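(* Let $n\geq 2$ and let $\{(X_i,x_i)\}_{i\in\mathbb{N}}$ be a family of pointed spaces such that each $X_i$ is an $(n-1)$-connected Tikhonov space which is locally strongly contractible at $x_i$ and first countable at $x_i$. Let $X=\widetilde{\bigvee}_{i\in\mathbb{N}}(X_i,x_i)$ be their weak join with common point $x_\ast$. Then $$\mathcal{H}_n(X,x_\ast)\cong \prod_{i\in\mathbb{N}}\ \prod^{w}_{k\in\mathbb{N}}\pi_n(X_i,x_i).$$
   Context: For $n\geq1$, the $n$-dimensional Hawaiian earring is $\mathbb{H}^n=\{(r_0,\dots,r_n)\in\mathbb{R}^{n+1} : (r_0-1/k)^2+\sum_{i=1}^n r_i^2=(1/k)^2 \text{ for some } k\in\mathbb{N}\}$ with base point $\theta=(0,\dots,0)$; $S^n_k$ denotes the $n$-sphere of radius $1/k$ in it. For a pointed space $(X,x_0)$, the $n$-Hawaiian group $\mathcal{H}_n(X,x_0)$ is the set of pointed homotopy classes (rel $\{\theta\}$) of continuous maps $f:(\mathbb{H}^n,\theta)\to(X,x_0)$, with the group operation $[f][g]=[f\ast g]$, where $(f\ast g)|_{S^n_k}$ is the usual concatenation (as in $\pi_n$, based at $\theta$) of $f|_{S^n_k}$ and $g|_{S^n_k}$ for every $k$. For a group $G$, $\prod^w_{k\in\mathbb{N}}G$ denotes the weak direct product (sequences with all but finitely many entries trivial). A pointed space $(Y,y_0)$ is locally strongly contractible at $y_0$ if for every neighborhood $U$ of $y_0$ there is a neighborhood $V\subseteq U$ of $y_0$ such that the inclusion $V\hookrightarrow U$ is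 homotopic in $U$ to the constant map at $y_0$ relative to $\{y_0\}$. The weak join $\widetilde{\bigvee}_{i\in\mathbb{N}}(X_i,x_i)$ is the set obtained from the disjoint union of the $X_i$ by identifying all $x_i$ to one point $x_\ast$, with the topology in which $U$ is open iff $U\cap X_i$ is open in $X_i$ for every $i$ and, whenever $x_\ast\in U$, $X_i\subseteq U$ for all but finitely many $i$. *)

theory Defs
  imports "HOL-Analysis.Analysis" "HOL-Algebra.Algebra"
begin

text \<open>Points of R^(n+1) are functions nat => real vanishing from index n+1 on
  (the library's Euclidean_space (Suc n)). The base point theta is the origin.\<close>

definition hw_base :: "nat \<Rightarrow> real" where
  "hw_base = (\<lambda>_. 0)"

definition hawaiian_set :: "nat \<Rightarrow> (nat \<Rightarrow> real) set" where
  "hawaiian_set n = {r. (\<forall>i>n. r i = 0) \<and>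
     (\<exists>k::nat. k \<ge> 1 \<and> (r 0 - 1 / real k)\<^sup>2 + (\<Sum>i\<in>{1..n}. (r i)\<^sup>2) = (1 / real k)\<^sup>2)}"

definition hawaiian_earring :: "nat \<Rightarrow> (nat \<Rightarrow> real) topology" where
  "hawaiian_earring n = subtopology (Euclidean_space (Suc n)) (hawaiian_set n)"

text \<open>The largest sphere S^n_1 of H^n (radius 1, through theta); used as the
  model n-sphere for pi_n.\<close>
definition base_sphere :: "nat \<Rightarrow> (nat \<Rightarrow> real) topology" where
  "base_sphere n = subtopology (Euclidean_space (Suc n))
     {r. (\<forall>i>n. r i = 0) \<and> (r 0 - 1)\<^sup>2 + (\<Sum>i\<in>{1..n}. (r i)\<^sup>2) = 1}"

text \<open>Fixed identification of the cube I^n with every sphere S^n_k (boundary to theta):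
  c_k(t) = inversion of (k/2, tan(pi(t_1 - 1/2)), ..., tan(pi(t_n - 1/2))),
  where inversion is v |-> v / |v|^2; inversion maps S^n_k - {theta} onto the
  hyperplane r_0 = k/2. Concatenation in the first cube coordinate t_1, as in pi_n.\<close>

definition hw_inversion :: "nat \<Rightarrow> (nat \<Rightarrow> real) \<Rightarrow> (nat \<Rightarrow> real)" where
  "hw_inversion n v = (\<lambda>i. v i / (\<Sum>j\<le>n. (v j)\<^sup>2))"

definition hw_concat :: "nat \<Rightarrow> ((nat \<Rightarrow> real) \<Rightarrow> 'a) \<Rightarrow> ((nat \<Rightarrow> real) \<Rightarrow> 'a)
      \<Rightarrow> (nat \<Rightarrow> real) \<Rightarrow> 'a" where
  "hw_concat n f g p =
     (if p = hw_base then f hw_base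
      else
        (let q = hw_inversion n p;
             t = arctan (q 1) / pi + 1 / 2;
             pt = (\<lambda>s::real. if s = 0 \<or> s = 1 then hw_base
                              else hw_inversion n (q(1 := tan (pi * (s - 1 / 2)))))
         in if t \<le> 1 / 2 then f (pt (2 * t)) else g (pt (2 * t - 1))))"

definition hw_class ::
  "(nat \<Rightarrow> real) topology \<Rightarrow> 'a topology \<Rightarrow> 'a \<Rightarrow> ((nat \<Rightarrow> real) \<Rightarrow> 'a)
     \<Rightarrow> ((nat \<Rightarrow> real) \<Rightarrow> 'a) set" where
  "hw_class D Top x0 f = {g. continuous_map D Top g \<and> g hw_base = x0 \<and>
       homotopic_with (\<lambda>h. h hw_base = x0) D Top f g}"

definition hw_group ::
  "(nat \<Rightarrow> real) topology \<Rightarrow> nat \<Rightarrow> 'a topology \<Rightarrow> 'a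
     \<Rightarrow> ((nat \<Rightarrow> real) \<Rightarrow> 'a) set monoid" where
  "hw_group D n Top x0 =
     \<lparr>carrier = {hw_class D Top x0 f | f. continuous_map D Top f \<and> f hw_base = x0},
      monoid.mult = (\<lambda>A B. hw_class D Top x0 (hw_concat n (SOME f. f \<in> A) (SOME g. g \<in> B))),
      one = hw_class D Top x0 (\<lambda>_. x0)\<rparr>"

definition hawaiian_group :: "nat \<Rightarrow> 'a topology \<Rightarrow> 'a \<Rightarrow> ((nat \<Rightarrow> real) \<Rightarrow> 'a) set monoid" where
  "hawaiian_group n Top x0 = hw_group (hawaiian_earring n) n Top x0"

definition homotopy_group :: "nat \<Rightarrow> 'a topology \<Rightarrow> 'a \<Rightarrow> ((nat \<Rightarrow> real) \<Rightarrow> 'a) set monoid" where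
  "homotopy_group n Top x0 = hw_group (base_sphere n) n Top x0"

definition connected_upto :: "nat \<Rightarrow> 'a topology \<Rightarrow> 'a \<Rightarrow> bool" where
  "connected_upto m Top x0 \<longleftrightarrow> path_connected_space Top \<and>
     (\<forall>k. 1 \<le> k \<and> k \<le> m \<longrightarrow> (\<exists>a. carrier (homotopy_group k Top x0) = {a}))"

definition tikhonov_space :: "'a topology \<Rightarrow> bool" where
  "tikhonov_space Top \<longleftrightarrow> completely_regular_space Top \<and> t1_space Top"

definition locally_strongly_contractible_at :: "'a topology \<Rightarrow> 'a \<Rightarrow> bool" where
  "locally_strongly_contractible_at Top y0 \<longleftrightarrow>
     (\<forall>U. openin Top U \<and> y0 \<in> U \<longrightarrow>
        (\<exists>V. openin Top V \<and> y0 \<in> V \<and> V \<subseteq> U \<and>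
             homotopic_with (\<lambda>h. h y0 = y0) (subtopology Top V) (subtopology Top U) (\<lambda>y. y) (\<lambda>_. y0)))"

definition first_countable_at :: "'a topology \<Rightarrow> 'a \<Rightarrow> bool" where
  "first_countable_at Top y0 \<longleftrightarrow>
     (\<exists>\<B>. countable \<B> \<and> (\<forall>V\<in>\<B>. openin Top V \<and> y0 \<in> V) \<and>
          (\<forall>U. openin Top U \<and> y0 \<in> U \<longrightarrow> (\<exists>V\<in>\<B>. V \<subseteq> U)))"

text \<open>Carrier: None is the common point x_*, Some (i,a) is a point a of X_i other than x_i.\<close>
definition wj_inj :: "(nat \<Rightarrow> 'a) \<Rightarrow> nat \<Rightarrow> 'a \<Rightarrow> (nat \<times> 'a) option" where
  "wj_inj x i a = (if a = x i then None else Some (i, a))"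

definition wj_carrier :: "(nat \<Rightarrow> 'a topology) \<Rightarrow> (nat \<Rightarrow> 'a) \<Rightarrow> (nat \<times> 'a) option set" where
  "wj_carrier Top x = insert None {Some (i, a) | i a. a \<in> topspace (Top i) \<and> a \<noteq> x i}"

definition wj_open :: "(nat \<Rightarrow> 'a topology) \<Rightarrow> (nat \<Rightarrow> 'a) \<Rightarrow> (nat \<times> 'a) option set \<Rightarrow> bool" where
  "wj_open Top x U \<longleftrightarrow> U \<subseteq> wj_carrier Top x \<and>
     (\<forall>i. openin (Top i) {a \<in> topspace (Top i). wj_inj x i a \<in> U}) \<and>
     (None \<in> U \<longrightarrow> finite {i. \<not> (wj_inj x i ` topspace (Top i) \<subseteq> U)})"

definition weak_join :: "(nat \<Rightarrow> 'a topology) \<Rightarrow> (nat \<Rightarrow> 'a) \<Rightarrow> (nat \<times> 'a) option topology" where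
  "weak_join Top x = topology (wj_open Top x)"

lemma istopology_wj_open: "istopology (wj_open Top x)"
  unfolding istopology_def
proof (intro conjI allI impI ballI)
  fix S T assume S: "wj_open Top x S" and T: "wj_open Top x T"
  have fin: "finite {i. \<not> (wj_inj x i ` topspace (Top i) \<subseteq> S \<inter> T)}" if "None \<in> S \<inter> T"
  proof -
    have "{i. \<not> (wj_inj x i ` topspace (Top i) \<subseteq> S \<inter> T)} \<subseteq>
          {i. \<not> (wj_inj x i ` topspace (Top i) \<subseteq> S)} \<union> {i. \<not> (wj_inj x i ` topspace (Top i) \<subseteq> T)}"
      by auto
    then show ?thesis using S T that unfolding wj_open_def by (meson IntD1 IntD2 finite_UnI finite_subset)
  qed
  have "{a \<in> topspace (Top i). wj_inj x i a \<in> S \<inter> T} =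
        {a \<in> topspace (Top i). wj_inj x i a \<in> S} \<inter> {a \<in> topspace (Top i). wj_inj x i a \<in> T}" for i
    by auto
  then show "wj_open Top x (S \<inter> T)"
    using S T fin unfolding wj_open_def by (auto intro: openin_Int)
next
  fix K assume K: "\<forall>S\<in>K. wj_open Top x S"
  have op: "openin (Top i) {a \<in> topspace (Top i). wj_inj x i a \<in> \<Union>K}" for i
  proof -
    have "{a \<in> topspace (Top i). wj_inj x i a \<in> \<Union>K} =
          \<Union>((\<lambda>S. {a \<in> topspace (Top i). wj_inj x i a \<in> S}) ` K)" by auto
    then show ?thesis using K unfolding wj_open_def by auto
  qed
  have fin: "finite {i. \<not> (wj_inj x i ` topspace (Top i) \<subseteq> \<Union>K)}" if N: "None \<in> \<Union>K"
  proof -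
    obtain S where "S \<in> K" "None \<in> S" using N by auto
    then have "finite {i. \<not> (wj_inj x i ` topspace (Top i) \<subseteq> S)}" using K unfolding wj_open_def by auto
    moreover have "{i. \<not> (wj_inj x i ` topspace (Top i) \<subseteq> \<Union>K)} \<subseteq> {i. \<not> (wj_inj x i ` topspace (Top i) \<subseteq> S)}"
      using \<open>S \<in> K\<close> by auto
    ultimately show ?thesis by (rule finite_subset[rotated])
  qed
  show "wj_open Top x (\<Union>K)" using K op fin unfolding wj_open_def by auto
qed

lemma openin_weak_join: "openin (weak_join Top x) U \<longleftrightarrow> wj_open Top x U"
  by (simp add: weak_join_def istopology_wj_open)

end

theory Submission
  imports Defs
begin

text \<open>
  The weak join is the subspace of the product of the spaces \<open>X\<^sub>i\<close> formed by the points with at most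
  one coordinate different from the base point, so a map into it is a family of maps \<open>f\<^sub>i\<close> with
  pairwise disjoint supports. On every sphere the classes of the \<open>f\<^sub>i\<close> give the isomorphism; they
  vanish for almost all spheres since \<open>X\<^sub>i\<close> is locally contractible, and they can be prescribed by
  placing maps side by side in disjoint slabs of the cube.

  For injectivity, let all \<open>f\<^sub>i\<close> be nullhomotopic on a sphere, seen as a cube. Connectivity allows one
  to make \<open>f\<^sub>i\<close> trivial on the walls of a fine grid \<open>\<Gamma>\<^sub>i\<close> without enlarging its support, where the
  walls of \<open>\<Gamma>\<^sub>j\<close> contain the bisecting hyperplanes of \<open>\<Gamma>\<^sub>i\<close> for all \<open>j > i\<close>, and to choose a nullhomotopy
  \<open>F\<close> of \<open>f\<^sub>i\<close> that is trivial on the vertices of \<open>\<Gamma>\<^sub>i\<close>. Let \<open>r\<close> collapse, in every coordinate, a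
  neighbourhood of the walls onto the walls, and let \<open>s\<close> collapse the rest onto the bisecting
  hyperplanes. A point whose coordinates all lie near walls is sent by \<open>r\<close> to a vertex, and any other
  point is sent by \<open>s\<close> to a bisecting hyperplane. So \<open>F \<circ> r\<close> is disjoint from \<open>f\<^sub>j \<circ> s\<close>, and \<open>f\<^sub>i\<close> can be
  removed from the family. Doing this for \<open>i = 0, 1, 2, \<dots>\<close> in shorter and shorter time intervals is
  continuous, because every coordinate is moved only finitely often.
\<close>

text \<open>The obstacle is disjointness of supports: a nullhomotopy of a single
  \<open>f\<^sub>i\<close> may sweep over the whole cube and meet the supports of infinitely many
  other maps, which can lie arbitrarily close to its own. Time is treated as one more coordinate of
  the cube: above a vertex the nullhomotopy is a loop, and such loops can be contracted because
  \<open>n \<ge> 2\<close>; the walls consist of cells of dimension at most \<open>n - 1\<close>.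
  The relation between walls and bisecting hyperplanes holds for grids whose meshes are strictly
  decreasing powers of 1/2. Room for cellwise deformations comes from complete regularity and local
  contractibility together: each support is first shrunk so far that every cell of a fine grid
  meeting the shrunk support lies in the original one. Passing from one sphere to all of them needs
  control of size near the base point, which nullhomotopies chosen sphere by sphere do not provide.
  Therefore each \<open>f\<^sub>i\<close> is first made constant on almost all spheres, and every
  later homotopy leaves it constant there.\<close>

type_synonym point = "nat \<Rightarrow> real"


section \<open>Continuous maps and homotopies on a type-class domain\<close>

lemma continuous_map_compose_on:
  assumes "continuous_map euclidean T h" "continuous_on UNIV \<phi>"
  shows "continuous_map euclidean T (\<lambda>x. h (\<phi> x))"
proof -
  have "continuous_map euclidean euclidean \<phi>" using assms(2) by simp
  from continuous_map_compose[OF this assms(1)] show ?thesis by (simp add: o_def)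
qed

lemma continuous_map_paste:
  fixes A B :: "'z::topological_space set"
  assumes "continuous_map euclidean T f" "continuous_map euclidean T g"
    and "closed A" "closed B" "A \<union> B = UNIV" and "\<And>x. x \<in> A \<Longrightarrow> x \<in> B \<Longrightarrow> f x = g x"
  shows "continuous_map euclidean T (\<lambda>x. if x \<in> A then f x else g x)"
proof (rule pasting_lemma_closed[where I = "{True,False}" and T = "\<lambda>b. if b then A else B"
        and f = "\<lambda>b. if b then f else g"])
  show "\<exists>j. j \<in> {True, False} \<and> x \<in> (if j then A else B) \<and>
         (if x \<in> A then f x else g x) = (if j then f else g) x" for x
    using assms(5) by (cases "x \<in> A") auto
qed (use assms in \<open>auto intro: continuous_map_from_subtopology\<close>)

text \<open>Clamping time to the unit interval makes a homotopy total on
  \<open>real \<times> 'z\<close>, so later continuity arguments avoid subspaces and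
  \<open>P\<close> is available at every real time.\<close>

lemma homotopic_with_extend:
  assumes "homotopic_with P (euclidean::'z::topological_space topology) T f g"
  obtains h where "continuous_map euclidean T (h :: real \<times> 'z \<Rightarrow> 'a)"
    "\<And>x. h (0,x) = f x" "\<And>x. h (1,x) = g x" "\<And>t. P (\<lambda>x. h (t,x))"
proof -
  obtain h where h: "continuous_map (prod_topology (top_of_set {0..1}) euclidean) T h"
    "\<And>x. h (0::real,x) = f x" "\<And>x. h (1,x) = g x" "\<And>t. t \<in> {0..1} \<Longrightarrow> P (\<lambda>x. h (t,x))"
    using assms unfolding homotopic_with_def by blast
  have "continuous_map euclidean (prod_topology (top_of_set {0..1}) euclidean)
      (\<lambda>z::real\<times>'z. (max 0 (min 1 (fst z)), snd z))"
    by (auto simp: continuous_map_pairwise o_def continuous_map_in_subtopology intro!: continuous_intros)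
  from continuous_map_compose[OF this h(1)]
  have "continuous_map euclidean T (\<lambda>z. h (max 0 (min 1 (fst z)), snd z))" by (simp add: o_def)
  then show ?thesis by (rule that) (use h in \<open>auto\<close>)
qed

lemma homotopic_withI:
  fixes h :: "real \<times> 'z::topological_space \<Rightarrow> 'a"
  assumes "continuous_map euclidean T h"
    "\<And>x. h (0,x) = f x" "\<And>x. h (1,x) = g x" "\<And>t. 0 \<le> t \<Longrightarrow> t \<le> 1 \<Longrightarrow> P (\<lambda>x. h (t,x))"
  shows "homotopic_with P euclidean T f g"
proof -
  have "continuous_map (prod_topology (top_of_set {0..1}) euclidean) T h"
    using assms(1) continuous_map_from_subtopology[of euclidean T h "{0..1} \<times> UNIV"]
    by (metis prod_topology_euclidean subtopology_Times subtopology_UNIV)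
  then show ?thesis unfolding homotopic_with_def using assms(2-4) by auto
qed

lemma continuous_on_apply: "continuous_on UNIV (\<lambda>x::point. x c)"
  by simp

lemma continuous_on_snd_apply: "continuous_on UNIV (\<lambda>z::'b::topological_space \<times> point. snd z c)"
  by (rule continuous_on_compose2[OF continuous_on_apply[of c], of UNIV snd]) (auto intro: continuous_intros)

section \<open>The collapse of a real line onto its integers\<close>

text \<open>A triangle wave: \<open>x - wig x\<close> collapses a neighbourhood of every integer,
  \<open>x + wig x\<close> a neighbourhood of every half-integer, and these neighbourhoods cover the line.\<close>

definition wig :: "real \<Rightarrow> real" where
  "wig x = arcsin (sin (2 * pi * x)) / (2 * pi)"

lemma continuous_on_wig [continuous_intros]:
  fixes f :: "'z::t2_space \<Rightarrow> real"
  shows "continuous_on S f \<Longrightarrow> continuous_on S (\<lambda>x. wig (f x))"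
  unfolding wig_def by (intro continuous_intros) auto

lemma wig_shift: "wig x = wig (x - of_int k)"
proof -
  have "sin (2 * pi * (x - of_int k)) = sin (2 * pi * x - 2 * pi * of_int k)"
    by (simp add: algebra_simps)
  also have "\<dots> = sin (2 * pi * x)"
    by (simp add: sin_diff)
  finally show ?thesis by (simp add: wig_def)
qed

lemma wig_near_int: assumes "\<bar>x - of_int k\<bar> \<le> 1/4" shows "wig x = x - of_int k"
proof -
  define u where "u = x - of_int k"
  have "\<bar>2 * pi * u\<bar> \<le> pi/2" using assms pi_gt_zero by (simp add: abs_mult u_def)
  then have "arcsin (sin (2 * pi * u)) = 2 * pi * u" by (intro arcsin_sin) linarith+
  then have "wig u = u" by (simp add: wig_def)
  then show ?thesis using wig_shift[of x k] by (simp add: u_def)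
qed

lemma wig_near_half: assumes "\<bar>x - of_int k - 1/2\<bar> \<le> 1/4" shows "wig x = of_int k + 1/2 - x"
proof -
  define u where "u = x - of_int k - 1/2"
  have "\<bar>2 * pi * u\<bar> \<le> pi/2" using assms pi_gt_zero by (simp add: abs_mult u_def)
  then have *: "arcsin (sin (- (2 * pi * u))) = - (2 * pi * u)" by (intro arcsin_sin) linarith+
  have "sin (2 * pi * (u + 1/2)) = sin (2 * pi * u + pi)" by (simp add: algebra_simps)
  also have "\<dots> = sin (- (2 * pi * u))" by simp
  finally have "wig (u + 1/2) = - u" using * by (simp add: wig_def)
  moreover have "u + 1/2 = x - of_int k" by (simp add: u_def)
  ultimately show ?thesis using wig_shift[of x k] by (simp add: u_def)
qed

lemma abs_wig_le: "\<bar>wig x\<bar> \<le> \<bar>x - of_int k\<bar>"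
proof (cases "\<bar>x - of_int k\<bar> \<le> 1/4")
  case False
  have "\<bar>arcsin (sin (2 * pi * x))\<bar> \<le> pi/2"
    using arcsin_bounded[of "sin (2 * pi * x)"] by auto
  then have "\<bar>wig x\<bar> \<le> 1/4" unfolding wig_def by (simp add: field_simps)
  then show ?thesis using False by linarith
qed (simp add: wig_near_int)

lemma wig_cases: "(\<exists>k. x - wig x = of_int k) \<or> (\<exists>k. x + wig x = of_int k + 1/2)"
proof -
  define k where "k = \<lfloor>x\<rfloor>"
  have k: "of_int k \<le> x" "x < of_int k + 1" unfolding k_def by linarith+
  consider "\<bar>x - of_int k\<bar> \<le> 1/4" | "\<bar>x - of_int k - 1/2\<bar> \<le> 1/4" | "\<bar>x - of_int (k+1)\<bar> \<le> 1/4"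
    using k unfolding of_int_add of_int_1 by linarith
  then show ?thesis
  proof cases
    case 1 then show ?thesis using wig_near_int[of x k] by auto
  next
    case 2 then show ?thesis using wig_near_half[of x k] by auto
  next
    case 3
    then have "x - wig x = of_int (k+1)" using wig_near_int[of x "k+1"] by simp
    then show ?thesis by blast
  qed
qed

text \<open>A displacement no longer than the distance to an integer cannot carry a point across it;
  this is what keeps every grid cell invariant.\<close>

lemma wig_between:
  assumes "0 \<le> t" "t \<le> 1"
  shows "of_int k \<le> x \<Longrightarrow> of_int k \<le> x - t * wig x" "x \<le> of_int k \<Longrightarrow> x - t * wig x \<le> of_int k"
    "of_int k \<le> x \<Longrightarrow> of_int k \<le> x + t * wig x" "x \<le> of_int k \<Longrightarrow> x + t * wig x \<le> of_int k"
proof -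
  have "\<bar>t * wig x\<bar> \<le> 1 * \<bar>x - of_int k\<bar>"
    unfolding abs_mult using assms abs_wig_le[of x k] by (intro mult_mono) auto
  then have *: "\<bar>t * wig x\<bar> \<le> \<bar>x - of_int k\<bar>" by simp
  show "of_int k \<le> x - t * wig x" "of_int k \<le> x + t * wig x" if "of_int k \<le> x"
    using * that by linarith+
  show "x - t * wig x \<le> of_int k" "x + t * wig x \<le> of_int k" if "x \<le> of_int k"
    using * that by linarith+
qed

section \<open>Cubical grids\<close>

text \<open>Encodes a map on a finite-dimensional space as a map on all sequences, so that cubes of
  every dimension share one type.\<close>

definition depends_on :: "nat set \<Rightarrow> (point \<Rightarrow> 'a) \<Rightarrow> bool" where
  "depends_on I g \<longleftrightarrow> (\<forall>x y. (\<forall>c\<in>I. x c = y c) \<longrightarrow> g x = g y)"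

lemma depends_onD: "depends_on I g \<Longrightarrow> (\<And>c. c \<in> I \<Longrightarrow> x c = y c) \<Longrightarrow> g x = g y"
  by (auto simp: depends_on_def)

text \<open>The coordinates in \<open>J\<close> are frozen at integers, so the cell has dimension
  \<open>card (I - J)\<close>, and enlarging \<open>J\<close> passes to a face.\<close>

definition grid_cell :: "nat set \<Rightarrow> nat set \<Rightarrow> (nat \<Rightarrow> int) \<Rightarrow> point set" where
  "grid_cell I J l =
     {x. \<forall>c\<in>I. if c \<in> J then x c = of_int (l c) else of_int (l c) \<le> x c \<and> x c \<le> of_int (l c) + 1}"

definition grid_cells :: "nat set \<Rightarrow> point set set" where
  "grid_cells I = {grid_cell I J l | J l. True}"

text \<open>In units of the grid, \<open>t = 1\<close> is the collapse \<open>r\<close> of the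
  overview and \<open>t = -1\<close> the collapse \<open>s\<close>.\<close>

definition wiggle :: "real \<Rightarrow> point \<Rightarrow> point" where
  "wiggle t x = (\<lambda>c. x c - t * wig (x c))"

lemma wiggle_in_cell:
  assumes "Q \<in> grid_cells I" "x \<in> Q" "\<bar>t\<bar> \<le> 1" shows "wiggle t x \<in> Q"
proof -
  obtain J l where Q: "Q = grid_cell I J l" using assms(1) by (auto simp: grid_cells_def)
  have bd: "of_int k \<le> u \<Longrightarrow> of_int k \<le> u - t * wig u" "u \<le> of_int k \<Longrightarrow> u - t * wig u \<le> of_int k"
    for u :: real and k :: int
    using wig_between[where t = t and k = k and x = u] wig_between[where t = "- t" and k = k and x = u] assms(3)
    by (cases "t \<ge> 0"; force)+
  have "wiggle t x c = of_int (l c)" if "x c = of_int (l c)" for c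
    unfolding wiggle_def using bd[where k = "l c" and u = "x c"] that by auto
  moreover have "of_int (l c) \<le> wiggle t x c \<and> wiggle t x c \<le> of_int (l c) + 1"
    if "of_int (l c) \<le> x c" "x c \<le> of_int (l c) + 1" for c
    unfolding wiggle_def using bd(1)[where k = "l c" and u = "x c"] bd(2)[where k = "l c + 1" and u = "x c"] that by auto
  ultimately show ?thesis using assms(2) unfolding Q grid_cell_def by auto
qed

lemma continuous_on_wiggle:
  fixes f :: "'z::t2_space \<Rightarrow> real"
  assumes "continuous_on UNIV f" "continuous_on UNIV g"
  shows "continuous_on UNIV (\<lambda>z. wiggle (f z) (g z))"
proof -
  have "continuous_on UNIV (\<lambda>z. g z c)" for c
    using continuous_on_compose2[OF continuous_on_apply[of c] assms(2)] by simp
  then show ?thesis unfolding wiggle_def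
    by (intro continuous_on_coordinatewise_then_product continuous_intros assms)
qed

text \<open>Vanishing of the homotopy in degrees at most \<open>m\<close>, for maps supported in a cube whose
  coordinates are indexed by an arbitrary finite set \<open>F\<close>.\<close>

definition nullable :: "nat \<Rightarrow> 'a topology \<Rightarrow> 'a \<Rightarrow> bool" where
  "nullable m T y \<longleftrightarrow> (\<forall>F g. finite F \<and> card F \<le> m \<and> continuous_map euclidean T g \<and> depends_on F g \<and>
      (\<forall>x. (\<exists>c\<in>F. x c \<le> 0 \<or> 1 \<le> x c) \<longrightarrow> g x = y) \<longrightarrow>
      (\<exists>G. continuous_map euclidean T (G :: real \<times> point \<Rightarrow> 'a) \<and> (\<forall>x. G (0,x) = g x) \<and>
         (\<forall>x. G (1,x) = y) \<and> (\<forall>t. depends_on F (\<lambda>x. G (t,x))) \<and>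
         (\<forall>t x. (\<exists>c\<in>F. x c \<le> 0 \<or> 1 \<le> x c) \<longrightarrow> G (t,x) = y)))"

text \<open>The control on supports: \<open>g\<close> may be nontrivial only in cells where
  \<open>a\<close> is already nontrivial somewhere.\<close>

definition cell_preserving :: "nat set \<Rightarrow> 'a \<Rightarrow> (point \<Rightarrow> 'a) \<Rightarrow> (point \<Rightarrow> 'a) \<Rightarrow> bool" where
  "cell_preserving I y a g \<longleftrightarrow> depends_on I g \<and>
     (\<forall>Q\<in>grid_cells I. (\<forall>x\<in>Q. a x = y) \<longrightarrow> (\<forall>x\<in>Q. g x = y))"

lemma cell_preserving_trans:
  "cell_preserving I y a b \<Longrightarrow> cell_preserving I y b c \<Longrightarrow> cell_preserving I y a c"
  unfolding cell_preserving_def by blast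

text \<open>After precomposition with \<open>wiggle 1\<close> the map near the cell factors through
  the cell, so a nullhomotopy on the cell extends to a neighbourhood; there it is run with a time
  that fades out in the normal directions.\<close>

lemma trivialize_cell:
  fixes a :: "point \<Rightarrow> 'a" and l :: "nat \<Rightarrow> int"
  assumes I: "finite I" and nul: "nullable m T y" and card: "card (I - J) \<le> m"
    and cont: "continuous_map euclidean T a" and dep: "depends_on I a"
    and bdry: "\<And>x c. x \<in> grid_cell I J l \<Longrightarrow> c \<in> I - J \<Longrightarrow> x c = of_int (l c) \<or> x c = of_int (l c) + 1 \<Longrightarrow> a x = y"
  shows "\<exists>a'. homotopic_with (cell_preserving I y a) euclidean T a a' \<and> (\<forall>x\<in>grid_cell I J l. a' x = y)"
proof (cases "\<forall>x\<in>grid_cell I J l. a x = y")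
  case True
  have "cell_preserving I y a a" using dep by (auto simp: cell_preserving_def)
  then show ?thesis using True cont by (intro exI[of _ a]) auto
next
  case nontriv: False
  define e where "e = grid_cell I J l"
  define F where "F = I - J"
  define cl where "cl = (\<lambda>u::real. max 0 (min 1 u))"
  \<comment> \<open>Parametrises the cell by the unit cube; the clamp sends points outside the cube
    to its boundary, where \<open>bdry\<close> makes \<open>a\<close> trivial.\<close>
  define ins where "ins = (\<lambda>x c. of_int (l c) + (if c \<in> F then cl (x c) else (0::real)))"
  define b where "b = (\<lambda>x. a (wiggle 1 x))"
  have dep': "a x = a z" if "\<And>c. c \<in> I \<Longrightarrow> x c = z c" for x z
    using dep that by (rule depends_onD)
  have ab: "homotopic_with (cell_preserving I y a) euclidean T a b"
  proof (rule homotopic_withI)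
    show "continuous_map euclidean T (\<lambda>z::real \<times> point. a (wiggle (fst z) (snd z)))"
      by (intro continuous_map_compose_on[OF cont] continuous_on_wiggle continuous_intros)
    show "cell_preserving I y a (\<lambda>x. a (wiggle (fst (t, x)) (snd (t, x))))" if "0 \<le> t" "t \<le> 1" for t
      unfolding cell_preserving_def depends_on_def
      using wiggle_in_cell[of _ I _ t] that by (auto intro!: dep' simp: wiggle_def)
  qed (auto simp: wiggle_def b_def)
  have ins_e: "ins x \<in> e" for x unfolding ins_def e_def grid_cell_def F_def cl_def by auto
  have g0: "a (ins x) = y" if "c \<in> F" "x c \<le> 0 \<or> 1 \<le> x c" for x c
    by (rule bdry[of _ c]) (use ins_e[of x] that in \<open>auto simp: e_def F_def, auto simp: ins_def cl_def F_def\<close>)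
  have cins: "continuous_on UNIV ins" unfolding ins_def cl_def
    by (intro continuous_on_coordinatewise_then_product, rename_tac c, case_tac "c \<in> F")
       (auto intro!: continuous_intros)
  have "finite F" "card F \<le> m" using I card by (auto simp: F_def)
  moreover have "continuous_map euclidean T (\<lambda>x. a (ins x))"
    by (rule continuous_map_compose_on[OF cont cins])
  moreover have "depends_on F (\<lambda>x. a (ins x))"
    unfolding depends_on_def by (auto intro!: dep' simp: ins_def)
  ultimately have "\<exists>G. continuous_map euclidean T (G :: real \<times> point \<Rightarrow> 'a) \<and> (\<forall>x. G (0,x) = a (ins x)) \<and>
         (\<forall>x. G (1,x) = y) \<and> (\<forall>t. depends_on F (\<lambda>x. G (t,x))) \<and>
         (\<forall>t x. (\<exists>c\<in>F. x c \<le> 0 \<or> 1 \<le> x c) \<longrightarrow> G (t,x) = y)"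
    using nul[unfolded nullable_def, rule_format, of F "\<lambda>x. a (ins x)"] g0 by blast
  then obtain G where G: "continuous_map euclidean T (G :: real \<times> point \<Rightarrow> 'a)"
    "\<And>x. G (0,x) = a (ins x)" "\<And>x. G (1,x) = y" "\<And>t. depends_on F (\<lambda>x. G (t,x))"
    "\<And>t x c. c \<in> F \<Longrightarrow> x c \<le> 0 \<or> 1 \<le> x c \<Longrightarrow> G (t,x) = y"
    by blast
  define sh where "sh = (\<lambda>x c. wiggle 1 x c - of_int (l c))"
  \<comment> \<open>A bump that is 1 on the cell and 0 once a frozen coordinate is 1/4 away, which
    is the radius within which \<open>wiggle 1\<close> collapses onto integers.\<close>
  define tau where "tau = (\<lambda>x::point. \<Prod>c\<in>I \<inter> J. max 0 (1 - 4 * \<bar>x c - of_int (l c)\<bar>))"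
  define N where "N = {x::point. (\<forall>c\<in>I\<inter>J. \<bar>x c - of_int (l c)\<bar> \<le> 1/4) \<and>
       (\<forall>c\<in>F. of_int (l c) \<le> x c \<and> x c \<le> of_int (l c) + 1)}"
  define M where "M = {x::point. (\<exists>c\<in>I\<inter>J. \<bar>x c - of_int (l c)\<bar> \<ge> 1/4) \<or>
       (\<exists>c\<in>F. x c \<le> of_int (l c) \<or> x c \<ge> of_int (l c) + 1)}"
  have fin: "finite (I \<inter> J)" "finite F" using I by (auto simp: F_def)
  have clN: "closed N"
  proof -
    have "N = (\<Inter>c\<in>I\<inter>J. {x. \<bar>x c - of_int (l c)\<bar> \<le> 1/4}) \<inter> (\<Inter>c\<in>F. {x. of_int (l c) \<le> x c \<and> x c \<le> of_int (l c) + 1})"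
      by (auto simp: N_def)
    then show ?thesis
      by (simp only:) (intro closed_Int closed_INT ballI closed_Collect_conj closed_Collect_le continuous_intros continuous_on_apply)
  qed
  have clM: "closed M"
  proof -
    have "M = (\<Union>c\<in>I\<inter>J. {x. \<bar>x c - of_int (l c)\<bar> \<ge> 1/4}) \<union> (\<Union>c\<in>F. {x. x c \<le> of_int (l c)} \<union> {x. x c \<ge> of_int (l c) + 1})"
      by (auto simp: M_def)
    then show ?thesis
      by (simp only:) (intro closed_Un closed_UN fin ballI closed_Collect_le continuous_intros continuous_on_apply)
  qed
  have "x \<in> N" if "x \<notin> M" for x
    unfolding N_def
  proof (intro CollectI conjI ballI)
    show "\<bar>x c - of_int (l c)\<bar> \<le> 1/4" if "c \<in> I \<inter> J" for c
      using that \<open>x \<notin> M\<close> unfolding M_def mem_Collect_eq by (meson linear)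
    show "of_int (l c) \<le> x c" "x c \<le> of_int (l c) + 1" if "c \<in> F" for c
      using that \<open>x \<notin> M\<close> unfolding M_def mem_Collect_eq by (meson linear)+
  qed
  then have NM: "N \<union> M = UNIV" by blast
  have wigN: "wiggle 1 x \<in> e" if "x \<in> N" for x
  proof -
    have "wiggle 1 x c = of_int (l c)" if "c \<in> I \<inter> J" for c
      using \<open>x \<in> N\<close> that wig_near_int[of "x c" "l c"] by (auto simp: N_def wiggle_def)
    moreover have "of_int (l c) \<le> wiggle 1 x c \<and> wiggle 1 x c \<le> of_int (l c) + 1" if "c \<in> F" for c
      using \<open>x \<in> N\<close> that wig_between(1)[where t = 1 and k = "l c" and x = "x c"] wig_between(2)[where t = 1 and k = "l c + 1" and x = "x c"]
      by (auto simp: N_def wiggle_def)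
    ultimately show ?thesis unfolding e_def grid_cell_def F_def by auto
  qed
  have insN: "a (ins (sh x)) = b x" if "x \<in> N" for x
    unfolding b_def
  proof (rule dep')
    fix c assume "c \<in> I"
    then show "ins (sh x) c = wiggle 1 x c"
      using wigN[OF that] unfolding e_def grid_cell_def F_def ins_def sh_def cl_def
      by (cases "c \<in> J") (auto dest!: bspec[of _ _ c])
  qed
  define H where "H = (\<lambda>z. if z \<in> UNIV \<times> N then G (fst z * tau (snd z), sh (snd z)) else b (snd z))"
  have ctau: "continuous_on UNIV (\<lambda>z::real \<times> point. tau (snd z))" unfolding tau_def
    by (intro continuous_intros continuous_on_snd_apply)
  have csh: "continuous_on UNIV (\<lambda>z::real \<times> point. sh (snd z))" unfolding sh_def
    by (intro continuous_on_coordinatewise_then_product continuous_intros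
          continuous_on_product_then_coordinatewise[OF continuous_on_wiggle])
  have bF: "b x = y" and GF: "G (s, sh x) = y"
    if "x \<in> N" "c \<in> F" "wiggle 1 x c \<le> of_int (l c) \<or> wiggle 1 x c \<ge> of_int (l c) + 1" for s x c
  proof -
    have w: "wiggle 1 x \<in> e" using that(1) by (rule wigN)
    then have "wiggle 1 x c = of_int (l c) \<or> wiggle 1 x c = of_int (l c) + 1"
      using that(2,3) unfolding e_def grid_cell_def F_def by force
    then show "b x = y" unfolding b_def using bdry[of "wiggle 1 x" c] w that(2) by (auto simp: e_def F_def)
    show "G (s, sh x) = y" by (rule G(5)[OF that(2)]) (use that(3) in \<open>auto simp: sh_def\<close>)
  qed
  have wint: "wiggle 1 x c = x c" if "x c = of_int k" for x c k
    using that wig_near_int[of "x c" k] by (simp add: wiggle_def)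
  have H0: "H (0,x) = b x" for x unfolding H_def by (auto simp: G(2) insN)
  have contH: "continuous_map euclidean T H" unfolding H_def
  proof (rule continuous_map_paste[where B = "UNIV \<times> M"])
    show "continuous_map euclidean T (\<lambda>z. G (fst z * tau (snd z), sh (snd z)))"
      by (intro continuous_map_compose_on[OF G(1)] continuous_intros ctau csh)
    show "continuous_map euclidean T (\<lambda>z::real \<times> point. b (snd z))" unfolding b_def
      by (intro continuous_map_compose_on[OF cont] continuous_on_wiggle continuous_intros)
    show "closed (UNIV \<times> N :: (real \<times> point) set)" "closed (UNIV \<times> M :: (real \<times> point) set)"
      using clN clM by (auto intro: closed_Times)
    show "UNIV \<times> N \<union> UNIV \<times> M = (UNIV :: (real \<times> point) set)" using NM by auto
    fix z :: "real \<times> point" assume "z \<in> UNIV \<times> N" "z \<in> UNIV \<times> M"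
    then obtain t x where z: "z = (t,x)" "x \<in> N" "x \<in> M" by auto
    show "G (fst z * tau (snd z), sh (snd z)) = b (snd z)"
    proof (cases "\<exists>c\<in>I\<inter>J. \<bar>x c - of_int (l c)\<bar> \<ge> 1/4")
      case True
      then obtain c where "c \<in> I \<inter> J" "max 0 (1 - 4 * \<bar>x c - of_int (l c)\<bar>) = 0" by force
      then have "tau x = 0" unfolding tau_def using fin(1) by (intro prod_zero) blast+
      then show ?thesis using insN[OF z(2)] by (simp add: z G(2))
    next
      case False
      then obtain c where c: "c \<in> F" "x c \<le> of_int (l c) \<or> x c \<ge> of_int (l c) + 1"
        using z(3) by (auto simp: M_def)
      have "x c = of_int (l c) \<or> x c = of_int (l c + 1)" using z(2) c by (auto simp: N_def)
      then have "wiggle 1 x c = x c" using wint by blast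
      then show ?thesis using bF[OF z(2) c(1)] GF[OF z(2) c(1)] c(2) by (simp add: z)
    qed
  qed
  have "homotopic_with (cell_preserving I y a) euclidean T b (\<lambda>x. H (1,x))"
  proof (rule homotopic_withI[OF contH H0 refl])
    fix t :: real
    show "cell_preserving I y a (\<lambda>x. H (t, x))" unfolding cell_preserving_def
    proof (intro conjI ballI impI)
      show "depends_on I (\<lambda>x. H (t, x))" unfolding depends_on_def
      proof (intro allI impI)
        fix x z :: "point" assume xz: "\<forall>c\<in>I. x c = z c"
        then have 1: "x \<in> N \<longleftrightarrow> z \<in> N" "tau x = tau z" by (auto simp: N_def F_def tau_def)
        have 2: "b x = b z" unfolding b_def by (rule dep') (simp add: wiggle_def xz)
        have 3: "G (s, sh x) = G (s, sh z)" for s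
          by (rule depends_onD[OF G(4)]) (use xz in \<open>auto simp: F_def sh_def wiggle_def\<close>)
        show "H (t,x) = H (t,z)" unfolding H_def using 1 2 3 by simp
      qed
      fix Q x assume Q: "Q \<in> grid_cells I" "\<forall>x\<in>Q. a x = y" "x \<in> Q"
      have w: "wiggle 1 x \<in> Q" by (rule wiggle_in_cell[OF Q(1,3)]) simp
      show "H (t,x) = y"
      proof (cases "x \<in> N")
        case False
        then show ?thesis using w Q(2) by (simp add: H_def b_def)
      next
        case True
        \<comment> \<open>If \<open>wiggle 1 x\<close> were interior to \<open>e\<close> in all free
          directions, the cell \<open>Q\<close> through it would contain all of \<open>e\<close>;
          but \<open>a\<close> is trivial on \<open>Q\<close> and nontrivial somewhere on
          \<open>e\<close>.\<close>
        have "\<exists>c\<in>F. wiggle 1 x c \<le> of_int (l c) \<or> wiggle 1 x c \<ge> of_int (l c) + 1"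
        proof (rule ccontr)
          assume "\<not> ?thesis"
          then have int: "of_int (l c) < wiggle 1 x c" "wiggle 1 x c < of_int (l c) + 1" if "c \<in> F" for c
            using that by force+
          obtain J' l' where Q': "Q = grid_cell I J' l'" using Q(1) by (auto simp: grid_cells_def)
          have "z \<in> Q" if z: "z \<in> e" for z
            unfolding Q' grid_cell_def
          proof (clarify)
            fix c assume c: "c \<in> I"
            have we: "wiggle 1 x \<in> e" by (rule wigN[OF True])
            have wQ: "if c \<in> J' then wiggle 1 x c = of_int (l' c) else of_int (l' c) \<le> wiggle 1 x c \<and> wiggle 1 x c \<le> of_int (l' c) + 1"
              using w c unfolding Q' grid_cell_def by auto
            show "if c \<in> J' then z c = of_int (l' c) else of_int (l' c) \<le> z c \<and> z c \<le> of_int (l' c) + 1"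
            proof (cases "c \<in> J")
              case True
              then have "z c = wiggle 1 x c" using z we c by (auto simp: e_def grid_cell_def)
              then show ?thesis using wQ by simp
            next
              case False
              then have cF: "c \<in> F" using c by (simp add: F_def)
              have zc: "of_int (l c) \<le> z c" "z c \<le> of_int (l c) + 1"
                using z c False by (auto simp: e_def grid_cell_def)
              have "c \<notin> J'"
              proof
                assume "c \<in> J'"
                then have "real_of_int (l c) < of_int (l' c)" "real_of_int (l' c) < of_int (l c + 1)"
                  using wQ int[OF cF] by auto
                then show False unfolding of_int_less_iff by linarith
              qed
              moreover have "l' c = l c"
              proof -
                have "real_of_int (l' c) < of_int (l c + 1)" "real_of_int (l c) < of_int (l' c + 1)"
                  using wQ int[OF cF] \<open>c \<notin> J'\<close> by auto
                then show ?thesis unfolding of_int_less_iff by linarith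
              qed
              ultimately show ?thesis using zc by simp
            qed
          qed
          then show False using nontriv Q(2) by (auto simp: e_def)
        qed
        then show ?thesis using GF[OF True] True by (auto simp: H_def)
      qed
    qed
  qed
  then have "homotopic_with (cell_preserving I y a) euclidean T a (\<lambda>x. H (1,x))"
    using ab homotopic_with_trans by blast
  moreover have "H (1,x) = y" if "x \<in> e" for x
  proof -
    have "tau x = 1" unfolding tau_def
      by (rule prod.neutral) (use that in \<open>auto simp: e_def grid_cell_def\<close>)
    moreover have "x \<in> N" using that by (force simp: N_def e_def grid_cell_def F_def)
    ultimately show ?thesis by (simp add: H_def G(3))
  qed
  ultimately show ?thesis by (auto simp: e_def)
qed

text \<open>Induction on the number of cells of \<open>\<E>\<close> on which the map is nontrivial.
  One of least dimension among them has trivial faces, so \<open>trivialize_cell\<close> applies to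
  it, and cell preservation keeps all trivial cells trivial.\<close>

lemma trivialize_cells:
  fixes a :: "point \<Rightarrow> 'a" and \<E> :: "(nat set \<times> (nat \<Rightarrow> int)) set"
  assumes I: "finite I" and nul: "nullable m T y" and \<E>: "finite \<E>"
    and card: "\<And>J l. (J,l) \<in> \<E> \<Longrightarrow> card (I - J) \<le> m"
    and cont: "continuous_map euclidean T a" and dep: "depends_on I a"
    and faces: "\<And>J l c v. (J,l) \<in> \<E> \<Longrightarrow> c \<in> I - J \<Longrightarrow> v = l c \<or> v = l c + 1 \<Longrightarrow>
        (insert c J, l(c := v)) \<in> \<E> \<or> (\<forall>x\<in>grid_cell I (insert c J) (l(c := v)). a x = y)"
  shows "\<exists>a'. homotopic_with (cell_preserving I y a) euclidean T a a' \<and>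
           (\<forall>(J,l)\<in>\<E>. \<forall>x\<in>grid_cell I J l. a' x = y)"
  using cont dep faces
proof (induction "card {(J,l)\<in>\<E>. \<not> (\<forall>x\<in>grid_cell I J l. a x = y)}" arbitrary: a rule: less_induct)
  case less
  define B where "B = (\<lambda>a::point\<Rightarrow>'a. {(J,l)\<in>\<E>. \<not> (\<forall>x\<in>grid_cell I J l. a x = y)})"
  have self: "cell_preserving I y a a" using less.prems(2) by (auto simp: cell_preserving_def)
  have finB: "finite (B a)" for a using \<E> by (rule finite_subset[rotated]) (auto simp: B_def)
  show ?case
  proof (cases "B a = {}")
    case True
    then show ?thesis using less.prems(1) self by (intro exI[of _ a]) (auto simp: B_def)
  next
    case False
    then obtain e where e: "e \<in> B a" "\<And>e'. e' \<in> B a \<Longrightarrow> card (I - fst e) \<le> card (I - fst e')"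
      using ex_has_least_nat[of "\<lambda>e. e \<in> B a" _ "\<lambda>e. card (I - fst e)"] by blast
    obtain J l where Jl: "e = (J,l)" by force
    have JlE: "(J,l) \<in> \<E>" using e(1) Jl by (auto simp: B_def)
    have "\<exists>a'. homotopic_with (cell_preserving I y a) euclidean T a a' \<and> (\<forall>x\<in>grid_cell I J l. a' x = y)"
    proof (rule trivialize_cell[OF I nul card[OF JlE] less.prems(1,2)])
      fix x c assume x: "x \<in> grid_cell I J l" and c: "c \<in> I - J"
        and xc: "x c = of_int (l c) \<or> x c = of_int (l c) + 1"
      define v where "v = (if x c = of_int (l c) then l c else l c + 1)"
      have xv: "x c = of_int v" using xc by (auto simp: v_def)
      have xin: "x \<in> grid_cell I (insert c J) (l(c := v))"
        using x xv c unfolding grid_cell_def by auto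
      have "card (I - insert c J) < card (I - J)"
        using c I by (intro psubset_card_mono) auto
      then have "(insert c J, l(c := v)) \<notin> B a" using e(2) Jl by force
      moreover have "(insert c J, l(c := v)) \<in> \<E> \<or> (\<forall>x\<in>grid_cell I (insert c J) (l(c := v)). a x = y)"
        by (rule less.prems(3)[OF JlE c]) (auto simp: v_def)
      ultimately show "a x = y" using xin by (auto simp: B_def)
    qed
    then obtain a' where a': "homotopic_with (cell_preserving I y a) euclidean T a a'"
      "\<forall>x\<in>grid_cell I J l. a' x = y" by blast
    have cp: "cell_preserving I y a a'" using homotopic_with_imp_property[OF a'(1)] by blast
    have triv: "\<forall>x\<in>grid_cell I J' l'. a' x = y" if "\<forall>x\<in>grid_cell I J' l'. a x = y" for J' l'
      using cp that unfolding cell_preserving_def grid_cells_def by blast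
    have "B a' \<subseteq> B a" unfolding B_def using triv by blast
    moreover have "e \<in> B a - B a'" using e(1) a'(2) Jl by (auto simp: B_def)
    ultimately have "card (B a') < card (B a)" by (intro psubset_card_mono finB) auto
    then have "card {(J,l)\<in>\<E>. \<not> (\<forall>x\<in>grid_cell I J l. a' x = y)} < card {(J,l)\<in>\<E>. \<not> (\<forall>x\<in>grid_cell I J l. a x = y)}"
      by (simp add: B_def)
    then have "\<exists>a''. homotopic_with (cell_preserving I y a') euclidean T a' a'' \<and>
           (\<forall>(J,l)\<in>\<E>. \<forall>x\<in>grid_cell I J l. a'' x = y)"
    proof (rule less.hyps)
      show "continuous_map euclidean T a'" using homotopic_with_imp_continuous_maps[OF a'(1)] by blast
      show "depends_on I a'" using cp by (simp add: cell_preserving_def)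
      show "(insert c J, l(c := v)) \<in> \<E> \<or> (\<forall>x\<in>grid_cell I (insert c J) (l(c := v)). a' x = y)"
        if "(J, l) \<in> \<E>" "c \<in> I - J" "v = l c \<or> v = l c + 1" for J l c v
        using less.prems(3)[OF that] triv[of "insert c J" "l(c := v)"] by argo
    qed
    then obtain a'' where a'': "homotopic_with (cell_preserving I y a') euclidean T a' a''"
        "\<forall>(J,l)\<in>\<E>. \<forall>x\<in>grid_cell I J l. a'' x = y" by blast
    have "homotopic_with (cell_preserving I y a) euclidean T a' a''"
      using a''(1) by (rule homotopic_with_mono) (rule cell_preserving_trans[OF cp])
    from homotopic_with_trans[OF a'(1) this] a''(2) show ?thesis by blast
  qed
qed

section \<open>Cube maps\<close>

text \<open>Coordinates are numbered from 1; coordinate 0 stays free and serves as time in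
  \<open>push_off\<close>.\<close>

definition ocube :: "nat \<Rightarrow> point set" where
  "ocube n = {x. \<forall>c\<in>{1..n}. 0 < x c \<and> x c < 1}"

definition cube_map :: "nat \<Rightarrow> 'a \<Rightarrow> (point \<Rightarrow> 'a) \<Rightarrow> bool" where
  "cube_map n y g \<longleftrightarrow> depends_on {1..n} g \<and> (\<forall>x. x \<notin> ocube n \<longrightarrow> g x = y)"

lemma cube_map_outside:
  assumes "cube_map n y g" "c \<in> {1..n}" "x c \<le> 0 \<or> 1 \<le> x c"
  shows "g x = y"
proof -
  have "x \<notin> ocube n" using assms(2,3) by (auto simp: ocube_def intro!: bexI[of _ c])
  then show ?thesis using assms(1) by (simp add: cube_map_def)
qed

section \<open>Rescaling of the cube to integer grids\<close>

definition scal :: "real \<Rightarrow> point \<Rightarrow> point" where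
  "scal r x = (\<lambda>c. r * x c)"

lemma scal_inverse: "r \<noteq> 0 \<Longrightarrow> scal r (scal (1/r) x) = x" "r \<noteq> 0 \<Longrightarrow> scal (1/r) (scal r x) = x"
  by (auto simp: scal_def)

lemma continuous_on_scal:
  assumes "continuous_on UNIV g"
  shows "continuous_on UNIV (\<lambda>z. scal r (g z))"
proof -
  have "continuous_on UNIV (\<lambda>z. g z c)" for c
    using continuous_on_compose2[OF continuous_on_apply[of c] assms] by simp
  then show ?thesis unfolding scal_def
    by (intro continuous_on_coordinatewise_then_product continuous_intros)
qed

lemma continuous_on_upd:
  fixes f :: "'z::topological_space \<Rightarrow> real" and g :: "'z \<Rightarrow> point"
  assumes "continuous_on UNIV f" "continuous_on UNIV g"
  shows "continuous_on UNIV (\<lambda>z. (g z)(k := f z))"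
proof (rule continuous_on_coordinatewise_then_product)
  show "continuous_on UNIV (\<lambda>z. ((g z)(k := f z)) c)" for c
    using continuous_on_compose2[OF continuous_on_apply[of c] assms(2)] assms(1) by (cases "c = k") simp_all
qed

lemma in_grid_cell_floor: "x \<in> grid_cell I {} (\<lambda>d. \<lfloor>x d\<rfloor>)"
  by (simp add: grid_cell_def less_imp_le)

text \<open>Half spaces bounded by an integer hyperplane, and the hyperplane itself, are unions of
  cells.\<close>

lemma cell_preserving_halfspace:
  assumes "cell_preserving I y a g" "c \<in> I"
  shows "(\<And>x. x c \<le> of_int k \<Longrightarrow> a x = y) \<Longrightarrow> z c \<le> of_int k \<Longrightarrow> g z = y"
    "(\<And>x. x c \<ge> of_int k \<Longrightarrow> a x = y) \<Longrightarrow> z c \<ge> of_int k \<Longrightarrow> g z = y"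
    "(\<And>x. x c = of_int k \<Longrightarrow> a x = y) \<Longrightarrow> z c = of_int k \<Longrightarrow> g z = y"
proof -
  have *: "g z = y" if "z \<in> grid_cell I J l" "\<And>x. x \<in> grid_cell I J l \<Longrightarrow> a x = y" for J l
    using assms(1) that unfolding cell_preserving_def grid_cells_def by blast
  show "g z = y" if a: "\<And>x. x c \<le> of_int k \<Longrightarrow> a x = y" and z: "z c \<le> of_int k"
  proof (rule *)
    \<comment> \<open>Rounding up and subtracting 1, instead of rounding down, selects the lower of
      two adjacent cells when \<open>z c\<close> equals \<open>k\<close>.\<close>
    show "z \<in> grid_cell I {} (\<lambda>d. \<lceil>z d\<rceil> - 1)" by (auto simp: grid_cell_def)
    show "a x = y" if "x \<in> grid_cell I {} (\<lambda>d. \<lceil>z d\<rceil> - 1)" for x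
    proof (rule a)
      have "x c \<le> of_int \<lceil>z c\<rceil>" using that assms(2) by (auto simp: grid_cell_def)
      then show "x c \<le> of_int k" using z by (meson ceiling_le_iff of_int_le_iff order_trans)
    qed
  qed
  show "g z = y" if a: "\<And>x. x c \<ge> of_int k \<Longrightarrow> a x = y" and z: "z c \<ge> of_int k"
  proof (rule *)
    show "z \<in> grid_cell I {} (\<lambda>d. \<lfloor>z d\<rfloor>)" by (rule in_grid_cell_floor)
    show "a x = y" if "x \<in> grid_cell I {} (\<lambda>d. \<lfloor>z d\<rfloor>)" for x
    proof (rule a)
      have "x c \<ge> of_int \<lfloor>z c\<rfloor>" using that assms(2) by (auto simp: grid_cell_def)
      then show "x c \<ge> of_int k" using z by (meson le_floor_iff of_int_le_iff order_trans)
    qed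
  qed
  show "g z = y" if a: "\<And>x. x c = of_int k \<Longrightarrow> a x = y" and z: "z c = of_int k"
  proof (rule *)
    show "z \<in> grid_cell I {c} (\<lambda>d. \<lfloor>z d\<rfloor>)" using z by (simp add: grid_cell_def less_imp_le)
    show "a x = y" if "x \<in> grid_cell I {c} (\<lambda>d. \<lfloor>z d\<rfloor>)" for x
      by (rule a) (use that assms(2) z in \<open>auto simp: grid_cell_def\<close>)
  qed
qed

definition scaled_preserving :: "nat \<Rightarrow> nat \<Rightarrow> 'a \<Rightarrow> (point \<Rightarrow> 'a) \<Rightarrow> (point \<Rightarrow> 'a) \<Rightarrow> bool" where
  "scaled_preserving n N y a g \<longleftrightarrow>
     cell_preserving {1..n} y (\<lambda>z. a (scal (1 / real N) z)) (\<lambda>z. g (scal (1 / real N) z))"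

lemma scaled_preservingD:
  assumes "scaled_preserving n N y a g" "N > 0" "Q \<in> grid_cells {1..n}"
    "\<And>x. scal (real N) x \<in> Q \<Longrightarrow> a x = y" "scal (real N) x \<in> Q"
  shows "g x = y"
proof -
  have "\<forall>z\<in>Q. a (scal (1 / real N) z) = y" using assms by (auto simp: scal_inverse)
  then have "g (scal (1 / real N) (scal (real N) x)) = y"
    using assms unfolding scaled_preserving_def cell_preserving_def by blast
  then show ?thesis using assms(2) by (simp add: scal_inverse)
qed

text \<open>After stretching, the walls of the cube lie at 0 and \<open>N\<close>, hence on the
  grid, so its exterior consists of half spaces that are unions of cells.\<close>

lemma scaled_preserving_cube_map:
  assumes "scaled_preserving n N y a g" "N > 0" "cube_map n y a"
  shows "cube_map n y g"
proof -
  let ?a = "\<lambda>z. a (scal (1 / real N) z)" and ?g = "\<lambda>z. g (scal (1 / real N) z)"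
  have cp: "cell_preserving {1..n} y ?a ?g" using assms(1) by (simp add: scaled_preserving_def)
  have gs: "g x = ?g (scal (real N) x)" for x using assms(2) by (simp add: scal_inverse)
  have "depends_on {1..n} g"
    unfolding depends_on_def
  proof (intro allI impI)
    fix x z :: "point" assume "\<forall>c\<in>{1..n}. x c = z c"
    then have "\<forall>c\<in>{1..n}. scal (real N) x c = scal (real N) z c" by (simp add: scal_def)
    then have "?g (scal (real N) x) = ?g (scal (real N) z)"
      using cp unfolding cell_preserving_def depends_on_def by blast
    then show "g x = g z" using gs by metis
  qed
  moreover have "g x = y" if x: "x \<notin> ocube n" for x
  proof -
    obtain c where c: "c \<in> {1..n}" "x c \<le> 0 \<or> x c \<ge> 1" using x by (force simp: ocube_def)
    have out: "a w = y" if "w c \<le> 0 \<or> w c \<ge> 1" for w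
      using assms(3) c(1) that by (rule cube_map_outside)
    show ?thesis
    proof (cases "x c \<le> 0")
      case True
      have "?g (scal (real N) x) = y"
        by (rule cell_preserving_halfspace(1)[OF cp c(1), of 0])
           (use True assms(2) in \<open>auto simp: scal_def mult_le_0_iff divide_le_0_iff intro!: out\<close>)
      then show ?thesis using gs by simp
    next
      case False
      have "?g (scal (real N) x) = y"
        by (rule cell_preserving_halfspace(2)[OF cp c(1), of "int N"])
           (use False c(2) assms(2) in \<open>auto simp: scal_def le_divide_eq intro!: out\<close>)
      then show ?thesis using gs by simp
    qed
  qed
  ultimately show ?thesis by (simp add: cube_map_def)
qed

text \<open>Every cell on a wall has a frozen coordinate, hence dimension at most
  \<open>n - 1\<close>, which is the range of the connectivity hypothesis.\<close>

lemma trivialize_grid: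
  assumes nul: "nullable (n-1) T y" and cont: "continuous_map euclidean T a" and a: "cube_map n y a"
    and N: "N > 0"
  shows "\<exists>a'. homotopic_with (scaled_preserving n N y a) euclidean T a a' \<and>
     (\<forall>x c. c \<in> {1..n} \<longrightarrow> real N * x c \<in> \<int> \<longrightarrow> a' x = y)"
proof -
  define I where "I = {1..n}"
  define b where "b = (\<lambda>z. a (scal (1 / real N) z))"
  \<comment> \<open>The range of \<open>l\<close> makes this set finite. A face leaves it only with
    a frozen coordinate \<open>N + 1\<close>, which lies outside the stretched cube, where the map
    is trivial.\<close>
  define \<E> where "\<E> = {(J,l). J \<in> Pow I - {{}} \<and> l \<in> I \<rightarrow>\<^sub>E {0..int N}}"
  have out: "a w = y" if "c \<in> I" "w c \<le> 0 \<or> w c \<ge> 1" for w c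
    using a that unfolding I_def by (rule cube_map_outside)
  have "\<exists>b'. homotopic_with (cell_preserving I y b) euclidean T b b' \<and>
           (\<forall>(J,l)\<in>\<E>. \<forall>x\<in>grid_cell I J l. b' x = y)"
  proof (rule trivialize_cells[OF _ nul])
    show "finite I" by (simp add: I_def)
    have "\<E> = (Pow I - {{}}) \<times> (I \<rightarrow>\<^sub>E {0..int N})" by (auto simp: \<E>_def)
    then show "finite \<E>" by (simp add: I_def finite_PiE)
    show "card (I - J) \<le> n - 1" if "(J,l) \<in> \<E>" for J l
    proof -
      have "I - J \<subset> I" using that by (auto simp: \<E>_def)
      then have "card (I - J) < card I" by (intro psubset_card_mono) (auto simp: I_def)
      then show ?thesis by (simp add: I_def)
    qed
    show "continuous_map euclidean T b" unfolding b_def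
      by (intro continuous_map_compose_on[OF cont] continuous_on_scal continuous_intros)
    have "depends_on I a" using a by (simp add: cube_map_def I_def)
    then show "depends_on I b" unfolding b_def depends_on_def[of _ "\<lambda>z. a (scal (1 / real N) z)"]
      by (intro allI impI, elim depends_onD) (simp add: scal_def)
    fix J l c v assume Jl: "(J,l) \<in> \<E>" and c: "c \<in> I - J" and v: "v = l c \<or> v = l c + 1"
    have lc: "0 \<le> l c" "l c \<le> int N" using Jl c by (auto simp: \<E>_def PiE_iff)
    show "(insert c J, l(c := v)) \<in> \<E> \<or> (\<forall>x\<in>grid_cell I (insert c J) (l(c := v)). b x = y)"
    proof (cases "v \<le> int N")
      case True
      then have v01: "v \<in> {0..int N}" unfolding atLeastAtMost_iff using v lc by linarith
      have "l(c := v) \<in> I \<rightarrow>\<^sub>E {0..int N}"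
        using Jl c v01 PiE_fun_upd[of v "\<lambda>_. {0..int N}" c l I] by (simp add: \<E>_def insert_absorb)
      then have "(insert c J, l(c := v)) \<in> \<E>" using Jl c by (simp add: \<E>_def)
      then show ?thesis ..
    next
      case False
      have "b x = y" if "x\<in>grid_cell I (insert c J) (l(c := v))" for x
      proof -
        have xc: "x c = of_int v" using that c by (auto simp: grid_cell_def)
        have "real_of_int v > of_int (int N)" using False unfolding of_int_less_iff by simp
        then show ?thesis unfolding b_def using c N xc by (intro out[of c]) (auto simp: scal_def le_divide_eq)
      qed
      then show ?thesis by blast
    qed
  qed
  then obtain b' where b': "homotopic_with (cell_preserving I y b) euclidean T b b'"
    "\<forall>(J,l)\<in>\<E>. \<forall>x\<in>grid_cell I J l. b' x = y" by (elim exE conjE)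
  have b'2: "b' x = y" if "(J,l) \<in> \<E>" "x \<in> grid_cell I J l" for J l x
    using bspec[OF b'(2) that(1)] that(2) by simp
  have ab: "a = b \<circ> scal (real N)" using N by (auto simp: b_def scal_inverse)
  define a' where "a' = b' \<circ> scal (real N)"
  have hom: "homotopic_with (scaled_preserving n N y a) euclidean T a a'"
  proof -
    have "homotopic_with (scaled_preserving n N y a) euclidean T (b \<circ> scal (real N)) a'"
      unfolding a'_def
    proof (rule homotopic_with_compose_continuous_map_right[OF b'(1)])
      show "continuous_map euclidean euclidean (scal (real N))"
        using continuous_on_scal[OF continuous_on_id] by (simp add: id_def)
      fix j assume "cell_preserving I y b j"
      moreover have "(\<lambda>z. (j \<circ> scal (real N)) (scal (1 / real N) z)) = j"
        using N by (auto simp: scal_inverse)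
      ultimately show "scaled_preserving n N y a (j \<circ> scal (real N))"
        by (simp add: scaled_preserving_def b_def I_def)
    qed
    then show ?thesis using ab by simp
  qed
  moreover have "a' x = y" if c: "c \<in> {1..n}" "real N * x c \<in> \<int>" for x c
  proof (cases "x \<in> ocube n")
    case False
    have "cube_map n y a'"
      by (rule scaled_preserving_cube_map[OF conjunct2[OF homotopic_with_imp_property[OF hom]] N a])
    then show ?thesis using False by (simp add: cube_map_def)
  next
    case True
    define z where "z = scal (real N) x"
    define J where "J = {d\<in>I. z d \<in> \<int>}"
    define l where "l = restrict (\<lambda>d. \<lfloor>z d\<rfloor>) I"
    have z01: "0 < z d" "z d < real N" if "d \<in> I" for d
      using True N that by (auto simp: z_def scal_def ocube_def I_def)
    have "c \<in> J" using c by (auto simp: J_def z_def scal_def I_def)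
    moreover have "l d \<in> {0..int N}" if "d \<in> I" for d
    proof -
      have "0 \<le> \<lfloor>z d\<rfloor>" "\<lfloor>z d\<rfloor> \<le> int N" using z01[OF that] by (auto simp: floor_le_iff)
      then show ?thesis using that by (simp add: l_def)
    qed
    then have "l \<in> I \<rightarrow>\<^sub>E {0..int N}" by (auto simp: l_def)
    moreover have "J \<subseteq> I" by (auto simp: J_def)
    ultimately have "(J,l) \<in> \<E>" by (auto simp: \<E>_def)
    moreover have "z \<in> grid_cell I J l"
      unfolding grid_cell_def
    proof (intro CollectI ballI)
      fix d assume d: "d \<in> I"
      show "if d \<in> J then z d = of_int (l d) else of_int (l d) \<le> z d \<and> z d \<le> of_int (l d) + 1"
      proof (cases "d \<in> J")
        case True
        then have "z d \<in> \<int>" by (simp add: J_def)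
        then have "z d = of_int \<lfloor>z d\<rfloor>" by (metis Ints_cases floor_of_int)
        then show ?thesis using True d by (simp add: l_def)
      next
        case False
        then show ?thesis using d by (simp add: l_def less_imp_le)
      qed
    qed
    ultimately show ?thesis unfolding a'_def by (simp add: b'2 z_def)
  qed
  ultimately show ?thesis by blast
qed

section \<open>Uniform continuity on the closed cube\<close>

lemma dist_fun_le:
  fixes x y :: "point"
  assumes "\<And>c. \<bar>x c - y c\<bar> \<le> e"
  shows "dist x y \<le> 2 * e"
proof -
  have e: "0 \<le> e" using assms[of 0] by linarith
  have s: "summable (\<lambda>n. (1/2::real)^n)" by (rule summable_geometric) auto
  have "dist x y \<le> suminf (\<lambda>n. (1/2)^n * e)"
    unfolding dist_fun_def
  proof (rule suminf_le)
    show "(1/2)^n * min (dist (x (from_nat n)) (y (from_nat n))) 1 \<le> (1/2)^n * e" for n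
      using assms[of "from_nat n"] by (intro mult_left_mono) (auto simp: dist_real_def)
    show "summable (\<lambda>n. (1/2)^n * e)" using s by (rule summable_mult2)
    show "summable (\<lambda>n. (1/2)^n * min (dist (x (from_nat n)) (y (from_nat n))) 1)"
      by (rule summable_comparison_test'[OF s, of 0]) (auto simp: mult_le_cancel_left2)
  qed
  also have "\<dots> = 2 * e" using suminf_mult2[OF s, of e] suminf_geometric[of "1/2::real"] by simp
  finally show ?thesis .
qed

text \<open>Freezing the other coordinates at 0 makes the closed cube compact in the space of all
  sequences; \<open>cclamp\<close> retracts onto it without changing the value of a cube
  map.\<close>

definition ccube :: "nat \<Rightarrow> point set" where
  "ccube n = {x. \<forall>c. x c \<in> (if c \<in> {1..n} then {0..1} else {0})}"

definition cclamp :: "nat \<Rightarrow> point \<Rightarrow> point" where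
  "cclamp n x = (\<lambda>c. if c \<in> {1..n} then max 0 (min 1 (x c)) else 0)"

lemma compact_ccube: "compact (ccube n)"
proof -
  have eq: "ccube n = PiE UNIV (\<lambda>c. if c \<in> {1..n} then {0..1} else {0::real})"
    unfolding ccube_def PiE_UNIV_domain Pi_def by simp
  have "compactin (product_topology (\<lambda>_::nat. euclideanreal) UNIV) (ccube n)"
    unfolding eq by (subst compactin_PiE) auto
  then show ?thesis by (simp add: euclidean_product_topology)
qed

lemma cclamp_in: "cclamp n x \<in> ccube n"
  by (auto simp: cclamp_def ccube_def)

lemma cube_map_cclamp:
  assumes "cube_map n y g" shows "g (cclamp n x) = g x"
proof (cases "x \<in> ocube n")
  case True
  then show ?thesis using assms unfolding cube_map_def
    by (intro depends_onD[of "{1..n}" g]) (auto simp: cclamp_def ocube_def)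
next
  case False
  then obtain c where "c \<in> {1..n}" "x c \<le> 0 \<or> x c \<ge> 1" by (force simp: ocube_def)
  then have "cclamp n x \<notin> ocube n" by (auto simp: cclamp_def ocube_def intro!: bexI[of _ c])
  then show ?thesis using assms False by (simp add: cube_map_def)
qed

text \<open>Uniform continuity on the compact cube. The bound is needed for all
  \<open>N \<ge> M\<close>, because the grids used later must also refine each other.\<close>

lemma cube_map_fine_grid:
  fixes v :: "point \<Rightarrow> real"
  assumes "continuous_on UNIV v" "cube_map n y v" "0 < \<delta>"
  shows "\<exists>M>0. \<forall>N\<ge>M. \<forall>Q\<in>grid_cells {1..n}. \<forall>x z. scal (real N) x \<in> Q \<longrightarrow> scal (real N) z \<in> Q \<longrightarrow> \<bar>v x - v z\<bar> < \<delta>"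
proof -
  have "uniformly_continuous_on (ccube n) v"
    by (rule compact_uniformly_continuous) (use continuous_on_subset[OF assms(1)] compact_ccube in auto)
  then obtain e where e: "e > 0" "\<And>x z. x \<in> ccube n \<Longrightarrow> z \<in> ccube n \<Longrightarrow> dist z x < e \<Longrightarrow> dist (v z) (v x) < \<delta>"
    using \<open>0 < \<delta>\<close> unfolding uniformly_continuous_on_def by metis
  obtain M :: nat where M: "2 / e < real M" using reals_Archimedean2 by blast
  have M0: "M > 0" using M e(1) by (cases "M = 0") (auto simp: field_simps)
  have "\<bar>v x - v z\<bar> < \<delta>" if N: "N \<ge> M" and Q: "Q \<in> grid_cells {1..n}" and x: "scal (real N) x \<in> Q" and z: "scal (real N) z \<in> Q"
    for N Q x z
  proof -
    have N0: "real N > 0" using N M0 by simp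
    obtain J l where Ql: "Q = grid_cell {1..n} J l" using Q by (auto simp: grid_cells_def)
    have "\<bar>x c - z c\<bar> \<le> 1 / real N" if "c \<in> {1..n}" for c
    proof -
      have "\<bar>real N * x c - real N * z c\<bar> \<le> 1"
        using x z that unfolding Ql grid_cell_def scal_def by (auto dest!: bspec[of _ _ c] split: if_splits)
      then have "real N * \<bar>x c - z c\<bar> \<le> 1" by (simp add: abs_mult flip: right_diff_distrib)
      then show ?thesis using N0 by (simp add: field_simps)
    qed
    then have "\<bar>cclamp n x c - cclamp n z c\<bar> \<le> 1 / real N" for c
      by (force simp: cclamp_def)
    then have "dist (cclamp n x) (cclamp n z) \<le> 2 * (1 / real N)" by (rule dist_fun_le)
    also have "\<dots> < e"
    proof -
      have "2 / e < real N" using M N by linarith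
      then show ?thesis using e(1) N0 by (simp add: field_simps)
    qed
    finally have "dist (v (cclamp n x)) (v (cclamp n z)) < \<delta>" by (intro e(2) cclamp_in)
    then show ?thesis using cube_map_cclamp[OF assms(2)] by (simp add: dist_real_def)
  qed
  then show ?thesis using M0 by blast
qed

section \<open>Families of maps with disjoint supports\<close>

text \<open>A map of the cube into the weak join in coordinates. The set \<open>Z\<close> of
  coordinates required to be trivial lets infinitely many homotopies be composed, and it later gives
  continuity across infinitely many spheres.\<close>

definition join_map :: "nat \<Rightarrow> (nat \<Rightarrow> 'a) \<Rightarrow> nat set \<Rightarrow> (point \<Rightarrow> nat \<Rightarrow> 'a) \<Rightarrow> bool" where
  "join_map n x Z g \<longleftrightarrow> (\<forall>p i j. g p i \<noteq> x i \<longrightarrow> g p j \<noteq> x j \<longrightarrow> i = j) \<and>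
     (\<forall>p. p \<notin> ocube n \<longrightarrow> g p = x) \<and> (\<forall>i\<in>Z. \<forall>p. g p i = x i)"

text \<open>Removal of one coordinate. \<open>sep\<close> provides disjointness while supports
  spread only inside cells; \<open>dual\<close>, together with triviality of the nullhomotopy above
  the vertices, provides it once both collapses are complete.\<close>

lemma push_off:
  fixes Xs :: "nat \<Rightarrow> 'a topology" and b :: "point \<Rightarrow> nat \<Rightarrow> 'a"
  assumes n: "n \<ge> 2" and N: "N > 0" and nul: "nullable (n-1) (Xs i) (x i)"
    and x: "\<And>j. x j \<in> topspace (Xs j)"
    and contb: "\<And>j. continuous_map euclidean (Xs j) (\<lambda>p. b p j)" and b: "join_map n x Z b"
    and grid: "\<And>p c. c \<in> {1..n} \<Longrightarrow> real N * p c \<in> \<int> \<Longrightarrow> b p i = x i"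
    and null: "homotopic_with (cube_map n (x i)) euclidean (Xs i) (\<lambda>p. b p i) (\<lambda>_. x i)"
    and dual: "\<And>p c j. j \<noteq> i \<Longrightarrow> c \<in> {1..n} \<Longrightarrow> real N * p c - 1/2 \<in> \<int> \<Longrightarrow> b p j = x j"
    and sep: "\<And>Q p q j. Q \<in> grid_cells {1..n} \<Longrightarrow> scal (real N) p \<in> Q \<Longrightarrow> scal (real N) q \<in> Q \<Longrightarrow>
                b q i \<noteq> x i \<Longrightarrow> j \<noteq> i \<Longrightarrow> b p j = x j"
  shows "homotopic_with (join_map n x Z) euclidean (product_topology Xs UNIV) b (\<lambda>p. (b p)(i := x i))"
proof (cases "\<forall>p. b p i = x i")
  case True
  then have "(\<lambda>p. (b p)(i := x i)) = b" by (auto simp: fun_eq_iff)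
  then show ?thesis using contb b by (simp add: continuous_map_componentwise_UNIV)
next
  case nontriv: False
  then have iZ: "i \<notin> Z" using b by (auto simp: join_map_def)
  define a where "a = (\<lambda>p. b p i)"
  have N1: "real N \<noteq> 0" using N by simp
  obtain k where k: "continuous_map euclidean (Xs i) (k :: real \<times> point \<Rightarrow> 'a)"
    "\<And>p. k (0,p) = a p" "\<And>p. k (1,p) = x i" "\<And>t. cube_map n (x i) (\<lambda>p. k (t,p))"
    using homotopic_with_extend[OF null] unfolding a_def by metis
  have kout: "k (t,p) = x i" if "c \<in> {1..n}" "p c \<le> 0 \<or> p c \<ge> 1" for t p c
    using k(4)[of t] that by (rule cube_map_outside)
  have kdep: "k (t,p) = k (t,q)" if "\<And>c. c \<in> {1..n} \<Longrightarrow> p c = q c" for t p q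
    using k(4)[of t] that unfolding cube_map_def by (auto intro: depends_onD)
  \<comment> \<open>The nullhomotopy as a map of the stretched cube with time as coordinate 0, so
    that the grid machinery applies to it.\<close>
  define F where "F = (\<lambda>z. k (z 0, scal (1 / real N) z))"
  define I where "I = {0..n}"
  \<comment> \<open>Only coordinate 0 is free: these cells are the time intervals above the
    vertices. Their ends are trivial, at time 0 by \<open>grid\<close> and at time 1 because the
    nullhomotopy has ended.\<close>
  define \<E> where "\<E> = {(J,l). J = {1..n} \<and> l \<in> I \<rightarrow>\<^sub>E {0..int N} \<and> l 0 = 0}"
  have "\<exists>F'. homotopic_with (cell_preserving I (x i) F) euclidean (Xs i) F F' \<and>
           (\<forall>(J,l)\<in>\<E>. \<forall>z\<in>grid_cell I J l. F' z = x i)"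
  proof (rule trivialize_cells[OF _ nul])
    show "finite I" by (simp add: I_def)
    have "\<E> \<subseteq> {{1..n}} \<times> (I \<rightarrow>\<^sub>E {0..int N})" by (auto simp: \<E>_def)
    then show "finite \<E>" by (rule finite_subset) (simp add: I_def finite_PiE)
    have IJ: "I - {1..n} = {0}" by (auto simp: I_def)
    then show "card (I - J) \<le> n - 1" if "(J,l) \<in> \<E>" for J l
      using that n by (simp add: \<E>_def)
    show "continuous_map euclidean (Xs i) F" unfolding F_def
      by (intro continuous_map_compose_on[OF k(1)] continuous_on_scal continuous_intros continuous_on_apply)
    show "depends_on I F"
      unfolding depends_on_def
    proof (intro allI impI)
      fix p q :: "point" assume pq: "\<forall>c\<in>I. p c = q c"
      have "k (p 0, scal (1 / real N) p) = k (p 0, scal (1 / real N) q)"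
        by (rule kdep) (use pq in \<open>auto simp: I_def scal_def\<close>)
      then show "F p = F q" using pq by (simp add: F_def I_def)
    qed
    fix J l c v assume Jl: "(J,l) \<in> \<E>" and c: "c \<in> I - J" and v: "v = l c \<or> v = l c + 1"
    have J: "J = {1..n}" and l0: "l 0 = 0" using Jl by (auto simp: \<E>_def)
    have c0: "c = 0" using c J by (auto simp: I_def)
    have "F z = x i" if z: "z \<in> grid_cell I (insert c J) (l(c := v))" for z
    proof (cases "v = 0")
      case True
      have "z 0 = 0" using z c0 True by (auto simp: grid_cell_def I_def)
      moreover have "z 1 = of_int (l 1)" using z c0 n J unfolding grid_cell_def I_def
        by (auto dest!: bspec[of _ _ 1])
      then have "a (scal (1 / real N) z) = x i" unfolding a_def
        using n N by (intro grid[of 1]) (auto simp: scal_def)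
      ultimately show ?thesis by (simp add: F_def k)
    next
      case False
      then have "z 0 = 1" using z c0 v l0 by (auto simp: grid_cell_def I_def)
      then show ?thesis by (simp add: F_def k)
    qed
    then show "(insert c J, l(c := v)) \<in> \<E> \<or> (\<forall>z\<in>grid_cell I (insert c J) (l(c := v)). F z = x i)"
      by blast
  qed
  then obtain F' where F': "homotopic_with (cell_preserving I (x i) F) euclidean (Xs i) F F'"
     "\<forall>(J,l)\<in>\<E>. \<forall>z\<in>grid_cell I J l. F' z = x i" by (elim exE conjE)
  have F'2: "F' z = x i" if "(J,l) \<in> \<E>" "z \<in> grid_cell I J l" for J l z
    using bspec[OF F'(2) that(1)] that(2) by simp
  obtain m where m: "continuous_map euclidean (Xs i) (m :: real \<times> point \<Rightarrow> 'a)"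
    "\<And>z. m (0,z) = F z" "\<And>z. m (1,z) = F' z" "\<And>s. cell_preserving I (x i) F (\<lambda>z. m (s,z))"
    using homotopic_with_extend[OF F'(1)] by metis
  have m_out: "m (s,z) = x i" if c: "c \<in> {1..n}" "z c \<le> 0 \<or> z c \<ge> real N" for s z c
  proof -
    have cI: "c \<in> I" using c by (simp add: I_def)
    show ?thesis
    proof (cases "z c \<le> 0")
      case True
      show ?thesis
        by (rule cell_preserving_halfspace(1)[OF m(4) cI, of 0])
           (use True c(1) in \<open>auto simp: F_def scal_def divide_le_0_iff intro!: kout[of c]\<close>)
    next
      case False
      show ?thesis
        by (rule cell_preserving_halfspace(2)[OF m(4) cI, of "int N"])
           (use False c N in \<open>auto simp: F_def scal_def le_divide_eq intro!: kout[of c]\<close>)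
    qed
  qed
  have m_end: "m (s,z) = x i" if "z 0 = 1" for s z
    by (rule cell_preserving_halfspace(3)[OF m(4), where c = 0 and k = 1])
       (use that in \<open>auto simp: I_def F_def k\<close>)
  have m_vert: "m (1,z) = x i" if z0: "0 \<le> z 0" "z 0 \<le> 1" and z: "\<And>c. c \<in> {1..n} \<Longrightarrow> z c \<in> \<int>" for z
  proof (cases "\<exists>c\<in>{1..n}. z c \<le> 0 \<or> z c \<ge> real N")
    case True then show ?thesis using m_out by blast
  next
    case False
    define l where "l = restrict (\<lambda>c. if c = 0 then 0 else \<lfloor>z c\<rfloor>) I"
    have "l c \<in> {0..int N}" if "c \<in> I" for c
    proof (cases "c = 0")
      case False
      then have "c \<in> {1..n}" using that by (auto simp: I_def)
      then have "0 < z c" "z c < real N" using \<open>\<not> (\<exists>c\<in>{1..n}. z c \<le> 0 \<or> z c \<ge> real N)\<close>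
        by (meson not_le)+
      then have "0 \<le> \<lfloor>z c\<rfloor>" "\<lfloor>z c\<rfloor> \<le> int N" by (auto simp: floor_le_iff)
      then show ?thesis using that False by (simp add: l_def)
    qed (simp add: l_def I_def)
    then have "({1..n},l) \<in> \<E>" by (auto simp: \<E>_def l_def I_def)
    moreover have "z \<in> grid_cell I {1..n} l"
      unfolding grid_cell_def
    proof (intro CollectI ballI)
      fix c assume c: "c \<in> I"
      show "if c \<in> {1..n} then z c = of_int (l c) else of_int (l c) \<le> z c \<and> z c \<le> of_int (l c) + 1"
      proof (cases "c = 0")
        case True
        then show ?thesis using z0 by (simp add: l_def I_def)
      next
        case False
        then have c1: "c \<in> {1..n}" using c by (auto simp: I_def)
        then have "z c = of_int \<lfloor>z c\<rfloor>" using z by (metis Ints_cases floor_of_int)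
        then show ?thesis using c c1 False by (simp add: l_def)
      qed
    qed
    ultimately show ?thesis by (simp add: m F'2)
  qed
  have m_cell: "\<exists>q. scal (real N) q \<in> Q \<and> a q \<noteq> x i"
    if Q: "Q \<in> grid_cells {1..n}" "w \<in> Q" "m (s, w(0 := 0)) \<noteq> x i" for Q w s
  proof (rule ccontr)
    assume "\<not> ?thesis"
    then have triv: "a q = x i" if "scal (real N) q \<in> Q" for q using that by blast
    obtain J l where Ql: "Q = grid_cell {1..n} J l" using Q(1) by (auto simp: grid_cells_def)
    \<comment> \<open>The copy of \<open>Q\<close> at time 0 is itself a cell of the grid with time,
      so preservation of cells by \<open>m\<close> applies to it.\<close>
    define Q0 where "Q0 = grid_cell I (insert 0 J) (l(0 := 0))"
    have Q0: "z \<in> Q0 \<longleftrightarrow> z 0 = 0 \<and> z \<in> Q" for z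
    proof -
      have "I = insert 0 {1..n}" by (auto simp: I_def)
      then show ?thesis unfolding Q0_def Ql grid_cell_def by auto
    qed
    have "F z = x i" if "z \<in> Q0" for z
      using that triv[of "scal (1 / real N) z"] N1 by (auto simp: Q0 F_def k scal_inverse)
    then have "\<forall>z\<in>Q0. m (s,z) = x i"
      using m(4)[of s] unfolding cell_preserving_def grid_cells_def Q0_def by blast
    moreover have "w(0 := 0) \<in> Q" using Q(2) unfolding Ql grid_cell_def by auto
    then have "w(0 := 0) \<in> Q0" by (simp add: Q0)
    ultimately show False using Q(3) by blast
  qed
  define B where "B = (\<lambda>t p. b (scal (1 / real N) (wiggle (- t) (scal (real N) p))))"
  \<comment> \<open>Three parameters, moved from 0 to 1 in the order \<open>s\<close>,
    \<open>t\<close>, \<open>u\<close>: \<open>s\<close> deforms \<open>F\<close> into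
    \<open>F'\<close>, \<open>t\<close> performs the two opposite collapses, and \<open>u\<close>
    runs the nullhomotopy of coordinate \<open>i\<close>.\<close>
  define K where "K = (\<lambda>u s t p. (B t p)(i := m (s, (wiggle t (scal (real N) p))(0 := u))))"
  have bdisj: "j = j'" if "b p j \<noteq> x j" "b p j' \<noteq> x j'" for p j j'
    using b that unfolding join_map_def by blast
  have bout: "b p = x" if "p \<notin> ocube n" for p using b that by (simp add: join_map_def)
  have bZ: "b p j = x j" if "j \<in> Z" for p j using b that by (simp add: join_map_def)
  have contB: "continuous_map euclidean (Xs j) (\<lambda>z. B (f z) (g z) j)"
    if "continuous_on UNIV f" "continuous_on UNIV g" for j and f :: "real \<times> point \<Rightarrow> real" and g
    unfolding B_def
    by (rule continuous_map_compose_on[OF contb]) (intro continuous_on_scal continuous_on_wiggle continuous_intros that)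
  have contK: "continuous_map euclidean (product_topology Xs UNIV) (\<lambda>z. K (e z) (d z) (f z) (g z))"
    if "continuous_on UNIV e" "continuous_on UNIV d" "continuous_on UNIV f" "continuous_on UNIV g"
    for e d f :: "real \<times> point \<Rightarrow> real" and g
    unfolding continuous_map_componentwise_UNIV
  proof
    fix j
    have "continuous_map euclidean (Xs i) (\<lambda>z. m (d z, (wiggle (f z) (scal (real N) (g z)))(0 := e z)))"
      by (rule continuous_map_compose_on[OF m(1)])
         (intro continuous_on_upd continuous_on_scal continuous_on_wiggle continuous_intros that)
    then show "continuous_map euclidean (Xs j) (\<lambda>z. K (e z) (d z) (f z) (g z) j)"
      using contB[OF that(3,4), of j] unfolding K_def by (cases "j = i") simp_all
  qed
  have outB: "B t p = x" and outm: "m (s, (wiggle t (scal (real N) p))(0 := u)) = x i"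
    if t: "\<bar>t\<bar> \<le> 1" and p: "p \<notin> ocube n" for t p s u
  proof -
    obtain c where c: "c \<in> {1..n}" "p c \<le> 0 \<or> p c \<ge> 1" using p by (force simp: ocube_def)
    have z: "scal (real N) p c \<le> of_int 0 \<or> scal (real N) p c \<ge> of_int (int N)"
      using c(2) N by (auto simp: scal_def mult_le_0_iff)
    have w: "wiggle r (scal (real N) p) c \<le> 0 \<or> wiggle r (scal (real N) p) c \<ge> real N" if "\<bar>r\<bar> \<le> 1" for r
      using z wig_between[where t = r and k = 0 and x = "scal (real N) p c"]
         wig_between[where t = "- r" and k = 0 and x = "scal (real N) p c"]
         wig_between[where t = r and k = "int N" and x = "scal (real N) p c"]
         wig_between[where t = "- r" and k = "int N" and x = "scal (real N) p c"] that
      unfolding wiggle_def by (cases "r \<ge> 0") auto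
    show "m (s, (wiggle t (scal (real N) p))(0 := u)) = x i"
      by (rule m_out[OF c(1)]) (use w[OF t] c(1) in auto)
    have "scal (1 / real N) (wiggle (- t) (scal (real N) p)) \<notin> ocube n"
      using w[of "- t"] t c(1) N unfolding ocube_def
      by (auto simp: scal_def[of "1 / real N"] zero_less_divide_iff divide_less_eq intro!: bexI[of _ c])
    then show "B t p = x" unfolding B_def by (rule bout)
  qed
  have joinK: "join_map n x Z (K u s t)"
    if t: "0 \<le> t" "t \<le> 1" and cross: "\<And>p j. j \<noteq> i \<Longrightarrow> m (s, (wiggle t (scal (real N) p))(0 := u)) \<noteq> x i \<Longrightarrow> B t p j = x j"
    for u s t
    unfolding join_map_def
  proof (intro conjI allI impI ballI)
    show "j = j'" if "K u s t p j \<noteq> x j" "K u s t p j' \<noteq> x j'" for p j j'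
    proof (cases "j = i \<or> j' = i")
      case True
      then show ?thesis using that cross[of j p] cross[of j' p] unfolding K_def by (auto split: if_splits)
    next
      case False
      then show ?thesis using that bdisj unfolding K_def B_def by auto
    qed
    show "K u s t p = x" if "p \<notin> ocube n" for p
      using outB[of t p] outm[of t p] t that by (auto simp: K_def fun_eq_iff)
    show "K u s t p j = x j" if "j \<in> Z" for j p
      using that iZ bZ by (auto simp: K_def B_def)
  qed
  \<comment> \<open>While \<open>u = 0\<close>, both displaced points remain in the cell of
    \<open>p\<close>, and nontriviality of coordinate \<open>i\<close> there forces \<open>a\<close>
    to be nontrivial somewhere in that cell.\<close>
  have cross0: "B t p j = x j" if "0 \<le> t" "t \<le> 1" "j \<noteq> i"
      and nt: "m (s, (wiggle t (scal (real N) p))(0 := 0)) \<noteq> x i" for s t p j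
  proof -
    define z where "z = scal (real N) p"
    define Q where "Q = grid_cell {1..n} {} (\<lambda>d. \<lfloor>z d\<rfloor>)"
    have Q: "Q \<in> grid_cells {1..n}" "z \<in> Q" unfolding Q_def
      by (auto simp: grid_cells_def intro: in_grid_cell_floor)
    have w: "wiggle t z \<in> Q" "wiggle (- t) z \<in> Q" using that by (auto intro!: wiggle_in_cell[OF Q])
    obtain q where "scal (real N) q \<in> Q" "a q \<noteq> x i"
      using m_cell[OF Q(1) w(1)] nt unfolding z_def by blast
    then show ?thesis unfolding B_def a_def
      by (intro sep[OF Q(1), of _ q]) (use w(2) N1 that(3) in \<open>auto simp: scal_inverse z_def\<close>)
  qed
  \<comment> \<open>With both collapses complete, \<open>s\<close> and \<open>u\<close> no longer
    keep coordinate \<open>i\<close> inside its cells, so the dichotomy \<open>wig_cases\<close>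
    takes over from \<open>sep\<close>.\<close>
  have cross1: "B 1 p j = x j" if u: "0 \<le> u" "u \<le> 1" and ji: "j \<noteq> i" and nt: "m (1, (wiggle 1 (scal (real N) p))(0 := u)) \<noteq> x i"
    for u p j
  proof -
    define z where "z = scal (real N) p"
    have "\<exists>c\<in>{1..n}. wiggle 1 z c \<notin> \<int>"
    proof (rule ccontr)
      assume "\<not> ?thesis"
      then have "m (1, (wiggle 1 z)(0 := u)) = x i" using u by (intro m_vert) auto
      then show False using nt by (simp add: z_def)
    qed
    then obtain c where c: "c \<in> {1..n}" "wiggle 1 z c \<notin> \<int>" by blast
    then have "\<nexists>k. z c - wig (z c) = of_int k" by (auto simp: wiggle_def)
    then obtain k where "z c + wig (z c) = of_int k + 1/2" using wig_cases[of "z c"] by blast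
    then show ?thesis unfolding B_def
      by (intro dual[OF ji c(1)]) (use N1 in \<open>simp add: scal_def[of "1 / real N"] wiggle_def z_def\<close>)
  qed
  let ?hom = "homotopic_with (join_map n x Z) euclidean (product_topology Xs UNIV)"
  have 1: "?hom (K 0 0 0) (K 0 1 0)"
    by (rule homotopic_withI[of _ "\<lambda>z. K 0 (fst z) 0 (snd z)"])
       (auto intro!: contK continuous_intros continuous_on_snd_apply joinK cross0)
  have 2: "?hom (K 0 1 0) (K 0 1 1)"
    by (rule homotopic_withI[of _ "\<lambda>z. K 0 1 (fst z) (snd z)"])
       (auto intro!: contK continuous_intros continuous_on_snd_apply joinK cross0)
  have 3: "?hom (K 0 1 1) (K 1 1 1)"
    by (rule homotopic_withI[of _ "\<lambda>z. K (fst z) 1 1 (snd z)"])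
       (auto intro!: contK continuous_intros continuous_on_snd_apply joinK cross1)
  \<comment> \<open>Once coordinate \<open>i\<close> has vanished, the collapse of the other
    coordinates can be undone without conflict.\<close>
  define L where "L = (\<lambda>t p. (B (1 - t) p)(i := x i))"
  have 4: "?hom (L 0) (L 1)"
  proof (rule homotopic_withI[of _ "\<lambda>z. L (fst z) (snd z)"])
    show "continuous_map euclidean (product_topology Xs UNIV) (\<lambda>z. L (fst z) (snd z))"
      unfolding continuous_map_componentwise_UNIV
    proof
      fix j
      show "continuous_map euclidean (Xs j) (\<lambda>z. L (fst z) (snd z) j)"
        using contB[of "\<lambda>z. 1 - fst z" snd j] x[of j] unfolding L_def
        by (cases "j = i") (simp_all add: continuous_intros)
    qed
    show "join_map n x Z (\<lambda>p. L (fst (t, p)) (snd (t, p)))" if "0 \<le> t" "t \<le> 1" for t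
      using outB[of "1 - t"] that bdisj bZ iZ by (auto simp: join_map_def L_def B_def fun_eq_iff split: if_splits)
  qed auto
  have K0: "K 0 0 0 = b"
  proof (intro ext)
    fix p j
    have w0: "wiggle 0 z = z" "wiggle (- 0) z = z" for z by (auto simp: wiggle_def)
    have "m (0, (scal (real N) p)(0 := 0)) = b p i"
    proof -
      have "k (0, scal (1 / real N) ((scal (real N) p)(0 := 0))) = k (0,p)"
        by (rule kdep) (use N1 in \<open>auto simp: scal_def\<close>)
      then show ?thesis by (simp add: m F_def k a_def)
    qed
    then show "K 0 0 0 p j = b p j" using N1 by (auto simp: K_def B_def w0 scal_inverse)
  qed
  have K1: "K 1 1 1 = L 0" by (auto simp: K_def L_def m_end)
  have L1: "L 1 = (\<lambda>p. (b p)(i := x i))"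
    using N1 by (auto simp: L_def B_def wiggle_def scal_inverse)
  show ?thesis
    using homotopic_with_trans[OF homotopic_with_trans[OF 1 2] homotopic_with_trans[OF 3]] 4 K0 K1 L1
    by simp
qed

section \<open>Infinitely many homotopies in succession\<close>

lemma continuous_map_concat:
  fixes \<Theta> :: "nat \<Rightarrow> real \<times> 'z::topological_space \<Rightarrow> 'a"
  assumes cont: "\<And>i. continuous_map euclidean T (\<Theta> i)"
    and glue: "\<And>i p. \<Theta> i (1,p) = \<Theta> (Suc i) (0,p)"
  shows "continuous_map euclidean T (\<lambda>(u,p). \<Theta> (nat \<lfloor>max 0 u\<rfloor>) (frac (max 0 u), p))"
\<comment> \<open>Strips of unit length in time form a locally finite closed cover, so infinitely
  many pieces can still be pasted.\<close>
proof (rule pasting_lemma_locally_finite[where I = UNIV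
      and T = "\<lambda>m::nat. {z. real m \<le> max 0 (fst z) \<and> max 0 (fst z) \<le> real m + 1}"
      and f = "\<lambda>m z. \<Theta> m (max 0 (fst z) - real m, snd z)"])
  show "\<exists>V. openin euclidean V \<and> z \<in> V \<and>
      finite {m \<in> UNIV. {w::real\<times>'z. real m \<le> max 0 (fst w) \<and> max 0 (fst w) \<le> real m + 1} \<inter> V \<noteq> {}}" for z
  proof -
    obtain M :: nat where M: "max 0 (fst z) < real M" using reals_Archimedean2 by blast
    show ?thesis
    proof (intro exI conjI)
      show "openin euclidean {w::real\<times>'z. max 0 (fst w) < real M}"
        unfolding open_openin[symmetric] by (intro open_Collect_less continuous_intros)
      show "z \<in> {w. max 0 (fst w) < real M}" using M by simp
      have "{m. {w::real\<times>'z. real m \<le> max 0 (fst w) \<and> max 0 (fst w) \<le> real m + 1} \<inter> {w. max 0 (fst w) < real M} \<noteq> {}} \<subseteq> {..<M}"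
        by auto
      then show "finite {m\<in>UNIV. {w::real\<times>'z. real m \<le> max 0 (fst w) \<and> max 0 (fst w) \<le> real m + 1} \<inter> {w. max 0 (fst w) < real M} \<noteq> {}}"
        by (auto intro: finite_subset)
    qed
  qed
  show "closedin euclidean {z::real\<times>'z. real m \<le> max 0 (fst z) \<and> max 0 (fst z) \<le> real m + 1}" for m
    unfolding closed_closedin[symmetric]
    by (intro closed_Collect_conj closed_Collect_le continuous_intros)
  show "continuous_map (subtopology euclidean {z::real\<times>'z. real m \<le> max 0 (fst z) \<and> max 0 (fst z) \<le> real m + 1}) T
     (\<lambda>z. \<Theta> m (max 0 (fst z) - real m, snd z))" for m
    by (intro continuous_map_from_subtopology continuous_map_compose_on[OF cont] continuous_intros)
  have adj: "\<Theta> i (u - real i, p) = \<Theta> j (u - real j, p)"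
    if "real i \<le> u" "u \<le> real i + 1" "real j \<le> u" "u \<le> real j + 1" "i < j" for i j u p
  proof -
    have "real i + 1 \<le> real j" using that(5) by linarith
    then have u: "u = real j" "j = Suc i" using that by linarith+
    then show ?thesis using glue[of i p] unfolding u by simp
  qed
  show "\<Theta> i (max 0 (fst z) - real i, snd z) = \<Theta> j (max 0 (fst z) - real j, snd z)"
    if "z \<in> topspace euclidean \<inter> {z. real i \<le> max 0 (fst z) \<and> max 0 (fst z) \<le> real i + 1} \<inter>
        {z. real j \<le> max 0 (fst z) \<and> max 0 (fst z) \<le> real j + 1}" for i j and z :: "real\<times>'z"
  proof -
    have "real i \<le> max 0 (fst z)" "max 0 (fst z) \<le> real i + 1"
      "real j \<le> max 0 (fst z)" "max 0 (fst z) \<le> real j + 1"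
      using that by blast+
    then show ?thesis using adj[of i "max 0 (fst z)" j "snd z"] adj[of j "max 0 (fst z)" i "snd z"]
      by (metis nat_neq_iff)
  qed
  show "\<exists>m. m \<in> UNIV \<and> z \<in> {z. real m \<le> max 0 (fst z) \<and> max 0 (fst z) \<le> real m + 1} \<and>
        (case z of (u, p) \<Rightarrow> \<Theta> (nat \<lfloor>max 0 u\<rfloor>) (frac (max 0 u), p)) = \<Theta> m (max 0 (fst z) - real m, snd z)"
    for z :: "real\<times>'z"
  proof -
    define u where "u = max 0 (fst z)"
    have "0 \<le> u" by (simp add: u_def)
    then have "real (nat \<lfloor>u\<rfloor>) = of_int \<lfloor>u\<rfloor>" by simp
    moreover have "of_int \<lfloor>u\<rfloor> \<le> u" "u \<le> of_int \<lfloor>u\<rfloor> + 1" by linarith+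
    ultimately have "real (nat \<lfloor>u\<rfloor>) \<le> u" "u \<le> real (nat \<lfloor>u\<rfloor>) + 1" "frac u = u - real (nat \<lfloor>u\<rfloor>)"
      by (simp_all add: frac_def)
    then show ?thesis
      by (intro exI[of _ "nat \<lfloor>u\<rfloor>"]) (simp only: u_def[symmetric] case_prod_unfold mem_Collect_eq UNIV_I simp_thms)
  qed
qed

text \<open>Infinitely many homotopies, the \<open>i\<close>-th of which is constant in the coordinates below \<open>i\<close>,
  can be performed one after the other: every coordinate changes during finitely many of them.\<close>

lemma infinite_concat:
  fixes Xs :: "nat \<Rightarrow> 'a topology" and f :: "nat \<Rightarrow> point \<Rightarrow> nat \<Rightarrow> 'a"
  assumes step: "\<And>i. homotopic_with (join_map n x (Z \<union> {..<i})) euclidean (product_topology Xs UNIV) (f i) (f (Suc i))"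
  shows "homotopic_with (join_map n x Z) euclidean (product_topology Xs UNIV) (f 0) (\<lambda>_. x)"
proof -
  let ?E = "product_topology Xs UNIV"
  have "\<exists>h. continuous_map euclidean ?E (h :: real \<times> point \<Rightarrow> nat \<Rightarrow> 'a) \<and> (\<forall>p. h (0,p) = f i p) \<and>
      (\<forall>p. h (1,p) = f (Suc i) p) \<and> (\<forall>t. join_map n x (Z \<union> {..<i}) (\<lambda>p. h (t,p)))" for i
    using homotopic_with_extend[OF step[of i]] by metis
  then obtain \<Theta> where \<Theta>: "\<And>i. continuous_map euclidean ?E (\<Theta> i :: real \<times> point \<Rightarrow> nat \<Rightarrow> 'a)"
    "\<And>i p. \<Theta> i (0,p) = f i p" "\<And>i p. \<Theta> i (1,p) = f (Suc i) p"
    "\<And>i t. join_map n x (Z \<union> {..<i}) (\<lambda>p. \<Theta> i (t,p))"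
    by metis
  define P where "P = (\<lambda>u p. \<Theta> (nat \<lfloor>max 0 u\<rfloor>) (frac (max 0 u), p))"
  have contP: "continuous_map euclidean ?E (\<lambda>(u,p). P u p)"
    unfolding P_def by (rule continuous_map_concat) (simp_all add: \<Theta>)
  have contPj: "continuous_map euclidean (Xs j) (\<lambda>z. P (fst z) (snd z) j)" for j
    using contP unfolding continuous_map_componentwise_UNIV by (simp add: case_prod_unfold)
  have joinP: "join_map n x (Z \<union> {..<nat \<lfloor>u\<rfloor>}) (P u)" if "u \<ge> 0" for u
    using \<Theta>(4) that by (simp add: P_def)
  have Pj: "P u p j = x j" if "u \<ge> real j + 1" for u p j
  proof -
    have "j < nat \<lfloor>u\<rfloor>" using that by linarith
    then show ?thesis using joinP[of u] that by (simp add: join_map_def)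
  qed
  \<comment> \<open>The time change \<open>t / (1 - t)\<close> fits the whole process into unit
    time. Coordinate \<open>j\<close> is trivial from process time \<open>j + 1\<close> on, which is
    reached at \<open>t = q j < 1\<close>, so its clock \<open>\<kappa> j\<close> may stop there and
    stays continuous at \<open>t = 1\<close>.\<close>
  define q :: "point" where "q = (\<lambda>j. (real j + 1) / (real j + 2))"
  define \<kappa> where "\<kappa> = (\<lambda>j t. min t (q j) / (1 - min t (q j)))"
  have q1: "q j < 1" for j by (simp add: q_def)
  have \<kappa>q: "q j / (1 - q j) = real j + 1" for j
  proof -
    have "1 - q j = 1 / (real j + 2)" by (simp add: q_def field_simps)
    then show ?thesis by (simp add: q_def)
  qed
  show ?thesis
  proof (rule homotopic_withI)
    show "continuous_map euclidean ?E (\<lambda>z. (\<lambda>j. P (\<kappa> j (fst z)) (snd z) j))"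
      unfolding continuous_map_componentwise_UNIV
    proof
      fix j
      have "continuous_on UNIV (\<lambda>z::real \<times> point. (\<kappa> j (fst z), snd z))"
        unfolding \<kappa>_def using q1[of j] by (intro continuous_intros ballI) (auto simp: min_def)
      from continuous_map_compose_on[OF contPj this]
      show "continuous_map euclidean (Xs j) (\<lambda>z. P (\<kappa> j (fst z)) (snd z) j)" by simp
    qed
    have "q j > 0" for j by (simp add: q_def)
    then have "\<kappa> j 0 = 0" for j by (simp add: \<kappa>_def min_def) (metis less_imp_le)
    then show "(\<lambda>j. P (\<kappa> j (fst (0, p))) (snd (0, p)) j) = f 0 p" for p
      by (simp add: P_def \<Theta>)
    have \<kappa>1: "\<kappa> j t = real j + 1" if "t \<ge> q j" for j t
      using that \<kappa>q by (simp add: \<kappa>_def min_def)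
    have P1: "(\<lambda>j. P (\<kappa> j t) p j) = x" if "t \<ge> 1" for p t
    proof
      fix j
      have "q j \<le> t" using q1[of j] that by linarith
      then show "P (\<kappa> j t) p j = x j" by (intro Pj) (simp add: \<kappa>1)
    qed
    show "(\<lambda>j. P (\<kappa> j (fst (1, p))) (snd (1, p)) j) = x" for p using P1 by simp
    fix t :: real assume t: "0 \<le> t" "t \<le> 1"
    show "join_map n x Z (\<lambda>p. (\<lambda>j. P (\<kappa> j (fst (t, p))) (snd (t, p)) j))"
    proof (cases "t = 1")
      case True
      then show ?thesis using P1 by (simp add: join_map_def)
    next
      case False
      \<comment> \<open>Restarting the stopped clocks changes nothing, since their coordinates are
        trivial. All coordinates are thus read at one common moment, and disjointness is inherited
        from \<open>P\<close>.\<close>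
      have "(\<lambda>j. P (\<kappa> j t) p j) = P (t / (1 - t)) p" for p
      proof
        fix j
        show "P (\<kappa> j t) p j = P (t / (1 - t)) p j"
        proof (cases "t \<le> q j")
          case True then show ?thesis by (simp add: \<kappa>_def)
        next
          case False
          then have "q j / (1 - q j) \<le> t / (1 - t)" using t \<open>t \<noteq> 1\<close> \<open>\<And>j. q j > 0\<close>[of j]
            by (intro frac_le) auto
          then have "t / (1 - t) \<ge> real j + 1" by (simp add: \<kappa>q)
          then show ?thesis using Pj[of j] \<kappa>1[of j t] False by simp
        qed
      qed
      moreover have "join_map n x (Z \<union> {..<nat \<lfloor>t / (1 - t)\<rfloor>}) (P (t / (1 - t)))"
        using t False by (intro joinP) simp
      ultimately show ?thesis by (auto simp: join_map_def)
    qed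
  qed
qed

text \<open>A variant of the neighbourhood deformation retract condition for the base point; the set
  where \<open>u\<close> lies between 0 and 1/3 is the slack used to separate supports.\<close>

definition well_pointed :: "'a topology \<Rightarrow> 'a \<Rightarrow> bool" where
  "well_pointed T y \<longleftrightarrow> (\<exists>u h. continuous_map T euclideanreal u \<and> u y = 0 \<and>
     continuous_map (prod_topology euclideanreal T) T h \<and> (\<forall>z. h (0, z) = z) \<and> (\<forall>t. h (t, y) = y) \<and>
     (\<forall>z\<in>topspace T. u z \<le> 1/3 \<longrightarrow> h (1, z) = y))"

text \<open>The retraction \<open>h\<close> leaves \<open>f i\<close> nontrivial only where
  \<open>v i > 1/3\<close>. On a cell with oscillation below 1/3 this forces \<open>v i > 0\<close>
  throughout, so the cell lies where the given \<open>i\<close>-th map is nontrivial. Homotopies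
  spreading only inside cells therefore create no overlap.\<close>

lemma nullhomotopic_join:
  fixes Xs :: "nat \<Rightarrow> 'a topology" and \<phi> :: "point \<Rightarrow> nat \<Rightarrow> 'a"
  assumes n: "n \<ge> 2" and x: "\<And>i. x i \<in> topspace (Xs i)"
    and nul: "\<And>i. nullable (n-1) (Xs i) (x i)" and wp: "\<And>i. well_pointed (Xs i) (x i)"
    and cont: "\<And>i. continuous_map euclidean (Xs i) (\<lambda>p. \<phi> p i)"
    and cube: "\<And>i. cube_map n (x i) (\<lambda>p. \<phi> p i)"
    and disj: "\<And>p i j. \<phi> p i \<noteq> x i \<Longrightarrow> \<phi> p j \<noteq> x j \<Longrightarrow> i = j"
    and null: "\<And>i. homotopic_with (cube_map n (x i)) euclidean (Xs i) (\<lambda>p. \<phi> p i) (\<lambda>_. x i)"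
  shows "homotopic_with (join_map n x {i. \<forall>p. \<phi> p i = x i}) euclidean (product_topology Xs UNIV) \<phi> (\<lambda>_. x)"
proof -
  define Z where "Z = {i. \<forall>p. \<phi> p i = x i}"
  have \<phi>out: "\<phi> p i = x i" if "p \<notin> ocube n" for p i using cube[of i] that by (simp add: cube_map_def)
  have \<phi>top: "\<phi> p i \<in> topspace (Xs i)" for p i
    using continuous_map_funspace[OF cont[of i]] by auto
  obtain u h where
    u: "\<And>i. continuous_map (Xs i) euclideanreal (u i)" "\<And>i. u i (x i) = 0" and
    h: "\<And>i. continuous_map (prod_topology euclideanreal (Xs i)) (Xs i) (h i)" "\<And>i z. h i (0, z) = z"
      "\<And>i t. h i (t, x i) = x i" "\<And>i z. z \<in> topspace (Xs i) \<Longrightarrow> u i z \<le> 1/3 \<Longrightarrow> h i (1, z) = x i"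
    using wp unfolding well_pointed_def by metis
  have conth: "continuous_map euclidean (Xs i) (\<lambda>z::real \<times> point. h i (fst z, \<phi> (snd z) i))" for i
  proof -
    have "continuous_map euclidean (prod_topology euclideanreal (Xs i)) (\<lambda>z::real \<times> point. (fst z, \<phi> (snd z) i))"
      unfolding continuous_map_pairwise o_def
      using continuous_map_compose_on[OF cont[of i], of snd] by (simp add: continuous_intros)
    from continuous_map_compose[OF this h(1)] show ?thesis by (simp add: o_def)
  qed
  define f where "f = (\<lambda>i p. h i (1, \<phi> p i))"
  have contf: "continuous_map euclidean (Xs i) (f i)" for i
    using continuous_map_compose_on[OF conth[of i], of "\<lambda>p. (1,p)"] by (simp add: f_def continuous_intros)
  have cubeh: "cube_map n (x i) (\<lambda>p. h i (t, \<phi> p i))" for i t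
    using cube[of i] h(3)[of i] by (auto simp: cube_map_def depends_on_def) metis
  have homf: "homotopic_with (cube_map n (x i)) euclidean (Xs i) (\<lambda>p. \<phi> p i) (f i)" for i
    by (rule homotopic_withI[OF conth[of i]]) (simp_all add: h f_def cubeh)
  define v where "v = (\<lambda>i p. u i (\<phi> p i))"
  have fv: "v i p > 1/3" if "f i p \<noteq> x i" for i p
    using that h(4)[OF \<phi>top] unfolding f_def v_def by (meson not_le)
  have v0: "\<phi> p i \<noteq> x i" if "v i p > 0" for i p using that u(2)[of i] by (auto simp: v_def)
  have "\<exists>M>0. \<forall>N\<ge>M. \<forall>Q\<in>grid_cells {1..n}. \<forall>p q. scal (real N) p \<in> Q \<longrightarrow> scal (real N) q \<in> Q \<longrightarrow>
      \<bar>v i p - v i q\<bar> < 1/3" for i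
  proof (rule cube_map_fine_grid)
    show "continuous_on UNIV (v i)"
      using continuous_map_compose[OF cont[of i] u(1)[of i]] by (simp add: v_def o_def)
    have "depends_on {1..n} (\<lambda>p. \<phi> p i)" using cube[of i] by (simp add: cube_map_def)
    then have "depends_on {1..n} (v i)" unfolding v_def depends_on_def by metis
    then show "cube_map n 0 (v i)" using \<phi>out u(2) by (simp add: cube_map_def v_def)
  qed simp
  then obtain M where M: "\<And>i. M i > 0" and fine: "\<And>i N Q p q. N \<ge> M i \<Longrightarrow> Q \<in> grid_cells {1..n} \<Longrightarrow>
     scal (real N) p \<in> Q \<Longrightarrow> scal (real N) q \<in> Q \<Longrightarrow> \<bar>v i p - v i q\<bar> < 1/3"
    by metis
  \<comment> \<open>Partial sums of positive numbers are strictly increasing and bound each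
    \<open>M i\<close>. Hence every \<open>N i\<close> is fine enough and every later grid is a
    proper dyadic refinement.\<close>
  define e where "e = (\<lambda>i::nat. \<Sum>j\<le>i. M j)"
  define N where "N = (\<lambda>i::nat. 2 ^ e i :: nat)"
  have e_less: "e i < e j" if "i < j" for i j
  proof -
    have "strict_mono e" unfolding strict_mono_Suc_iff using M by (simp add: e_def)
    then show ?thesis using that by (simp add: strict_mono_less)
  qed
  have NM: "N i \<ge> M i" and N0: "N i > 0" for i
  proof -
    have "M i \<le> e i" unfolding e_def by (rule member_le_sum) auto
    also have "e i \<le> 2 ^ e i" by (simp add: less_imp_le)
    finally show "N i \<ge> M i" "N i > 0" by (simp_all add: N_def)
  qed
  have supp: "\<phi> q i \<noteq> x i"
    if "Q \<in> grid_cells {1..n}" "scal (real (N i)) p \<in> Q" "scal (real (N i)) q \<in> Q" "f i p \<noteq> x i" for Q p q i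
  proof (rule v0)
    show "v i q > 0" using fine[OF NM that(1-3)] fv[OF that(4)] by linarith
  qed
  have "\<exists>f'. homotopic_with (scaled_preserving n (N i) (x i) (f i)) euclidean (Xs i) (f i) f' \<and>
     (\<forall>p c. c \<in> {1..n} \<longrightarrow> real (N i) * p c \<in> \<int> \<longrightarrow> f' p = x i)" for i
    by (rule trivialize_grid[OF nul contf _ N0]) (simp add: f_def cubeh)
  then obtain f' where f': "\<And>i. homotopic_with (scaled_preserving n (N i) (x i) (f i)) euclidean (Xs i) (f i) (f' i)"
     and grid: "\<And>i p c. c \<in> {1..n} \<Longrightarrow> real (N i) * p c \<in> \<int> \<Longrightarrow> f' i p = x i"
    by metis
  have "\<exists>k. continuous_map euclidean (Xs i) (k :: real \<times> point \<Rightarrow> 'a) \<and> (\<forall>p. k (0,p) = f i p) \<and>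
     (\<forall>p. k (1,p) = f' i p) \<and> (\<forall>t. scaled_preserving n (N i) (x i) (f i) (\<lambda>p. k (t,p)))" for i
    using homotopic_with_extend[OF f'[of i]] by metis
  then obtain k where k: "\<And>i. continuous_map euclidean (Xs i) (k i :: real \<times> point \<Rightarrow> 'a)"
    "\<And>i p. k i (0,p) = f i p" "\<And>i p. k i (1,p) = f' i p"
    "\<And>i t. scaled_preserving n (N i) (x i) (f i) (\<lambda>p. k i (t,p))"
    by metis
  have ksupp: "\<phi> p i \<noteq> x i" if "k i (t,p) \<noteq> x i" for i t p
  proof -
    define Q where "Q = grid_cell {1..n} {} (\<lambda>d. \<lfloor>scal (real (N i)) p d\<rfloor>)"
    have Q: "Q \<in> grid_cells {1..n}" "scal (real (N i)) p \<in> Q" unfolding Q_def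
      by (auto simp: grid_cells_def intro: in_grid_cell_floor)
    obtain q where "scal (real (N i)) q \<in> Q" "f i q \<noteq> x i"
      using scaled_preservingD[OF k(4) N0 Q(1) _ Q(2)] \<open>k i (t,p) \<noteq> x i\<close> by metis
    then show ?thesis using supp[OF Q(1) _ Q(2)] by blast
  qed
  have cubek: "cube_map n (x i) (\<lambda>p. k i (t,p))" for i t
    by (rule scaled_preserving_cube_map[OF k(4) N0]) (simp add: f_def cubeh)
  have f'supp: "\<phi> p i \<noteq> x i" if "f' i p \<noteq> x i" for i p using ksupp[of i 1 p] that by (simp add: k)
  let ?E = "product_topology Xs UNIV"
  have 1: "homotopic_with (join_map n x Z) euclidean ?E \<phi> (\<lambda>p i. f i p)"
  proof (rule homotopic_withI[where h = "\<lambda>z i. h i (fst z, \<phi> (snd z) i)"])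
    show "continuous_map euclidean ?E (\<lambda>z i. h i (fst z, \<phi> (snd z) i))"
      unfolding continuous_map_componentwise_UNIV using conth by simp
    show "join_map n x Z (\<lambda>p i. h i (fst (t, p), \<phi> (snd (t, p)) i))" for t
      unfolding join_map_def
    proof (intro conjI allI impI ballI)
      show "i = j" if "h i (fst (t, p), \<phi> (snd (t, p)) i) \<noteq> x i" "h j (fst (t, p), \<phi> (snd (t, p)) j) \<noteq> x j" for p i j
        by (rule disj[of p]) (use that h(3) in auto)
    qed (auto simp: \<phi>out h Z_def)
  qed (auto simp: h f_def)
  have 2: "homotopic_with (join_map n x Z) euclidean ?E (\<lambda>p i. f i p) (\<lambda>p i. f' i p)"
  proof (rule homotopic_withI[where h = "\<lambda>z i. k i z"])
    show "continuous_map euclidean ?E (\<lambda>z i. k i z)"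
      unfolding continuous_map_componentwise_UNIV using k by simp
    show "join_map n x Z (\<lambda>p i. k i (t, p))" for t
      unfolding join_map_def
    proof (intro conjI allI impI ballI)
      show "i = j" if "k i (t,p) \<noteq> x i" "k j (t,p) \<noteq> x j" for p i j
        by (rule disj[of p]) (use that ksupp in auto)
      show "(\<lambda>i. k i (t, p)) = x" if "p \<notin> ocube n" for p
        using cubek that by (auto simp: cube_map_def)
      show "k i (t,p) = x i" if "i \<in> Z" for i p using ksupp that by (auto simp: Z_def)
    qed
  qed (auto simp: k)
  \<comment> \<open>Stage \<open>i\<close> of the process: the coordinates below \<open>i\<close>
    have been removed, the others are untouched.\<close>
  define g where "g = (\<lambda>i p j. if j < i then x j else f' j p)"
  have 3: "homotopic_with (join_map n x Z) euclidean ?E (g 0) (\<lambda>_. x)"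
  proof (rule infinite_concat)
    fix i
    have null': "homotopic_with (cube_map n (x i)) euclidean (Xs i) (f' i) (\<lambda>_. x i)"
    proof -
      have "homotopic_with (cube_map n (x i)) euclidean (Xs i) (f i) (f' i)"
        by (rule homotopic_withI[OF k(1)]) (simp_all add: k cubek)
      then show ?thesis
        using homf[of i] null[of i] by (meson homotopic_with_symD homotopic_with_trans)
    qed
    have "homotopic_with (join_map n x (Z \<union> {..<i})) euclidean ?E (g i) (\<lambda>p. (g i p)(i := x i))"
    proof (rule push_off[OF n N0[of i] nul x])
      show "continuous_map euclidean (Xs j) (\<lambda>p. g i p j)" for j
        using k(3) homotopic_with_imp_continuous_maps[OF f'[of j]] x by (cases "j < i") (auto simp: g_def)
      show "join_map n x (Z \<union> {..<i}) (g i)"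
        unfolding join_map_def
      proof (intro conjI allI impI ballI)
        show "j = l" if "g i p j \<noteq> x j" "g i p l \<noteq> x l" for p j l
          by (rule disj[of p]) (use that f'supp in \<open>auto simp: g_def split: if_splits\<close>)
        show "g i p = x" if "p \<notin> ocube n" for p
        proof -
          have "f' j p = x j" for j using f'supp \<phi>out[OF that] by blast
          then show ?thesis unfolding g_def by (intro ext) simp
        qed
        show "g i p j = x j" if "j \<in> Z \<union> {..<i}" for p j
          using f'supp that by (auto simp: g_def Z_def)
      qed
      show "g i p i = x i" if "c \<in> {1..n}" "real (N i) * p c \<in> \<int>" for p c
        using grid[where i = i and c = c and p = p] that by (simp add: g_def)
      show "homotopic_with (cube_map n (x i)) euclidean (Xs i) (\<lambda>p. g i p i) (\<lambda>_. x i)"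
        using null' by (simp add: g_def)
      show "g i p j = x j" if "j \<noteq> i" "c \<in> {1..n}" and half: "real (N i) * p c - 1/2 \<in> \<int>" for p c j
      proof (cases "j < i")
        case False
        then have ij: "e i < e j" using that(1) e_less by simp
        obtain r where r: "real (N i) * p c - 1/2 = of_int r" using half by (auto elim: Ints_cases)
        \<comment> \<open>Since \<open>e j > e i\<close>, the number \<open>N j\<close> is an even
          multiple of \<open>N i\<close>, which turns half-integers of grid \<open>i\<close> into
          integers of grid \<open>j\<close>.\<close>
        have "e j = Suc (e i) + (e j - Suc (e i))" using ij by simp
        then have "N j = 2 * N i * 2 ^ (e j - Suc (e i))" unfolding N_def
          by (metis power_Suc power_add)
        then have "real (N j) * p c = (2 * (real (N i) * p c)) * 2 ^ (e j - Suc (e i))" by simp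
        also have "2 * (real (N i) * p c) = of_int (2 * r + 1)" using r by simp
        finally have "real (N j) * p c \<in> \<int>" by (metis Ints_mult Ints_of_int Ints_numeral Ints_power)
        then show ?thesis using grid[where i = j, OF that(2)] False by (simp add: g_def)
      qed (simp add: g_def)
      show "g i p j = x j"
        if Q: "Q \<in> grid_cells {1..n}" and p: "scal (real (N i)) p \<in> Q" and q: "scal (real (N i)) q \<in> Q"
          and nt: "g i q i \<noteq> x i" and ji: "j \<noteq> i" for Q p q j
      proof -
        have "k i (1,q) \<noteq> x i" using nt by (simp add: g_def k)
        then obtain q' where "scal (real (N i)) q' \<in> Q" "f i q' \<noteq> x i"
          using scaled_preservingD[OF k(4) N0 Q _ q] by metis
        then have "\<phi> p i \<noteq> x i" using supp[OF Q _ p] by blast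
        then have "\<phi> p j = x j" using disj ji by blast
        then show ?thesis using f'supp by (auto simp: g_def)
      qed
    qed
    moreover have "(\<lambda>p. (g i p)(i := x i)) = g (Suc i)"
      by (auto simp: g_def fun_eq_iff less_Suc_eq)
    ultimately show "homotopic_with (join_map n x (Z \<union> {..<i})) euclidean ?E (g i) (g (Suc i))" by simp
  qed
  have "g 0 = (\<lambda>p i. f' i p)" by (simp add: g_def)
  then show ?thesis
    using homotopic_with_trans[OF homotopic_with_trans[OF 1 2]] 3 by (simp add: Z_def)
qed

section \<open>Spheres as quotients of cubes\<close>

definition earring :: "nat \<Rightarrow> nat set \<Rightarrow> point set" where
  "earring n K = {r. (\<forall>i>n. r i = 0) \<and>
     (\<exists>k\<in>K. (r 0 - 1 / real k)\<^sup>2 + (\<Sum>i\<in>{1..n}. (r i)\<^sup>2) = (1 / real k)\<^sup>2)}"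

lemma hawaiian_earring_eq: "hawaiian_earring n = top_of_set (earring n {1..})"
proof -
  have "hawaiian_set n = earring n {1..}"
    by (auto simp: hawaiian_set_def earring_def)
  moreover have "{x. \<forall>i\<ge>Suc n. x i = (0::real)} \<inter> earring n {1..} = earring n {1..}"
    by (auto simp: earring_def Suc_le_eq)
  ultimately show ?thesis
    by (simp add: hawaiian_earring_def Euclidean_space_def euclidean_product_topology subtopology_subtopology)
qed

lemma base_sphere_eq: "base_sphere n = top_of_set (earring n {1})"
proof -
  have "{x. \<forall>i\<ge>Suc n. x i = (0::real)} \<inter> {r. (\<forall>i>n. r i = 0) \<and> (r 0 - 1)\<^sup>2 + (\<Sum>i\<in>{1..n}. (r i)\<^sup>2) = 1} = earring n {1}"
    by (auto simp: earring_def Suc_le_eq)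
  then show ?thesis
    by (simp add: base_sphere_def Euclidean_space_def euclidean_product_topology subtopology_subtopology)
qed

lemma angle_bounds:
  assumes "0 < u" "u < 1"
  shows "- (pi/2) < pi * (u - 1/2)" "pi * (u - 1/2) < pi/2" "0 < cos (pi * (u - 1/2))"
proof -
  have "0 < pi * u" "0 < pi * (1 - u)" using assms by simp_all
  then show *: "- (pi/2) < pi * (u - 1/2)" "pi * (u - 1/2) < pi/2" by (simp_all add: algebra_simps)
  then show "0 < cos (pi * (u - 1/2))" by (rule cos_gt_zero_pi)
qed

section \<open>Inversion and the tangent chart of a sphere\<close>

definition sqn :: "nat \<Rightarrow> point \<Rightarrow> real" where
  "sqn n v = (\<Sum>j\<le>n. (v j)\<^sup>2)"

lemma hw_inversion_apply: "hw_inversion n v i = v i / sqn n v"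
  by (simp add: hw_inversion_def sqn_def)

lemma sqn_nonneg: "0 \<le> sqn n v" by (simp add: sqn_def sum_nonneg)

lemma sqn_inversion: "sqn n (hw_inversion n v) = 1 / sqn n v"
proof -
  have "sqn n (hw_inversion n v) = (\<Sum>j\<le>n. (v j)\<^sup>2) / (sqn n v)\<^sup>2"
    by (subst sqn_def) (simp add: hw_inversion_apply power_divide sum_divide_distrib)
  also have "\<dots> = sqn n v / (sqn n v)\<^sup>2" by (simp add: sqn_def)
  finally show ?thesis by (simp add: power2_eq_square)
qed

lemma inversion_inversion: "sqn n v \<noteq> 0 \<Longrightarrow> hw_inversion n (hw_inversion n v) = v"
  by (rule ext) (simp add: hw_inversion_apply[of n "hw_inversion n v"] sqn_inversion, simp add: hw_inversion_apply)

lemma sqn_ge: "i \<le> n \<Longrightarrow> (v i)\<^sup>2 \<le> sqn n v"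
  unfolding sqn_def by (rule member_le_sum) auto

lemma sqn_eq_0_iff: "sqn n v = 0 \<longleftrightarrow> (\<forall>i\<le>n. v i = 0)"
  unfolding sqn_def by (subst sum_nonneg_eq_0_iff) auto

lemma sqn_split: "sqn n v = (v 0)\<^sup>2 + (\<Sum>i\<in>{1..n}. (v i)\<^sup>2)"
proof -
  have "{..n} = insert 0 {1..n}" by auto
  then show ?thesis by (simp add: sqn_def)
qed

lemma on_sphere_iff:
  assumes "k \<ge> 1"
  shows "(r 0 - 1 / real k)\<^sup>2 + (\<Sum>i\<in>{1..n}. (r i)\<^sup>2) = (1 / real k)\<^sup>2 \<longleftrightarrow> sqn n r = 2 * r 0 / real k"
  by (simp add: sqn_split power2_diff field_simps)

lemma earring_iff:
  assumes "K \<subseteq> {1..}"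
  shows "r \<in> earring n K \<longleftrightarrow> (\<forall>i>n. r i = 0) \<and> (\<exists>k\<in>K. sqn n r = 2 * r 0 / real k)"
proof -
  have "(r 0 - 1 / real k)\<^sup>2 + (\<Sum>i\<in>{1..n}. (r i)\<^sup>2) = (1 / real k)\<^sup>2 \<longleftrightarrow> sqn n r = 2 * r 0 / real k"
    if "k \<in> K" for k
    using that assms by (intro on_sphere_iff) auto
  then show ?thesis unfolding earring_def by (simp cong: bex_cong)
qed

lemma sqn_pos: assumes "r \<noteq> hw_base" "\<And>i. i > n \<Longrightarrow> r i = 0" shows "sqn n r > 0"
proof -
  have "sqn n r \<noteq> 0" using assms unfolding sqn_eq_0_iff hw_base_def by (metis not_le ext)
  then show ?thesis using sqn_nonneg[of n r] by linarith
qed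

definition tan_coords :: "nat \<Rightarrow> nat \<Rightarrow> point \<Rightarrow> point" where
  "tan_coords n k x = (\<lambda>c. if c = 0 then real k / 2 else if c \<le> n then tan (pi * (x c - 1/2)) else 0)"

text \<open>The identification of the cube with the sphere of radius \<open>1/k\<close> of \<open>Defs\<close>, extended by the
  base point outside the open cube.\<close>

definition sph :: "nat \<Rightarrow> nat \<Rightarrow> point \<Rightarrow> point" where
  "sph n k x = (if x \<in> ocube n then hw_inversion n (tan_coords n k x) else hw_base)"

definition unsph :: "nat \<Rightarrow> point \<Rightarrow> point" where
  "unsph n p = (\<lambda>c. if c \<in> {1..n} then arctan (hw_inversion n p c) / pi + 1/2 else 0)"

text \<open>Inversion carries the sphere of radius \<open>1/k\<close>, without the base point, to
  the hyperplane with zeroth coordinate \<open>k/2\<close>, from which the index is read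
  off.\<close>

definition sph_index :: "nat \<Rightarrow> point \<Rightarrow> nat" where
  "sph_index n p = nat \<lfloor>2 * hw_inversion n p 0\<rfloor>"

lemma sqn_tan_coords: "k \<ge> 1 \<Longrightarrow> sqn n (tan_coords n k x) \<ge> (real k / 2)\<^sup>2"
  using sqn_ge[of 0 n "tan_coords n k x"] by (simp add: tan_coords_def)

lemma sqn_tan_coords_pos: "k \<ge> 1 \<Longrightarrow> sqn n (tan_coords n k x) > 0"
  using sqn_tan_coords[of k n x] by (smt (verit) of_nat_1 of_nat_mono zero_less_power half_gt_zero)

lemma inversion_sph: "k \<ge> 1 \<Longrightarrow> x \<in> ocube n \<Longrightarrow> hw_inversion n (sph n k x) = tan_coords n k x"
  using sqn_tan_coords_pos[of k n x] by (simp add: sph_def inversion_inversion)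

lemma sph_neq_base: "k \<ge> 1 \<Longrightarrow> x \<in> ocube n \<Longrightarrow> sph n k x \<noteq> hw_base"
proof
  assume "k \<ge> 1" "x \<in> ocube n" "sph n k x = hw_base"
  then have "hw_inversion n hw_base 0 = real k / 2" using inversion_sph[of k x n] by (simp add: tan_coords_def)
  then show False using \<open>k \<ge> 1\<close> by (simp add: hw_inversion_def hw_base_def)
qed

lemma base_in_earring: "K \<subseteq> {1..} \<Longrightarrow> K \<noteq> {} \<Longrightarrow> hw_base \<in> earring n K"
  by (subst earring_iff) (auto simp: hw_base_def sqn_def)

lemma sph_in_earring:
  assumes "K \<subseteq> {1..}" "k \<in> K"
  shows "sph n k x \<in> earring n K"
proof (cases "x \<in> ocube n")
  case True
  have k: "k \<ge> 1" using assms by auto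
  have p: "sph n k x = hw_inversion n (tan_coords n k x)" using True by (simp add: sph_def)
  have "sqn n (sph n k x) = 2 * sph n k x 0 / real k"
    using k unfolding p by (simp add: sqn_inversion hw_inversion_apply) (simp add: tan_coords_def)
  moreover have "sph n k x i = 0" if "i > n" for i using that by (simp add: p hw_inversion_apply tan_coords_def)
  ultimately show ?thesis using assms(2) by (subst earring_iff[OF assms(1)]) blast
next
  case False
  then show ?thesis using assms base_in_earring[of K n] by (auto simp: sph_def)
qed

lemma unsph_sph:
  assumes "k \<ge> 1" "x \<in> ocube n" "c \<in> {1..n}"
  shows "unsph n (sph n k x) c = x c"
proof -
  have "0 < x c" "x c < 1" using assms by (auto simp: ocube_def)
  then have "arctan (tan (pi * (x c - 1/2))) = pi * (x c - 1/2)" by (intro arctan_tan angle_bounds)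
  then show ?thesis using assms inversion_sph[of k x n] by (simp add: unsph_def tan_coords_def)
qed

lemma unsph_ocube: "unsph n p \<in> ocube n"
proof -
  have "0 < arctan u / pi + 1/2" "arctan u / pi + 1/2 < 1" for u
    using arctan_lbound[of u] arctan_ubound[of u] pi_gt_zero by (simp_all add: field_simps)
  then show ?thesis by (auto simp: ocube_def unsph_def)
qed

lemma unsph_ccube: "unsph n p \<in> ccube n"
  using unsph_ocube[of n p] by (auto simp: ocube_def ccube_def less_imp_le unsph_def)

lemma earring_cases:
  assumes "K \<subseteq> {1..}" "p \<in> earring n K" "p \<noteq> hw_base"
  shows "sph_index n p \<in> K" "2 * hw_inversion n p 0 = real (sph_index n p)"
    "sph n (sph_index n p) (unsph n p) = p" "sqn n p > 0"
proof -
  obtain k where k: "k \<in> K" "sqn n p = 2 * p 0 / real k" and p0: "\<And>i. i > n \<Longrightarrow> p i = 0"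
    using assms(2) unfolding earring_iff[OF assms(1)] by blast
  have k1: "k \<ge> 1" using k assms by auto
  show s: "sqn n p > 0" using sqn_pos assms(3) p0 by blast
  then have p00: "p 0 > 0" using k k1 by (simp add: zero_less_divide_iff zero_less_mult_iff)
  have q0: "hw_inversion n p 0 = real k / 2" using k p00 k1 by (simp add: hw_inversion_apply)
  have i: "sph_index n p = k" unfolding sph_index_def q0 by simp
  then show "sph_index n p \<in> K" "2 * hw_inversion n p 0 = real (sph_index n p)" using k q0 by auto
  have "tan_coords n k (unsph n p) = hw_inversion n p"
    by (rule ext) (use q0 p0 in \<open>auto simp: tan_coords_def unsph_def hw_inversion_apply tan_arctan\<close>)
  then show "sph n (sph_index n p) (unsph n p) = p"
    using s by (simp add: sph_def unsph_ocube i inversion_inversion)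
qed

lemma sph_index_sph: "k \<ge> 1 \<Longrightarrow> x \<in> ocube n \<Longrightarrow> sph_index n (sph n k x) = k"
  by (simp add: sph_index_def inversion_sph tan_coords_def)

lemma abs_sph_le:
  assumes "k \<ge> 1"
  shows "\<bar>sph n k x c\<bar> \<le> 2 / real k"
proof (cases "x \<in> ocube n \<and> c \<le> n")
  case True
  have "(sph n k x c)\<^sup>2 \<le> sqn n (sph n k x)" using True by (intro sqn_ge) auto
  also have "\<dots> = 1 / sqn n (tan_coords n k x)" using True by (simp add: sph_def sqn_inversion)
  also have "\<dots> \<le> 1 / (real k / 2)\<^sup>2" using sqn_tan_coords[OF assms, of n x] sqn_tan_coords_pos[OF assms, of n x] assms
    by (intro divide_left_mono mult_pos_pos) auto
  also have "\<dots> = (2 / real k)\<^sup>2" by (simp add: power_divide)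
  finally have "\<bar>sph n k x c\<bar> \<le> \<bar>2 / real k\<bar>" by (simp only: abs_le_square_iff)
  then show ?thesis by simp
next
  case False
  then have "sph n k x c = 0" by (auto simp: sph_def hw_base_def hw_inversion_apply tan_coords_def)
  then show ?thesis by simp
qed

lemma open_ocube: "open (ocube n)"
proof -
  have "ocube n = (\<Inter>c\<in>{1..n}. {x. 0 < x c} \<inter> {x. x c < 1})" by (auto simp: ocube_def)
  then show ?thesis
    by (simp only:) (intro open_INT open_Int finite_atLeastAtMost ballI open_Collect_less continuous_intros continuous_on_apply)
qed

text \<open>A quantitative form of the convergence to the base point at the walls of the cube;
  continuity of \<open>sph\<close> there rests on it.\<close>

lemma abs_sph_le_cos:
  assumes "k \<ge> 1" "x \<in> ocube n" "d \<in> {1..n}"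
  shows "\<bar>sph n k x c\<bar> \<le> 2 * cos (pi * (x d - 1/2))"
proof (cases "c \<le> n")
  case True
  define C where "C = cos (pi * (x d - 1/2))"
  have "0 < x d" "x d < 1" using assms by (auto simp: ocube_def)
  then have C: "0 < C" unfolding C_def by (rule angle_bounds)
  have C1: "C \<le> 1" by (simp add: C_def)
  let ?q = "tan_coords n k x"
  have "(?q 0)\<^sup>2 + (?q d)\<^sup>2 = (\<Sum>j\<in>{0,d}. (?q j)\<^sup>2)" using assms(3) by auto
  also have "\<dots> \<le> sqn n ?q" unfolding sqn_def using assms(3) by (intro sum_mono2) auto
  finally have "(real k / 2)\<^sup>2 + (tan (pi * (x d - 1/2)))\<^sup>2 \<le> sqn n ?q" using assms(3) by (simp add: tan_coords_def)
  moreover have "1 + (tan (pi * (x d - 1/2)))\<^sup>2 = 1 / C\<^sup>2"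
    using tan_sec[of "pi * (x d - 1/2)"] C by (simp add: C_def inverse_eq_divide power_divide)
  moreover have "(1/2)\<^sup>2 \<le> (real k / 2)\<^sup>2" using assms(1) by (intro power_mono) auto
  \<comment> \<open>From \<open>1 / C\<^sup>2 - 3/4\<close> this leaves the lower bound
    \<open>1 / (4 * C\<^sup>2)\<close>, whose inverse is the square of \<open>2 * C\<close>.\<close>
  moreover have "3/4 \<le> 3 / (4 * C\<^sup>2)" using C C1 power_le_one[of C 2] by (simp add: field_simps)
  ultimately have q: "1 / (4 * C\<^sup>2) \<le> sqn n ?q" by (simp add: power2_eq_square field_simps)
  have "(sph n k x c)\<^sup>2 \<le> sqn n (sph n k x)" using True by (intro sqn_ge) auto
  also have "\<dots> = 1 / sqn n ?q" using assms by (simp add: sph_def sqn_inversion)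
  also have "\<dots> \<le> 1 / (1 / (4 * C\<^sup>2))" using q C by (intro divide_left_mono mult_pos_pos) (auto intro: less_le_trans[OF _ q])
  also have "\<dots> = (2 * C)\<^sup>2" by (simp add: power2_eq_square)
  finally have "(sph n k x c)\<^sup>2 \<le> (2 * C)\<^sup>2" .
  then have "\<bar>sph n k x c\<bar> \<le> \<bar>2 * C\<bar>" by (simp add: abs_le_square_iff)
  then show ?thesis using C by (simp add: C_def)
next
  case False
  have "0 < x d" "x d < 1" using assms by (auto simp: ocube_def)
  then have "0 < cos (pi * (x d - 1/2))" by (rule angle_bounds)
  moreover have "sph n k x c = 0" using False assms by (auto simp: sph_def hw_inversion_apply tan_coords_def)
  ultimately show ?thesis by simp
qed

lemma continuous_on_sph:
  assumes "k \<ge> 1"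
  shows "continuous_on UNIV (sph n k)"
proof (rule continuous_on_coordinatewise_then_product)
  fix c
  have "isCont (\<lambda>x. sph n k x c) x" for x
  proof (cases "x \<in> ocube n")
    case True
    have tc: "continuous_on (ocube n) (\<lambda>x. tan_coords n k x j)" for j
    proof (cases "j = 0 \<or> j > n")
      case False
      have nz: "cos (pi * (x j - 1/2)) \<noteq> 0" if "x \<in> ocube n" for x
      proof -
        have "0 < x j" "x j < 1" using that False by (auto simp: ocube_def)
        then show ?thesis using angle_bounds(3) by force
      qed
      have "continuous_on (ocube n) (\<lambda>x. tan (pi * (x j - 1/2)))"
        unfolding tan_def
        by (intro continuous_on_divide continuous_on_sin continuous_on_cos continuous_on_mult continuous_on_diff
            continuous_on_const continuous_on_subset[OF continuous_on_apply] subset_UNIV ballI) (rule nz)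
      then show ?thesis using False by (simp add: tan_coords_def)
    qed (auto simp: tan_coords_def)
    have "continuous_on (ocube n) (\<lambda>x. tan_coords n k x c / sqn n (tan_coords n k x))"
    proof (intro continuous_on_divide tc ballI)
      show "continuous_on (ocube n) (\<lambda>x. sqn n (tan_coords n k x))"
        unfolding sqn_def by (intro continuous_on_sum continuous_on_power tc)
      show "sqn n (tan_coords n k x) \<noteq> 0" for x using sqn_tan_coords_pos[OF assms, of n x] by simp
    qed
    then have "continuous_on (ocube n) (\<lambda>x. sph n k x c)"
      by (rule continuous_on_eq) (simp add: sph_def hw_inversion_apply)
    then show ?thesis using True open_ocube continuous_on_eq_continuous_at by blast
  next
    case False
    then obtain d where d: "d \<in> {1..n}" "x d \<le> 0 \<or> 1 \<le> x d" by (force simp: ocube_def)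
    \<comment> \<open>The cosine bound with a clamped argument: continuous everywhere and zero
      beyond the walls in direction \<open>d\<close>, so it dominates \<open>sph\<close> on both
      sides of the wall.\<close>
    define g where "g = (\<lambda>y::point. 2 * cos (pi * (max 0 (min 1 (y d)) - 1/2)))"
    have "continuous_on UNIV g" unfolding g_def by (intro continuous_intros continuous_on_apply)
    then have "isCont g x" using continuous_on_eq_continuous_at by blast
    moreover have "g x = 0"
    proof -
      have "max 0 (min 1 (x d)) = 0 \<or> max 0 (min 1 (x d)) = 1" using d(2) by auto
      then show ?thesis unfolding g_def by (elim disjE) (simp_all)
    qed
    ultimately have g: "(g \<longlongrightarrow> 0) (at x)" by (simp add: isCont_def)
    have "\<bar>sph n k y c\<bar> \<le> g y" for y
    proof (cases "y \<in> ocube n")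
      case True
      then have "max 0 (min 1 (y d)) = y d" using d(1) by (auto simp: ocube_def less_imp_le)
      then show ?thesis using abs_sph_le_cos[OF assms True d(1), of c] by (simp add: g_def)
    next
      case False
      have "0 \<le> g y" unfolding g_def by (intro mult_nonneg_nonneg cos_ge_zero) (auto simp: field_simps)
      then show ?thesis using False by (simp add: sph_def hw_base_def)
    qed
    then have "((\<lambda>y. sph n k y c) \<longlongrightarrow> 0) (at x)"
      by (intro Lim_null_comparison[OF _ g]) (auto intro: always_eventually)
    then show ?thesis using False by (simp add: isCont_def sph_def hw_base_def)
  qed
  then show "continuous_on UNIV (\<lambda>x. sph n k x c)" by (simp add: continuous_at_imp_continuous_on)
qed

lemma cube_map_sph:
  assumes "f hw_base = y"
  shows "cube_map n y (\<lambda>x. f (sph n k x))"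
proof -
  have "sph n k x = sph n k z" if "\<forall>c\<in>{1..n}. x c = z c" for x z
  proof -
    have "x \<in> ocube n \<longleftrightarrow> z \<in> ocube n" using that by (simp add: ocube_def)
    moreover have "tan_coords n k x = tan_coords n k z" using that by (auto simp: tan_coords_def fun_eq_iff)
    ultimately show ?thesis by (simp add: sph_def)
  qed
  then have "depends_on {1..n} (\<lambda>x. f (sph n k x))" unfolding depends_on_def by metis
  then show ?thesis using assms by (simp add: cube_map_def sph_def)
qed

lemma continuous_sph_homotopy:
  assumes K: "K \<subseteq> {1..}" "k \<in> K"
    and F: "continuous_map (prod_topology (top_of_set {0..1}) (top_of_set (earring n K))) T F"
  shows "continuous_map euclidean T (\<lambda>z::real \<times> point. F (max 0 (min 1 (fst z)), sph n k (snd z)))"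
proof -
  have c: "continuous_on UNIV (\<lambda>z::real \<times> point. sph n k (snd z))"
    by (rule continuous_on_compose2[OF continuous_on_sph]) (use K in \<open>auto intro: continuous_intros\<close>)
  have "continuous_map euclidean (prod_topology (top_of_set {0..1}) (top_of_set (earring n K)))
     (\<lambda>z::real \<times> point. (max 0 (min 1 (fst z)), sph n k (snd z)))"
    unfolding continuous_map_pairwise o_def
    using c sph_in_earring[OF K] by (auto simp: continuous_map_in_subtopology intro!: continuous_intros)
  from continuous_map_compose[OF this F] show ?thesis by (simp add: o_def)
qed

text \<open>By the tube lemma one neighbourhood of the base point serves all times in the unit
  interval, and it contains almost all spheres because the coordinates on the sphere with index
  \<open>k\<close> are at most \<open>2 / k\<close>.\<close>

lemma sph_homotopy_small:
  assumes K: "K \<subseteq> {1..}" "K \<noteq> {}"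
    and F: "continuous_map (prod_topology (top_of_set {0..1::real}) (top_of_set (earring n K))) T F"
    and base: "\<And>t. t \<in> {0..1} \<Longrightarrow> F (t, hw_base) = y" and U: "openin T U" "y \<in> U"
  shows "finite {k\<in>K. \<not> (\<forall>t\<in>{0..1}. \<forall>x. F (t, sph n k x) \<in> U)}"
proof -
  let ?P = "prod_topology (top_of_set {0..1::real}) (top_of_set (earring n K))"
  have W: "openin ?P {z \<in> topspace ?P. F z \<in> U}"
    by (rule openin_continuous_map_preimage[OF F U(1)])
  have "\<exists>A V. openin (top_of_set {0..1::real}) A \<and> openin (top_of_set (earring n K)) V \<and> {0..1} \<subseteq> A \<and>
      hw_base \<in> V \<and> A \<times> V \<subseteq> {z \<in> topspace ?P. F z \<in> U}"
  proof (rule tube_lemma_left[OF W])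
    show "compactin (top_of_set {0..1::real}) {0..1}" by (simp add: compactin_subtopology)
    show "hw_base \<in> topspace (top_of_set (earring n K))" using base_in_earring[OF K] by simp
    show "{0..1} \<times> {hw_base} \<subseteq> {z \<in> topspace ?P. F z \<in> U}"
      using base U(2) base_in_earring[OF K] by auto
  qed
  then obtain A V where AV: "openin (top_of_set (earring n K)) V" "{0..1} \<subseteq> A" "hw_base \<in> V" "A \<times> V \<subseteq> {z \<in> topspace ?P. F z \<in> U}"
    by blast
  then obtain O' where O': "open O'" "V = earring n K \<inter> O'" by (auto simp: openin_open)
  then obtain e where e: "e > 0" "\<And>p. dist p hw_base < e \<Longrightarrow> p \<in> O'"
    using AV(3) unfolding open_dist by blast
  obtain M :: nat where M: "4 / e < real M" using reals_Archimedean2 by blast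
  have "{k\<in>K. \<not> (\<forall>t\<in>{0..1}. \<forall>x. F (t, sph n k x) \<in> U)} \<subseteq> {..M}"
  proof (rule ccontr)
    assume "\<not> ?thesis"
    then obtain k where k': "k \<in> K" "\<not> (\<forall>t\<in>{0..1}. \<forall>x. F (t, sph n k x) \<in> U)" "k \<notin> {..M}" by blast
    then obtain t x where "t \<in> {0..1}" "F (t, sph n k x) \<notin> U" by blast
    with k' have k: "k \<in> K" "k > M" "t \<in> {0..1}" "F (t, sph n k x) \<notin> U" by auto
    have k1: "k \<ge> 1" using k K by auto
    have "dist (sph n k x) hw_base \<le> 2 * (2 / real k)"
      using abs_sph_le[OF k1] by (intro dist_fun_le) (simp add: hw_base_def)
    also have "\<dots> < e"
    proof -
      have "4 / e < real k" using M k(2) by linarith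
      then show ?thesis using e(1) k1 by (simp add: field_simps)
    qed
    finally have "sph n k x \<in> V" using e(2) O' sph_in_earring[OF K(1) k(1)] by auto
    then show False using AV(2,4) k(3,4) by blast
  qed
  then show ?thesis by (rule finite_subset) simp
qed

section \<open>Gluing cube maps to maps of an earring\<close>

definition unglue :: "nat \<Rightarrow> 'a \<Rightarrow> (nat \<Rightarrow> point \<Rightarrow> 'a) \<Rightarrow> point \<Rightarrow> 'a" where
  "unglue n y g p = (if p = hw_base then y else g (sph_index n p) (unsph n p))"

lemma unglue_base [simp]: "unglue n y g hw_base = y" by (simp add: unglue_def)

lemma unglue_sph:
  assumes "k \<ge> 1" "cube_map n y (g k)"
  shows "unglue n y g (sph n k x) = g k x"
proof (cases "x \<in> ocube n")
  case True
  have "g k (unsph n (sph n k x)) = g k x"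
    by (rule depends_onD[of "{1..n}"]) (use assms unsph_sph[OF assms(1) True] in \<open>auto simp: cube_map_def\<close>)
  then show ?thesis using True sph_neq_base[OF assms(1) True] sph_index_sph[OF assms(1) True]
    by (simp add: unglue_def)
next
  case False
  then show ?thesis using assms by (simp add: sph_def cube_map_def)
qed

text \<open>Away from the base point the index is locally constant and \<open>unsph\<close> is
  continuous. At the base point, \<open>small\<close> leaves finitely many spheres to consider, and
  on each the points with a value outside \<open>U\<close> at some time lie in a compact set
  avoiding the base point.\<close>

lemma continuous_unglue_homotopy:
  fixes h :: "nat \<Rightarrow> real \<times> point \<Rightarrow> 'a"
  assumes K: "K \<subseteq> {1..}" and y: "y \<in> topspace T"
    and cont: "\<And>k. k \<in> K \<Longrightarrow> continuous_map euclidean T (h k)"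
    and out: "\<And>k t x. k \<in> K \<Longrightarrow> x \<notin> ocube n \<Longrightarrow> h k (t,x) = y"
    and small: "\<And>U. openin T U \<Longrightarrow> y \<in> U \<Longrightarrow> finite {k\<in>K. \<not> (\<forall>t\<in>{0..1}. \<forall>x. h k (t,x) \<in> U)}"
  shows "continuous_map (prod_topology (top_of_set {0..1}) (top_of_set (earring n K))) T
           (\<lambda>z. unglue n y (\<lambda>k x. h k (fst z, x)) (snd z))"
proof -
  let ?S = "{0..1} \<times> earring n K :: (real \<times> point) set"
  let ?f = "\<lambda>z. unglue n y (\<lambda>k x. h k (fst z, x)) (snd z)"
  have top: "prod_topology (top_of_set {0..1}) (top_of_set (earring n K)) = top_of_set ?S"
    by (metis prod_topology_euclidean subtopology_Times)
  have htop: "h k z \<in> topspace T" if "k \<in> K" for k z using continuous_map_funspace[OF cont[OF that]] by auto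
  have G: "open {z. h k z \<in> U}" if "k \<in> K" "openin T U" for k U
    using openin_continuous_map_preimage[OF cont[OF that(1)] that(2)] by simp
  have loc: "\<exists>W. open W \<and> z \<in> W \<and> (\<forall>w\<in>W \<inter> ?S. ?f w \<in> U)"
    if U: "openin T U" and z: "z \<in> ?S" "?f z \<in> U" for U z
  proof (cases "snd z = hw_base")
    case True
    then have yU: "y \<in> U" using z by simp
    define E where "E = {k\<in>K. \<not> (\<forall>t\<in>{0..1}. \<forall>x. h k (t,x) \<in> U)}"
    have finE: "finite E" unfolding E_def by (rule small[OF U yU])
    define C where "C = (\<lambda>k. ({0..1} \<times> ccube n) - {z. h k z \<in> U})"
    define B where "B = (\<lambda>k. sph n k ` snd ` C k)"
    have compB: "compact (B k)" if "k \<in> E" for k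
    proof -
      have kK: "k \<in> K" using that by (simp add: E_def)
      have "compact (C k)" unfolding C_def
        by (intro compact_diff compact_Times compact_ccube compact_Icc G[OF kK U])
      then have "compact (snd ` C k)" by (rule compact_continuous_image[rotated]) (intro continuous_intros)
      then show ?thesis unfolding B_def
        by (rule compact_continuous_image[rotated])
           (rule continuous_on_subset[OF continuous_on_sph], use kK K in auto)
    qed
    have notB: "hw_base \<notin> B k" if "k \<in> E" for k
    proof
      assume "hw_base \<in> B k"
      then obtain t x where x: "(t,x) \<in> C k" "sph n k x = hw_base" by (auto simp: B_def)
      have kK: "k \<in> K" using that by (simp add: E_def)
      then have "x \<notin> ocube n" using sph_neq_base[of k x n] x(2) K by auto
      then show False using x(1) yU out[OF kK] by (auto simp: C_def)
    qed
    show ?thesis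
    proof (intro exI conjI ballI)
      show "open (UNIV \<times> (- (\<Union>k\<in>E. B k)) :: (real \<times> point) set)"
        using finE compB by (intro open_Times open_UNIV open_Compl closed_UN ballI compact_imp_closed) auto
      show "z \<in> UNIV \<times> (- (\<Union>k\<in>E. B k))" using True notB by (cases z) auto
      fix w assume w: "w \<in> UNIV \<times> (- (\<Union>k\<in>E. B k)) \<inter> ?S"
      obtain t p where tp: "w = (t,p)" by force
      show "?f w \<in> U"
      proof (cases "p = hw_base")
        case False
        have p: "p \<in> earring n K" "t \<in> {0..1}" using w tp by auto
        note ec = earring_cases[OF K p(1) False]
        show ?thesis
        proof (rule ccontr)
          assume "?f w \<notin> U"
          then have nU: "h (sph_index n p) (t, unsph n p) \<notin> U" using False by (simp add: tp unglue_def)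
          then have E: "sph_index n p \<in> E" using ec(1) p(2) by (auto simp: E_def)
          have "(t, unsph n p) \<in> C (sph_index n p)" using nU p(2) unsph_ccube by (simp add: C_def)
          then have "p \<in> B (sph_index n p)" unfolding B_def using ec(3) by force
          then show False using w E tp by auto
        qed
      qed (simp add: tp yU)
    qed
  next
    case False
    obtain t p where tp: "z = (t,p)" by force
    have p: "p \<in> earring n K" "p \<noteq> hw_base" using z False tp by auto
    note ec = earring_cases[OF K p]
    define k where "k = sph_index n p"
    have kK: "k \<in> K" using ec(1) by (simp add: k_def)
    define P where "P = {w::real \<times> point. 0 < sqn n (snd w)}"
    have csq: "continuous_on A (\<lambda>w::real \<times> point. sqn n (snd w))" for A
      unfolding sqn_def by (intro continuous_intros continuous_on_subset[OF continuous_on_snd_apply] subset_UNIV)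
    have oP: "open P" unfolding P_def by (intro open_Collect_less csq continuous_intros)
    have cinv: "continuous_on P (\<lambda>w. hw_inversion n (snd w) c)" for c
      unfolding hw_inversion_apply
      by (intro continuous_on_divide csq continuous_on_subset[OF continuous_on_snd_apply] subset_UNIV) (auto simp: P_def)
    have cu: "continuous_on P (\<lambda>w. (fst w, unsph n (snd w)))"
    proof (intro continuous_on_Pair continuous_on_coordinatewise_then_product)
      show "continuous_on P (\<lambda>w. unsph n (snd w) c)" for c
        unfolding unsph_def using cinv by (cases "c \<in> {1..n}") (auto intro!: continuous_intros)
    qed (intro continuous_intros)
    \<comment> \<open>On the earring the doubled zeroth coordinate of the inverted point is an
      integer, so a window of radius 1 around \<open>k\<close> pins the index.\<close>
    define W where "W = (P \<inter> (\<lambda>w. 2 * hw_inversion n (snd w) 0) -` {real k - 1 <..< real k + 1}) \<inter>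
         (P \<inter> (\<lambda>w. (fst w, unsph n (snd w))) -` {w. h k w \<in> U})"
    show ?thesis
    proof (intro exI conjI ballI)
      show "open W" unfolding W_def
        by (intro open_Int continuous_open_preimage[OF _ oP] cu G[OF kK U] continuous_on_mult continuous_on_const cinv
            open_greaterThanLessThan)
      show "z \<in> W" using ec(2,4) z(2) p(2) by (auto simp: W_def P_def tp k_def unglue_def)
      fix w assume w: "w \<in> W \<inter> ?S"
      obtain t' p' where tp': "w = (t',p')" by force
      have p': "p' \<in> earring n K" "0 < sqn n p'" using w by (auto simp: W_def P_def tp')
      have "p' \<noteq> hw_base" using p'(2) by (auto simp: hw_base_def sqn_def)
      note ec' = earring_cases[OF K p'(1) this]
      have "real k - 1 < real (sph_index n p')" "real (sph_index n p') < real k + 1"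
        using w ec'(2) by (auto simp: W_def tp')
      then have "sph_index n p' = k" by linarith
      then show "?f w \<in> U" using w \<open>p' \<noteq> hw_base\<close> by (auto simp: W_def tp' unglue_def)
    qed
  qed
  show ?thesis unfolding top continuous_map_def
  proof (intro conjI allI impI)
    show "?f \<in> topspace (top_of_set ?S) \<rightarrow> topspace T"
    proof
      fix z assume "z \<in> topspace (top_of_set ?S)"
      then have "snd z \<in> earring n K" by auto
      then show "?f z \<in> topspace T"
        using y htop earring_cases(1)[OF K, of "snd z" n] by (auto simp: unglue_def)
    qed
    fix U assume U: "openin T U"
    show "openin (top_of_set ?S) {z \<in> topspace (top_of_set ?S). ?f z \<in> U}"
    proof (subst openin_subopen, intro ballI)
      fix z assume "z \<in> {z \<in> topspace (top_of_set ?S). ?f z \<in> U}"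
      then have z: "z \<in> ?S" "?f z \<in> U" by auto
      then obtain W where W: "open W" "z \<in> W" "\<forall>w\<in>W \<inter> ?S. ?f w \<in> U" using loc[OF U z] by blast
      show "\<exists>V. openin (top_of_set ?S) V \<and> z \<in> V \<and> V \<subseteq> {z \<in> topspace (top_of_set ?S). ?f z \<in> U}"
        using W z by (intro exI[of _ "?S \<inter> W"]) (simp add: openin_open_Int subset_iff)
    qed
  qed
qed

section \<open>The Hawaiian groups\<close>

lemma outside_ocube: "c \<in> {1..n} \<Longrightarrow> x c \<le> 0 \<or> 1 \<le> x c \<Longrightarrow> x \<notin> ocube n"
  unfolding ocube_def by force

text \<open>In the cube chart the inversion and tangent formulas become ordinary concatenation in
  the first coordinate; the exceptional values 0 and 1 of \<open>s\<close> correspond to boundary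
  points, which \<open>sph\<close> sends to the base point.\<close>

lemma hw_concat_sph:
  assumes k: "k \<ge> 1" and n: "n \<ge> 1" and f: "f hw_base = y" and g: "g hw_base = y"
  shows "hw_concat n f g (sph n k x) =
    (if x 1 \<le> 1/2 then f (sph n k (x(1 := 2 * x 1))) else g (sph n k (x(1 := 2 * x 1 - 1))))"
proof (cases "x \<in> ocube n")
  case False
  then obtain c where c: "c \<in> {1..n}" "x c \<le> 0 \<or> 1 \<le> x c" by (force simp: ocube_def)
  have b: "sph n k (x(1 := s)) = hw_base" if "c \<noteq> 1 \<or> s \<le> 0 \<or> 1 \<le> s" for s
  proof -
    have "(x(1 := s)) c \<le> 0 \<or> 1 \<le> (x(1 := s)) c" using that c by auto
    then have "x(1 := s) \<notin> ocube n" by (rule outside_ocube[OF c(1)])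
    then show ?thesis by (simp add: sph_def)
  qed
  have "sph n k x = hw_base" using False by (simp add: sph_def)
  then show ?thesis using b[of "2 * x 1"] b[of "2 * x 1 - 1"] c f g
    by (cases "c = 1") (auto simp: hw_concat_def)
next
  case True
  have one: "1 \<in> {1..n}" using n by simp
  have x1: "0 < x 1" "x 1 < 1" using True one by (auto simp: ocube_def)
  let ?q = "tan_coords n k x"
  have q: "hw_inversion n (sph n k x) = ?q" by (rule inversion_sph[OF k True])
  have t: "arctan (?q 1) / pi + 1/2 = x 1"
    using unsph_sph[OF k True one] one unfolding unsph_def q by simp
  have pt: "(if s = 0 \<or> s = 1 then hw_base else hw_inversion n (?q(1 := tan (pi * (s - 1/2))))) = sph n k (x(1 := s))"
    if "0 \<le> s" "s \<le> 1" for s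
  proof (cases "s = 0 \<or> s = 1")
    case s: True
    then have "x(1 := s) \<notin> ocube n" using one unfolding ocube_def by (auto intro!: bexI[of _ 1])
    then show ?thesis using s by (simp add: sph_def)
  next
    case False
    then have "x(1 := s) \<in> ocube n" using True that by (auto simp: ocube_def)
    moreover have "?q(1 := tan (pi * (s - 1/2))) = tan_coords n k (x(1 := s))"
      using n by (auto simp: tan_coords_def fun_eq_iff)
    ultimately show ?thesis using False by (simp add: sph_def)
  qed
  show ?thesis
    using sph_neq_base[OF k True] pt[of "2 * x 1"] pt[of "2 * x 1 - 1"] x1
    unfolding hw_concat_def Let_def q t by (auto simp: not_le)
qed

text \<open>One development serves both groups: \<open>K = {1..}\<close> yields the Hawaiian group
  and \<open>K = {1}\<close> the homotopy group.\<close>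

locale earring_maps =
  fixes K :: "nat set" and n :: nat and T :: "'a topology" and y :: 'a
  assumes K: "K \<subseteq> {1..}" "K \<noteq> {}" and n: "n \<ge> 1" and y: "y \<in> topspace T"
begin

abbreviation D :: "point topology" where "D \<equiv> top_of_set (earring n K)"

definition based :: "(point \<Rightarrow> 'a) \<Rightarrow> bool" where
  "based f \<longleftrightarrow> continuous_map D T f \<and> f hw_base = y"

definition homot :: "(point \<Rightarrow> 'a) \<Rightarrow> (point \<Rightarrow> 'a) \<Rightarrow> bool" where
  "homot f g \<longleftrightarrow> homotopic_with (\<lambda>h. h hw_base = y) D T f g"

lemma K1: "k \<in> K \<Longrightarrow> k \<ge> 1" using K by auto

lemma base_in: "hw_base \<in> topspace D" using base_in_earring[OF K] by simp

lemma sph_cases: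
  assumes "p \<in> earring n K"
  obtains "p = hw_base" | k x where "k \<in> K" "x \<in> ocube n" "p = sph n k x"
  using earring_cases[OF K(1) assms] unsph_ocube by metis

lemma based_const: "based (\<lambda>_. y)" using y by (simp add: based_def)

lemma based_base: "based f \<Longrightarrow> f hw_base = y" by (simp add: based_def)

lemma based_cube_map: "based f \<Longrightarrow> cube_map n y (\<lambda>x. f (sph n k x))"
  by (rule cube_map_sph) (simp add: based_def)

lemma based_outside: "based f \<Longrightarrow> x \<notin> ocube n \<Longrightarrow> f (sph n k x) = y"
  using based_cube_map[of f k] by (simp add: cube_map_def)

lemma based_continuous:
  assumes "based f" "k \<in> K"
  shows "continuous_map euclidean T (\<lambda>x. f (sph n k x))"
proof -
  have "continuous_map euclidean D (sph n k)"
    using continuous_on_sph[OF K1[OF assms(2)]] sph_in_earring[OF K(1) assms(2)]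
    by (auto simp: continuous_map_in_subtopology)
  from continuous_map_compose[OF this, of T f] show ?thesis using assms(1) by (simp add: based_def o_def)
qed

lemma based_continuous_on:
  assumes "based f" "k \<in> K" "continuous_on UNIV \<phi>"
  shows "continuous_map euclidean T (\<lambda>z. f (sph n k (\<phi> z)))"
  using continuous_map_compose_on[OF based_continuous[OF assms(1,2)] assms(3)] .

lemma based_small:
  assumes f: "based f" and U: "openin T U" "y \<in> U"
  shows "finite {k\<in>K. \<not> (\<forall>x. f (sph n k x) \<in> U)}"
proof -
  have "continuous_map (prod_topology (top_of_set {0..1::real}) D) T (f \<circ> snd)"
    unfolding continuous_map_of_snd using f by (simp add: based_def)
  then have "continuous_map (prod_topology (top_of_set {0..1::real}) D) T (\<lambda>z. f (snd z))"
    by (simp only: o_def)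
  from sph_homotopy_small[OF K this _ U] have "finite {k\<in>K. \<not> (\<forall>t\<in>{0..1::real}. \<forall>x. f (sph n k x) \<in> U)}"
    using f by (simp add: based_def)
  then show ?thesis by (rule finite_subset[rotated]) force
qed

text \<open>The criterion for homotopies, applied to a homotopy that is constant in time.\<close>

lemma basedI:
  assumes "f hw_base = y" and cont: "\<And>k. k \<in> K \<Longrightarrow> continuous_map euclidean T (\<lambda>x. f (sph n k x))"
    and small: "\<And>U. openin T U \<Longrightarrow> y \<in> U \<Longrightarrow> finite {k\<in>K. \<not> (\<forall>x. f (sph n k x) \<in> U)}"
  shows "based f"
proof -
  let ?h = "\<lambda>k z. f (sph n k (snd z))"
  have "continuous_map (prod_topology (top_of_set {0..1}) D) T
           (\<lambda>z::real \<times> point. unglue n y (\<lambda>k x. ?h k (fst z, x)) (snd z))"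
  proof (rule continuous_unglue_homotopy[OF K(1) y])
    show "continuous_map euclidean T (?h k :: real \<times> point \<Rightarrow> 'a)" if "k \<in> K" for k
      by (rule continuous_map_compose_on[OF cont[OF that], of snd]) (intro continuous_intros)
    show "?h k (t,x) = y" if "x \<notin> ocube n" for k x and t :: real using that assms(1) by (simp add: sph_def)
    show "finite {k\<in>K. \<not> (\<forall>t\<in>{0..1::real}. \<forall>x. ?h k (t,x) \<in> U)}" if "openin T U" "y \<in> U" for U
      by (rule finite_subset[OF _ small[OF that]]) auto
  qed
  moreover have "continuous_map D (prod_topology (top_of_set {0..1}) D) (\<lambda>p. (0::real,p))"
    by (intro continuous_map_pairedI) auto
  ultimately have "continuous_map D T ((\<lambda>z::real \<times> point. unglue n y (\<lambda>k x. ?h k (fst z, x)) (snd z)) \<circ> (\<lambda>p. (0,p)))"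
    by (rule continuous_map_compose[rotated])
  then have "continuous_map D T (unglue n y (\<lambda>k x. f (sph n k x)))" by (simp add: o_def)
  then have "continuous_map D T f"
  proof (rule continuous_map_eq)
    show "unglue n y (\<lambda>k x. f (sph n k x)) p = f p" if "p \<in> topspace D" for p
      using that earring_cases(3)[OF K(1), of p n] assms(1) by (auto simp: unglue_def)
  qed
  then show ?thesis using assms(1) by (simp add: based_def)
qed

lemma based_unglue:
  assumes cont: "\<And>k. k \<in> K \<Longrightarrow> continuous_map euclidean T (g k)" and cube: "\<And>k. k \<in> K \<Longrightarrow> cube_map n y (g k)"
    and small: "\<And>U. openin T U \<Longrightarrow> y \<in> U \<Longrightarrow> finite {k\<in>K. \<not> (\<forall>x. g k x \<in> U)}"
  shows "based (unglue n y g)"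
proof (rule basedI)
  have eq: "unglue n y g (sph n k x) = g k x" if "k \<in> K" for k x
    by (rule unglue_sph) (use K1[OF that] cube[OF that] in auto)
  show "continuous_map euclidean T (\<lambda>x. unglue n y g (sph n k x))" if "k \<in> K" for k
    using cont[OF that] eq[OF that] by simp
  show "finite {k\<in>K. \<not> (\<forall>x. unglue n y g (sph n k x) \<in> U)}" if "openin T U" "y \<in> U" for U
    using small[OF that] eq by (simp cong: conj_cong)
qed simp

lemma homotI:
  assumes f: "based f" and g: "based g"
    and cont: "\<And>k. k \<in> K \<Longrightarrow> continuous_map euclidean T (h k :: real \<times> point \<Rightarrow> 'a)"
    and h0: "\<And>k x. k \<in> K \<Longrightarrow> x \<in> ocube n \<Longrightarrow> h k (0,x) = f (sph n k x)"
    and h1: "\<And>k x. k \<in> K \<Longrightarrow> x \<in> ocube n \<Longrightarrow> h k (1,x) = g (sph n k x)"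
    and out: "\<And>k t x. k \<in> K \<Longrightarrow> x \<notin> ocube n \<Longrightarrow> h k (t,x) = y"
    and small: "\<And>U. openin T U \<Longrightarrow> y \<in> U \<Longrightarrow> finite {k\<in>K. \<not> (\<forall>t\<in>{0..1}. \<forall>x. h k (t,x) \<in> U)}"
  shows "homot f g"
  unfolding homot_def
proof (subst homotopic_with)
  show "(h hw_base = y) = (k hw_base = y)" if "\<And>x. x \<in> topspace D \<Longrightarrow> h x = k x" for h k
    using that[OF base_in] by simp
  let ?F = "\<lambda>z. unglue n y (\<lambda>k x. h k (fst z, x)) (snd z)"
  have eq: "?F (t, p) = f p" if "p \<in> topspace D" "\<And>k x. k \<in> K \<Longrightarrow> x \<in> ocube n \<Longrightarrow> h k (t,x) = f (sph n k x)" "based f" for t p f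
  proof (cases "p = hw_base")
    case True then show ?thesis using that(3) by (simp add: based_def)
  next
    case False
    have "p \<in> earring n K" using that(1) by simp
    note ec = earring_cases[OF K(1) this False]
    show ?thesis using False that(2)[OF ec(1) unsph_ocube] ec(3) by (simp add: unglue_def)
  qed
  show "\<exists>h. continuous_map (prod_topology (top_of_set {0..1::real}) D) T h \<and>
      (\<forall>x\<in>topspace D. h (0,x) = f x) \<and> (\<forall>x\<in>topspace D. h (1,x) = g x) \<and> (\<forall>t\<in>{0..1}. h (t, hw_base) = y)"
  proof (intro exI conjI ballI)
    show "continuous_map (prod_topology (top_of_set {0..1}) D) T ?F"
      by (rule continuous_unglue_homotopy[OF K(1) y cont out small])
    show "?F (0,p) = f p" if "p \<in> topspace D" for p by (rule eq[OF that h0 f])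
    show "?F (1,p) = g p" if "p \<in> topspace D" for p by (rule eq[OF that h1 g])
  qed simp
qed

lemma homotE:
  assumes "homot f g"
  obtains h where "\<And>k. k \<in> K \<Longrightarrow> continuous_map euclidean T (h k :: real \<times> point \<Rightarrow> 'a)"
    "\<And>k x. h k (0,x) = f (sph n k x)" "\<And>k x. h k (1,x) = g (sph n k x)"
    "\<And>k t. cube_map n y (\<lambda>x. h k (t,x))"
    "\<And>U. openin T U \<Longrightarrow> y \<in> U \<Longrightarrow> finite {k\<in>K. \<not> (\<forall>t. \<forall>x. h k (t,x) \<in> U)}"
proof -
  obtain F where F: "continuous_map (prod_topology (top_of_set {0..1::real}) D) T F"
    "\<And>x. F (0,x) = f x" "\<And>x. F (1,x) = g x" "\<And>t. t \<in> {0..1} \<Longrightarrow> F (t,hw_base) = y"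
    using assms unfolding homot_def homotopic_with_def by blast
  define h where "h = (\<lambda>k z. F (max 0 (min 1 (fst z)), sph n k (snd z)))"
  show ?thesis
  proof (rule that)
    show "continuous_map euclidean T (h k)" if "k \<in> K" for k
      unfolding h_def by (rule continuous_sph_homotopy[OF K(1) that F(1)])
    show "h k (0,x) = f (sph n k x)" "h k (1,x) = g (sph n k x)" for k x by (simp_all add: h_def F)
    show "cube_map n y (\<lambda>x. h k (t,x))" for k t
      unfolding h_def fst_conv snd_conv
      by (rule cube_map_sph[where f = "\<lambda>p. F (max 0 (min 1 t), p)"]) (simp add: F)
    show "finite {k\<in>K. \<not> (\<forall>t. \<forall>x. h k (t,x) \<in> U)}" if "openin T U" "y \<in> U" for U
    proof (rule finite_subset[OF _ sph_homotopy_small[OF K F(1) F(4) that]])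
      have "max 0 (min 1 t) \<in> {0..1::real}" for t by auto
      then show "{k\<in>K. \<not> (\<forall>t. \<forall>x. h k (t,x) \<in> U)} \<subseteq> {k\<in>K. \<not> (\<forall>t\<in>{0..1}. \<forall>x. F (t, sph n k x) \<in> U)}"
        unfolding h_def fst_conv snd_conv by blast
    qed
  qed
qed

lemma homot_refl: "based f \<Longrightarrow> homot f f" by (simp add: homot_def based_def)

lemma homot_sym: "homot f g \<Longrightarrow> homot g f" unfolding homot_def by (rule homotopic_with_symD)

lemma homot_trans: "homot f g \<Longrightarrow> homot g h \<Longrightarrow> homot f h" unfolding homot_def by (rule homotopic_with_trans)

lemma homot_based: "homot f g \<Longrightarrow> based f \<and> based g"
  unfolding homot_def based_def
  using homotopic_with_imp_continuous_maps homotopic_with_imp_property by blast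

lemma homot_cong:
  assumes "based f" "g hw_base = y" "\<And>p. p \<in> earring n K \<Longrightarrow> f p = g p"
  shows "homot f g"
  unfolding homot_def using assms by (intro homotopic_with_equal) (auto simp: based_def)

section \<open>Concatenation and the group laws\<close>

lemma continuous_concat:
  fixes a b :: "real \<times> point \<Rightarrow> 'a"
  assumes a: "continuous_map euclidean T a" "\<And>t x. x \<notin> ocube n \<Longrightarrow> a (t,x) = y"
    and b: "continuous_map euclidean T b" "\<And>t x. x \<notin> ocube n \<Longrightarrow> b (t,x) = y"
  shows "continuous_map euclidean T (\<lambda>z. if snd z 1 \<le> 1/2 then a (fst z, (snd z)(1 := 2 * snd z 1))
           else b (fst z, (snd z)(1 := 2 * snd z 1 - 1)))"
proof -
  have one: "1 \<in> {1..n}" using n by simp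
  have "continuous_map euclidean T (\<lambda>z. if z \<in> {z. snd z 1 \<le> 1/2} then a (fst z, (snd z)(1 := 2 * snd z 1))
           else b (fst z, (snd z)(1 := 2 * snd z 1 - 1)))"
  proof (rule continuous_map_paste[where B = "{z. snd z 1 \<ge> 1/2}"])
    show "continuous_map euclidean T (\<lambda>z. a (fst z, (snd z)(1 := 2 * snd z 1)))"
      "continuous_map euclidean T (\<lambda>z. b (fst z, (snd z)(1 := 2 * snd z 1 - 1)))"
      by (intro continuous_map_compose_on[OF a(1)] continuous_map_compose_on[OF b(1)]
           continuous_on_Pair continuous_on_upd continuous_on_mult continuous_on_diff continuous_on_const
           continuous_on_snd_apply continuous_on_fst continuous_on_snd continuous_on_id)+
    show "closed {z::real \<times> point. snd z 1 \<le> 1/2}" "closed {z::real \<times> point. snd z 1 \<ge> 1/2}"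
      by (intro closed_Collect_le continuous_on_snd_apply continuous_on_const)+
    fix z :: "real \<times> point" assume "z \<in> {z. snd z 1 \<le> 1/2}" "z \<in> {z. snd z 1 \<ge> 1/2}"
    then have z: "snd z 1 = 1/2" by auto
    have "(snd z)(1 := 2 * snd z 1) \<notin> ocube n" "(snd z)(1 := 2 * snd z 1 - 1) \<notin> ocube n"
    proof -
      have "snd z (Suc 0) = 1/2" using z by simp
      then show "(snd z)(1 := 2 * snd z 1) \<notin> ocube n" "(snd z)(1 := 2 * snd z 1 - 1) \<notin> ocube n"
        by (rule_tac [!] outside_ocube[OF one]) simp_all
    qed
    then show "a (fst z, (snd z)(1 := 2 * snd z 1)) = b (fst z, (snd z)(1 := 2 * snd z 1 - 1))"
      using a(2) b(2) by simp
  qed auto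
  then show ?thesis by simp
qed

lemma outside_concat:
  assumes "x \<notin> ocube n" "\<And>x. x \<notin> ocube n \<Longrightarrow> a x = y" "\<And>x. x \<notin> ocube n \<Longrightarrow> b x = y"
  shows "(if x 1 \<le> 1/2 then a (x(1 := 2 * x 1)) else b (x(1 := 2 * x 1 - 1))) = y"
proof -
  obtain c where c: "c \<in> {1..n}" "x c \<le> 0 \<or> 1 \<le> x c" using assms(1) by (force simp: ocube_def)
  have *: "x(1 := s) \<notin> ocube n" if "c = 1 \<Longrightarrow> s \<le> 0 \<or> 1 \<le> s" for s
  proof -
    have "(x(1 := s)) c \<le> 0 \<or> 1 \<le> (x(1 := s)) c" using c that by auto
    then show ?thesis using c(1) by (intro outside_ocube[of c]) auto
  qed
  show ?thesis
  proof (cases "x 1 \<le> 1/2")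
    case True
    have "x(1 := 2 * x 1) \<notin> ocube n" by (rule *) (use True c in auto)
    then show ?thesis using True assms by simp
  next
    case False
    have "x(1 := 2 * x 1 - 1) \<notin> ocube n" by (rule *) (use False c in auto)
    then show ?thesis using False assms by simp
  qed
qed

lemma concat_sph:
  assumes "based f" "based g" "k \<in> K"
  shows "hw_concat n f g (sph n k x) =
    (if x 1 \<le> 1/2 then f (sph n k (x(1 := 2 * x 1))) else g (sph n k (x(1 := 2 * x 1 - 1))))"
  by (rule hw_concat_sph) (use K1[OF assms(3)] n based_base[OF assms(1)] based_base[OF assms(2)] in auto)

lemma based_concat:
  assumes f: "based f" and g: "based g"
  shows "based (hw_concat n f g)"
proof (rule basedI)
  show "hw_concat n f g hw_base = y" using f by (simp add: hw_concat_def based_def)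
  show "continuous_map euclidean T (\<lambda>x. hw_concat n f g (sph n k x))" if k: "k \<in> K" for k
  proof -
    define c where "c = (\<lambda>z::real \<times> point. if snd z 1 \<le> 1/2
        then (\<lambda>z. f (sph n k (snd z))) (fst z, (snd z)(1 := 2 * snd z 1))
        else (\<lambda>z. g (sph n k (snd z))) (fst z, (snd z)(1 := 2 * snd z 1 - 1)))"
    have "continuous_map euclidean T c" unfolding c_def
      by (rule continuous_concat)
         (use based_outside f g in \<open>auto intro!: based_continuous_on[OF _ k] continuous_intros continuous_on_snd_apply\<close>)
    moreover have "continuous_on UNIV (\<lambda>x::point. (0::real,x))" by (intro continuous_intros)
    ultimately have "continuous_map euclidean T (\<lambda>x. c (0,x))" by (rule continuous_map_compose_on)
    then show ?thesis by (simp only: c_def concat_sph[OF f g k] fst_conv snd_conv)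
  qed
  show "finite {k\<in>K. \<not> (\<forall>x. hw_concat n f g (sph n k x) \<in> U)}" if "openin T U" "y \<in> U" for U
  proof (rule finite_subset)
    show "{k\<in>K. \<not> (\<forall>x. hw_concat n f g (sph n k x) \<in> U)} \<subseteq>
      {k\<in>K. \<not> (\<forall>x. f (sph n k x) \<in> U)} \<union> {k\<in>K. \<not> (\<forall>x. g (sph n k x) \<in> U)}"
    proof -
      have "hw_concat n f g (sph n k x) \<in> U" if "k \<in> K" "\<forall>x. f (sph n k x) \<in> U" "\<forall>x. g (sph n k x) \<in> U" for k x
        using that by (simp add: concat_sph[OF f g])
      then show ?thesis by blast
    qed
    show "finite ({k\<in>K. \<not> (\<forall>x. f (sph n k x) \<in> U)} \<union> {k\<in>K. \<not> (\<forall>x. g (sph n k x) \<in> U)})"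
      using based_small[OF f that] based_small[OF g that] by simp
  qed
qed

lemma homot_concat:
  assumes "homot f f'" "homot g g'"
  shows "homot (hw_concat n f g) (hw_concat n f' g')"
proof -
  have b: "based f" "based f'" "based g" "based g'" using homot_based assms by blast+
  obtain h where h: "\<And>k. k \<in> K \<Longrightarrow> continuous_map euclidean T (h k :: real \<times> point \<Rightarrow> 'a)"
    "\<And>k x. h k (0,x) = f (sph n k x)" "\<And>k x. h k (1,x) = f' (sph n k x)"
    "\<And>k t. cube_map n y (\<lambda>x. h k (t,x))"
    "\<And>U. openin T U \<Longrightarrow> y \<in> U \<Longrightarrow> finite {k\<in>K. \<not> (\<forall>t. \<forall>x. h k (t,x) \<in> U)}"
    using homotE[OF assms(1)] by blast
  obtain e where e: "\<And>k. k \<in> K \<Longrightarrow> continuous_map euclidean T (e k :: real \<times> point \<Rightarrow> 'a)"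
    "\<And>k x. e k (0,x) = g (sph n k x)" "\<And>k x. e k (1,x) = g' (sph n k x)"
    "\<And>k t. cube_map n y (\<lambda>x. e k (t,x))"
    "\<And>U. openin T U \<Longrightarrow> y \<in> U \<Longrightarrow> finite {k\<in>K. \<not> (\<forall>t. \<forall>x. e k (t,x) \<in> U)}"
    using homotE[OF assms(2)] by blast
  have out: "h k (t,x) = y" "e k (t,x) = y" if "x \<notin> ocube n" for k t x
    using h(4)[of k t] e(4)[of k t] that by (simp_all add: cube_map_def)
  define H where "H = (\<lambda>k z. if snd z 1 \<le> 1/2 then h k (fst z, (snd z)(1 := 2 * snd z 1))
           else e k (fst z, (snd z)(1 := 2 * snd z 1 - 1)))"
  show ?thesis
  proof (rule homotI[OF based_concat[OF b(1,3)] based_concat[OF b(2,4)]])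
    show "continuous_map euclidean T (H k)" if "k \<in> K" for k
      unfolding H_def by (rule continuous_concat) (use h(1) e(1) that out in auto)
    show "H k (0,x) = hw_concat n f g (sph n k x)" "H k (1,x) = hw_concat n f' g' (sph n k x)" if "k \<in> K" for k x
      using that by (simp_all add: H_def concat_sph b h e)
    show "H k (t,x) = y" if "x \<notin> ocube n" for k t x
      unfolding H_def fst_conv snd_conv by (rule outside_concat[OF that]) (use out in auto)
    show "finite {k\<in>K. \<not> (\<forall>t\<in>{0..1}. \<forall>x. H k (t,x) \<in> U)}" if "openin T U" "y \<in> U" for U
    proof (rule finite_subset)
      show "{k\<in>K. \<not> (\<forall>t\<in>{0..1}. \<forall>x. H k (t,x) \<in> U)} \<subseteq>
        {k\<in>K. \<not> (\<forall>t. \<forall>x. h k (t,x) \<in> U)} \<union> {k\<in>K. \<not> (\<forall>t. \<forall>x. e k (t,x) \<in> U)}"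
        unfolding H_def by auto
      show "finite ({k\<in>K. \<not> (\<forall>t. \<forall>x. h k (t,x) \<in> U)} \<union> {k\<in>K. \<not> (\<forall>t. \<forall>x. e k (t,x) \<in> U)})"
        using h(5)[OF that] e(5)[OF that] by simp
    qed
  qed
qed

text \<open>Reparametrising the first coordinate does not change the homotopy class; all group laws are
  instances.\<close>

lemma homot_reparam:
  assumes f: "based f" and g: "based g" "based g'" and \<phi>: "continuous_on UNIV (\<lambda>z. \<phi> (fst z) (snd z))"
    and ends: "\<And>t s. 0 \<le> t \<Longrightarrow> t \<le> 1 \<Longrightarrow> s \<le> 0 \<or> 1 \<le> s \<Longrightarrow> \<phi> t s \<le> 0 \<or> 1 \<le> \<phi> t (s::real)"
    and g0: "\<And>k x. k \<in> K \<Longrightarrow> 0 < x 1 \<Longrightarrow> x 1 < 1 \<Longrightarrow> g (sph n k x) = f (sph n k (x(1 := \<phi> 0 (x 1))))"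
    and g1: "\<And>k x. k \<in> K \<Longrightarrow> 0 < x 1 \<Longrightarrow> x 1 < 1 \<Longrightarrow> g' (sph n k x) = f (sph n k (x(1 := \<phi> (1::real) (x 1))))"
  shows "homot g g'"
proof (rule homotI[OF g])
  have one: "1 \<in> {1..n}" using n by simp
  define H where "H = (\<lambda>k z. f (sph n k ((snd z)(1 := \<phi> (max 0 (min 1 (fst z))) (snd z 1)))))"
  show "continuous_map euclidean T (H k)" if "k \<in> K" for k
    unfolding H_def
  proof (intro based_continuous_on[OF f that] continuous_on_upd)
    have "continuous_on UNIV (\<lambda>z::real \<times> point. (max 0 (min 1 (fst z)), snd z 1))"
      by (intro continuous_intros continuous_on_snd_apply)
    from continuous_on_compose2[OF \<phi> this]
    show "continuous_on UNIV (\<lambda>z::real \<times> point. \<phi> (max 0 (min 1 (fst z))) (snd z 1))" by simp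
  qed (intro continuous_intros)
  show "H k (0,x) = g (sph n k x)" "H k (1,x) = g' (sph n k x)" if "k \<in> K" "x \<in> ocube n" for k x
    using g0[of k x] g1[of k x] that one by (auto simp: H_def ocube_def)
  show "H k (t,x) = y" if x: "x \<notin> ocube n" for k t x
  proof -
    obtain c where c: "c \<in> {1..n}" "x c \<le> 0 \<or> 1 \<le> x c" using x by (force simp: ocube_def)
    have "x(1 := \<phi> (max 0 (min 1 t)) (x 1)) \<notin> ocube n"
    proof (cases "c = 1")
      case True
      then have "\<phi> (max 0 (min 1 t)) (x 1) \<le> 0 \<or> 1 \<le> \<phi> (max 0 (min 1 t)) (x 1)" using c by (intro ends) auto
      then show ?thesis using one by (intro outside_ocube[of 1]) auto
    next
      case False
      then show ?thesis using c by (intro outside_ocube[of c]) auto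
    qed
    then show ?thesis by (simp add: H_def based_outside[OF f])
  qed
  show "finite {k\<in>K. \<not> (\<forall>t\<in>{0..1}. \<forall>x. H k (t,x) \<in> U)}" if "openin T U" "y \<in> U" for U
    by (rule finite_subset[OF _ based_small[OF f that]]) (auto simp: H_def)
qed

lemma homot_assoc:
  assumes b: "based f" "based g" "based h"
  shows "homot (hw_concat n (hw_concat n f g) h) (hw_concat n f (hw_concat n g h))"
proof -
  \<comment> \<open>The piecewise linear map taking 1/4, 1/2, 1 to 1/2, 3/4, 1. Its slopes 2, 1, 1/2
    decrease, so it is the minimum of its three linear pieces.\<close>
  define \<psi> where "\<psi> = (\<lambda>s::real. min (2 * s) (min (s + 1/4) ((s + 1) / 2)))"
  define \<phi> where "\<phi> = (\<lambda>t s::real. (1 - t) * \<psi> s + t * s)"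
  have fg: "based (hw_concat n f g)" "based (hw_concat n g h)" by (intro based_concat b)+
  show ?thesis
  proof (rule homot_reparam[where \<phi> = \<phi> and f = "hw_concat n f (hw_concat n g h)"])
    show "continuous_on UNIV (\<lambda>z. \<phi> (fst z) (snd z))" unfolding \<phi>_def \<psi>_def by (intro continuous_intros) auto
    show "\<phi> t s \<le> 0 \<or> 1 \<le> \<phi> t s" if t: "0 \<le> t" "t \<le> 1" and s: "s \<le> 0 \<or> 1 \<le> s" for t s
    proof (cases "s \<le> 0")
      case True
      then have "\<psi> s \<le> 0" by (simp add: \<psi>_def)
      then have "(1 - t) * \<psi> s \<le> 0" "t * s \<le> 0" using t True by (simp_all add: mult_nonneg_nonpos)
      then show ?thesis by (simp add: \<phi>_def)
    next
      case False
      then have "1 \<le> s" "1 \<le> \<psi> s" using s by (auto simp: \<psi>_def)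
      then have "(1 - t) * 1 \<le> (1 - t) * \<psi> s" "t * 1 \<le> t * s" using t
        by (intro mult_left_mono; linarith)+
      then show ?thesis by (simp add: \<phi>_def)
    qed
    fix k and x :: "point" assume k: "k \<in> K" and x: "0 < x 1" "x 1 < 1"
    show "hw_concat n f (hw_concat n g h) (sph n k x) = hw_concat n f (hw_concat n g h) (sph n k (x(1 := \<phi> 1 (x 1))))"
      by (simp add: \<phi>_def)
    have p0: "\<phi> 0 (x 1) = \<psi> (x 1)" by (simp add: \<phi>_def)
    consider "x 1 \<le> 1/4" | "1/4 < x 1" "x 1 \<le> 1/2" | "1/2 < x 1" by linarith
    then show "hw_concat n (hw_concat n f g) h (sph n k x) = hw_concat n f (hw_concat n g h) (sph n k (x(1 := \<phi> 0 (x 1))))"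
    proof cases
      case 1
      then have ps: "\<psi> (x 1) = 2 * x 1" by (simp add: \<psi>_def)
      show ?thesis unfolding p0 ps using 1 by (simp add: concat_sph[OF _ _ k] b fg)
    next
      case 2
      then have ps: "\<psi> (x 1) = x 1 + 1/4" using x by (simp add: \<psi>_def)
      show ?thesis unfolding p0 ps using 2 by (simp add: concat_sph[OF _ _ k] b fg algebra_simps)
    next
      case 3
      then have ps: "\<psi> (x 1) = (x 1 + 1) / 2" using x by (simp add: \<psi>_def)
      show ?thesis unfolding p0 ps using 3 by (simp add: concat_sph[OF _ _ k] b fg add_divide_distrib)
    qed
  qed (intro based_concat b)+
qed

text \<open>A reparametrisation may leave the unit interval: \<open>2 * s - 1\<close> is at most 0
  on the first half, where the extension of \<open>f\<close> by the base value reproduces the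
  constant map.\<close>

lemma homot_lunit:
  assumes f: "based f"
  shows "homot (hw_concat n (\<lambda>_. y) f) f"
proof (rule homot_reparam[where \<phi> = "\<lambda>t s. (1 - t) * (2 * s - 1) + t * s" and f = f])
  show "continuous_on UNIV (\<lambda>z::real\<times>real. (1 - fst z) * (2 * snd z - 1) + fst z * snd z)"
    by (intro continuous_intros)
  show "(1 - t) * (2 * s - 1) + t * s \<le> 0 \<or> 1 \<le> (1 - t) * (2 * s - 1) + t * s"
    if t: "0 \<le> t" "t \<le> 1" and s: "s \<le> 0 \<or> 1 \<le> s" for t s :: real
  proof (cases "s \<le> 0")
    case True
    then have "(1 - t) * (2 * s - 1) \<le> 0" "t * s \<le> 0" using t by (simp_all add: mult_nonneg_nonpos)
    then show ?thesis by simp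
  next
    case False
    then have "(1 - t) * 1 \<le> (1 - t) * (2 * s - 1)" "t * 1 \<le> t * s" using t s
      by (intro mult_left_mono; linarith)+
    then show ?thesis by simp
  qed
  show "hw_concat n (\<lambda>_. y) f (sph n k x) = f (sph n k (x(1 := (1 - 0) * (2 * x 1 - 1) + 0 * x 1)))" if "k \<in> K" for k x
  proof (cases "x 1 \<le> 1/2")
    case True
    then have "x(1 := 2 * x 1 - 1) \<notin> ocube n" using n by (intro outside_ocube[of 1]) auto
    then show ?thesis using True based_outside[OF f] concat_sph[OF based_const f that, of x] by simp
  next
    case False
    then show ?thesis using concat_sph[OF based_const f that, of x] by simp
  qed
qed (use f based_concat based_const in auto)

lemma homot_linv:
  assumes f: "based f"
  shows "\<exists>g. based g \<and> homot (hw_concat n g f) (\<lambda>_. y)"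
proof (intro exI conjI)
  define r where "r = (\<lambda>x::point. x(1 := 1 - x 1))"
  have one: "1 \<in> {1..n}" using n by simp
  have r: "r x \<in> ocube n \<longleftrightarrow> x \<in> ocube n" for x
  proof -
    have "x \<in> ocube n" if "r x \<in> ocube n" for x
      unfolding ocube_def
    proof (intro CollectI ballI)
      fix c assume "c \<in> {1..n}"
      then show "0 < x c \<and> x c < 1" using that by (cases "c = 1") (auto simp: ocube_def r_def dest!: bspec[of _ _ c])
    qed
    moreover have "r (r x) = x" for x by (auto simp: r_def)
    ultimately show ?thesis by metis
  qed
  define g where "g = unglue n y (\<lambda>k x. f (sph n k (r x)))"
  have cube: "cube_map n y (\<lambda>x. f (sph n k (r x)))" for k
  proof -
    have "f (sph n k (r x)) = f (sph n k (r z))" if "\<forall>c\<in>{1..n}. x c = z c" for x z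
      using based_cube_map[OF f, of k] that one unfolding cube_map_def
      by (intro depends_onD[of "{1..n}" "\<lambda>x. f (sph n k x)"]) (auto simp: r_def)
    then show ?thesis using r based_outside[OF f] by (auto simp: cube_map_def depends_on_def)
  qed
  have cr: "continuous_on UNIV r" unfolding r_def
    by (intro continuous_on_upd continuous_intros continuous_on_apply)
  show g: "based g" unfolding g_def
  proof (rule based_unglue)
    show "continuous_map euclidean T (\<lambda>x. f (sph n k (r x)))" if "k \<in> K" for k
      by (rule based_continuous_on[OF f that cr])
    show "finite {k\<in>K. \<not> (\<forall>x. f (sph n k (r x)) \<in> U)}" if "openin T U" "y \<in> U" for U
      by (rule finite_subset[OF _ based_small[OF f that]]) auto
  qed (rule cube)
  have gs: "g (sph n k x) = f (sph n k (r x))" if "k \<in> K" for k x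
    unfolding g_def by (rule unglue_sph[where g = "\<lambda>k x. f (sph n k (r x))"]) (use K1[OF that] cube in auto)
  show "homot (hw_concat n g f) (\<lambda>_. y)"
  \<comment> \<open>Running \<open>f\<close> backwards and then forwards is \<open>f\<close> along
    \<open>\<bar>2 * s - 1\<bar>\<close>. Pushing this parameter linearly to 1 ends at the wall,
    where \<open>f\<close> has the value \<open>y\<close>.\<close>
  proof (rule homot_reparam[where \<phi> = "\<lambda>t s. (1 - t) * \<bar>2 * s - 1\<bar> + t" and f = f])
    show "continuous_on UNIV (\<lambda>z::real\<times>real. (1 - fst z) * \<bar>2 * snd z - 1\<bar> + fst z)"
      by (intro continuous_intros)
    show "(1 - t) * \<bar>2 * s - 1\<bar> + t \<le> 0 \<or> 1 \<le> (1 - t) * \<bar>2 * s - 1\<bar> + t"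
      if t: "0 \<le> t" "t \<le> 1" and s: "s \<le> 0 \<or> 1 \<le> s" for t s :: real
    proof -
      have "(1 - t) * 1 \<le> (1 - t) * \<bar>2 * s - 1\<bar>" using t s by (intro mult_left_mono) auto
      then show ?thesis by simp
    qed
    fix k and x :: "point" assume k: "k \<in> K" and x: "0 < x 1" "x 1 < 1"
    show "hw_concat n g f (sph n k x) = f (sph n k (x(1 := (1 - 0) * \<bar>2 * x 1 - 1\<bar> + 0)))"
      unfolding concat_sph[OF g f k] gs[OF k] r_def by (cases "x 1 \<le> 1/2") simp_all
    have "x(1 := 1) \<notin> ocube n" using one by (intro outside_ocube[of 1]) auto
    then show "y = f (sph n k (x(1 := (1 - 1) * \<bar>2 * x 1 - 1\<bar> + 1)))" by (simp add: based_outside[OF f])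
  qed (use f g based_concat based_const in auto)
qed

section \<open>The group of homotopy classes\<close>

definition cls :: "(point \<Rightarrow> 'a) \<Rightarrow> (point \<Rightarrow> 'a) set" where
  "cls f = hw_class D T y f"

abbreviation G :: "(point \<Rightarrow> 'a) set monoid" where "G \<equiv> hw_group D n T y"

lemma cls_eq: "cls f = {g. homot f g}"
  using homot_based by (auto simp: cls_def hw_class_def homot_def[symmetric] based_def)

lemma cls_eq_iff: "based f \<Longrightarrow> based g \<Longrightarrow> cls f = cls g \<longleftrightarrow> homot f g"
  unfolding cls_eq using homot_refl homot_sym homot_trans by blast

lemma carrier_G: "carrier G = cls ` {f. based f}"
  by (auto simp: hw_group_def cls_def based_def)

lemma one_G: "\<one>\<^bsub>G\<^esub> = cls (\<lambda>_. y)" by (simp add: hw_group_def cls_def)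

lemma some_cls:
  assumes "based f"
  shows "homot f (SOME g. g \<in> cls f)"
proof -
  have "f \<in> cls f" using assms by (simp add: cls_eq homot_refl)
  then have "(SOME g. g \<in> cls f) \<in> cls f" by (rule someI[of "\<lambda>g. g \<in> cls f"])
  then show ?thesis by (simp add: cls_eq)
qed

lemma mult_G:
  assumes "based f" "based g"
  shows "cls f \<otimes>\<^bsub>G\<^esub> cls g = cls (hw_concat n f g)"
proof -
  have "cls f \<otimes>\<^bsub>G\<^esub> cls g = cls (hw_concat n (SOME h. h \<in> cls f) (SOME h. h \<in> cls g))"
    by (simp add: hw_group_def cls_def)
  also have "\<dots> = cls (hw_concat n f g)"
  proof -
    have "homot (hw_concat n f g) (hw_concat n (SOME h. h \<in> cls f) (SOME h. h \<in> cls g))"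
      by (intro homot_concat some_cls assms)
    then show ?thesis using cls_eq_iff homot_based by blast
  qed
  finally show ?thesis .
qed

lemma group_G: "group G"
proof (rule groupI)
  fix A B C assume "A \<in> carrier G" "B \<in> carrier G" "C \<in> carrier G"
  then obtain f g h where fgh: "A = cls f" "B = cls g" "C = cls h" "based f" "based g" "based h"
    by (auto simp: carrier_G)
  show "A \<otimes>\<^bsub>G\<^esub> B \<in> carrier G" using fgh based_concat by (auto simp: mult_G carrier_G)
  have "cls (hw_concat n (hw_concat n f g) h) = cls (hw_concat n f (hw_concat n g h))"
    using fgh homot_assoc by (subst cls_eq_iff) (auto intro: based_concat)
  then show "A \<otimes>\<^bsub>G\<^esub> B \<otimes>\<^bsub>G\<^esub> C = A \<otimes>\<^bsub>G\<^esub> (B \<otimes>\<^bsub>G\<^esub> C)"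
    using fgh by (simp add: mult_G based_concat)
next
  show "\<one>\<^bsub>G\<^esub> \<in> carrier G" using based_const by (auto simp: one_G carrier_G)
next
  fix A assume "A \<in> carrier G"
  then obtain f where f: "A = cls f" "based f" by (auto simp: carrier_G)
  show "\<one>\<^bsub>G\<^esub> \<otimes>\<^bsub>G\<^esub> A = A"
    using f homot_lunit based_const by (simp add: one_G mult_G cls_eq_iff based_concat)
  obtain g where g: "based g" "homot (hw_concat n g f) (\<lambda>_. y)" using homot_linv[OF f(2)] by blast
  then have "cls g \<otimes>\<^bsub>G\<^esub> A = \<one>\<^bsub>G\<^esub>"
    using f by (simp add: one_G mult_G cls_eq_iff based_concat based_const)
  then show "\<exists>B\<in>carrier G. B \<otimes>\<^bsub>G\<^esub> A = \<one>\<^bsub>G\<^esub>" using g by (auto simp: carrier_G)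
qed

end

section \<open>The weak join as a subspace of the product\<close>

definition wj_proj :: "(nat \<Rightarrow> 'a) \<Rightarrow> nat \<Rightarrow> (nat \<times> 'a) option \<Rightarrow> 'a" where
  "wj_proj x i z = (case z of None \<Rightarrow> x i | Some (j, a) \<Rightarrow> if j = i then a else x i)"

definition wj_of :: "(nat \<Rightarrow> 'a) \<Rightarrow> (nat \<Rightarrow> 'a) \<Rightarrow> (nat \<times> 'a) option" where
  "wj_of x v = (if v = x then None else (let i = SOME i. v i \<noteq> x i in Some (i, v i)))"

lemma wj_proj_None [simp]: "wj_proj x i None = x i" by (simp add: wj_proj_def)

lemma topspace_weak_join: "topspace (weak_join Xs x) = wj_carrier Xs x"
proof -
  have "wj_inj x i a \<in> wj_carrier Xs x" if "a \<in> topspace (Xs i)" for i a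
    using that by (auto simp: wj_carrier_def wj_inj_def)
  then have "{a \<in> topspace (Xs i). wj_inj x i a \<in> wj_carrier Xs x} = topspace (Xs i)" for i by auto
  moreover have "{i. \<not> wj_inj x i ` topspace (Xs i) \<subseteq> wj_carrier Xs x} = {}"
    using \<open>\<And>i a. a \<in> topspace (Xs i) \<Longrightarrow> wj_inj x i a \<in> wj_carrier Xs x\<close> by blast
  ultimately have "openin (weak_join Xs x) (wj_carrier Xs x)"
    unfolding openin_weak_join wj_open_def by (simp only:) simp
  moreover have "openin (weak_join Xs x) U \<Longrightarrow> U \<subseteq> wj_carrier Xs x" for U
    by (simp add: openin_weak_join wj_open_def)
  ultimately show ?thesis by (simp add: topspace_def subset_antisym Sup_le_iff Sup_upper)
qed

lemma wj_proj_disjoint: "wj_proj x i z \<noteq> x i \<Longrightarrow> wj_proj x j z \<noteq> x j \<Longrightarrow> i = j"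
  by (auto simp: wj_proj_def split: option.splits if_splits)

lemma wj_of_eq:
  assumes "\<And>i j. v i \<noteq> x i \<Longrightarrow> v j \<noteq> x j \<Longrightarrow> i = j" "v i \<noteq> x i"
  shows "wj_of x v = Some (i, v i)"
proof -
  have "(SOME i. v i \<noteq> x i) = i" using assms by (intro some_equality) auto
  then show ?thesis using assms(2) by (auto simp: wj_of_def)
qed

lemma wj_of_base [simp]: "wj_of x x = None" by (simp add: wj_of_def)

lemma wj_proj_of:
  assumes "\<And>i j. v i \<noteq> x i \<Longrightarrow> v j \<noteq> x j \<Longrightarrow> i = j"
  shows "wj_proj x i (wj_of x v) = v i"
proof (cases "v = x")
  case False
  then obtain j where j: "v j \<noteq> x j" by (auto simp: fun_eq_iff)
  have "wj_of x v = Some (j, v j)" using assms j by (rule wj_of_eq)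
  moreover have "v i = x i" if "i \<noteq> j" using assms[of i j] j that by blast
  ultimately show ?thesis by (auto simp: wj_proj_def)
qed simp

lemma wj_of_proj:
  assumes "z \<in> wj_carrier Xs x"
  shows "wj_of x (\<lambda>i. wj_proj x i z) = z"
proof (cases z)
  case None
  then show ?thesis by (simp add: wj_of_def fun_eq_iff)
next
  case (Some b)
  obtain i a where b: "b = (i,a)" by force
  then have "wj_proj x i z = a" "a \<noteq> x i" using assms Some by (auto simp: wj_proj_def wj_carrier_def)
  then show ?thesis using wj_of_eq[of "\<lambda>i. wj_proj x i z" x i] wj_proj_disjoint Some b by force
qed

lemma wj_of_in_carrier:
  assumes "\<And>i. v i \<in> topspace (Xs i)" "\<And>i j. v i \<noteq> x i \<Longrightarrow> v j \<noteq> x j \<Longrightarrow> i = j"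
  shows "wj_of x v \<in> wj_carrier Xs x"
proof (cases "v = x")
  case False
  then obtain j where j: "v j \<noteq> x j" by (auto simp: fun_eq_iff)
  have "wj_of x v = Some (j, v j)" using assms(2) j by (rule wj_of_eq)
  then show ?thesis using assms(1) j by (auto simp: wj_carrier_def)
qed (simp add: wj_carrier_def)

lemma continuous_wj_proj:
  assumes "\<And>i. x i \<in> topspace (Xs i)"
  shows "continuous_map (weak_join Xs x) (Xs i) (wj_proj x i)"
  unfolding continuous_map_def topspace_weak_join
proof (intro conjI allI impI)
  show "wj_proj x i \<in> wj_carrier Xs x \<rightarrow> topspace (Xs i)"
    using assms by (auto simp: wj_proj_def wj_carrier_def)
  fix U assume U: "openin (Xs i) U"
  define V where "V = {z \<in> wj_carrier Xs x. wj_proj x i z \<in> U}"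
  have V: "wj_inj x j a \<in> V \<longleftrightarrow> (if j = i then a \<in> U else x i \<in> U)" if "a \<in> topspace (Xs j)" for j a
    using that by (auto simp: V_def wj_inj_def wj_proj_def wj_carrier_def)
  have "openin (Xs j) {a \<in> topspace (Xs j). wj_inj x j a \<in> V}" for j
  proof (cases "j = i")
    case True
    have "{a \<in> topspace (Xs i). wj_inj x i a \<in> V} = U" using V[of _ i] openin_subset[OF U] by auto
    then show ?thesis using True U by simp
  next
    case False
    have "{a \<in> topspace (Xs j). wj_inj x j a \<in> V} = (if x i \<in> U then topspace (Xs j) else {})"
      using V[of _ j] False by auto
    then show ?thesis by simp
  qed
  moreover have "finite {j. \<not> wj_inj x j ` topspace (Xs j) \<subseteq> V}" if "None \<in> V"
  proof (rule finite_subset)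
    have "x i \<in> U" using that by (simp add: V_def)
    then show "{j. \<not> wj_inj x j ` topspace (Xs j) \<subseteq> V} \<subseteq> {i}" using V by auto
  qed simp
  ultimately show "openin (weak_join Xs x) {z \<in> wj_carrier Xs x. wj_proj x i z \<in> U}"
    unfolding openin_weak_join wj_open_def V_def[symmetric] by (auto simp: V_def)
qed

text \<open>Membership in a neighbourhood of the common point is decided by finitely many
  coordinates. This is the reason why the weak join carries the topology of a subspace of the
  product.\<close>

lemma wj_mem_nbhd:
  assumes W: "openin (weak_join Xs x) W" "None \<in> W" and z: "z \<in> wj_carrier Xs x"
  shows "z \<in> W \<longleftrightarrow> (\<forall>i\<in>{i. \<not> wj_inj x i ` topspace (Xs i) \<subseteq> W}. wj_inj x i (wj_proj x i z) \<in> W)"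
proof (cases z)
  case None
  then show ?thesis using W by (simp add: wj_inj_def)
next
  case (Some b)
  obtain j a where b: "b = (j,a)" by force
  have a: "a \<in> topspace (Xs j)" "a \<noteq> x j" using z Some b by (auto simp: wj_carrier_def)
  have inj: "wj_inj x i (wj_proj x i z) = (if i = j then z else None)" for i
    using a Some b by (simp add: wj_inj_def wj_proj_def)
  show ?thesis
  proof
    assume "z \<in> W" then show "\<forall>i\<in>{i. \<not> wj_inj x i ` topspace (Xs i) \<subseteq> W}. wj_inj x i (wj_proj x i z) \<in> W"
      using inj W(2) by simp
  next
    assume R: "\<forall>i\<in>{i. \<not> wj_inj x i ` topspace (Xs i) \<subseteq> W}. wj_inj x i (wj_proj x i z) \<in> W"
    show "z \<in> W"
    proof (cases "wj_inj x j ` topspace (Xs j) \<subseteq> W")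
      case True
      have "z = wj_inj x j a" using a Some b by (simp add: wj_inj_def)
      then show ?thesis using True a(1) by blast
    next
      case False
      then have "wj_inj x j (wj_proj x j z) \<in> W" using R by blast
      then show ?thesis using inj by simp
    qed
  qed
qed

lemma wj_nbhd_coords:
  assumes W: "openin (weak_join Xs x) W"
  shows "finite {i. \<not> wj_inj x i ` topspace (Xs i) \<subseteq> W} \<or> None \<notin> W"
    "openin (Xs i) {a \<in> topspace (Xs i). wj_inj x i a \<in> W}"
  using W unfolding openin_weak_join wj_open_def by auto

lemma continuous_into_weak_join:
  assumes f: "\<And>p. p \<in> topspace D \<Longrightarrow> f p \<in> wj_carrier Xs x"
    and cont: "\<And>i. continuous_map D (Xs i) (\<lambda>p. wj_proj x i (f p))"
  shows "continuous_map D (weak_join Xs x) f"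
  unfolding continuous_map_def topspace_weak_join
proof (intro conjI allI impI)
  show "f \<in> topspace D \<rightarrow> wj_carrier Xs x" using f by auto
  fix W assume W: "openin (weak_join Xs x) W"
  define J where "J = {i. \<not> wj_inj x i ` topspace (Xs i) \<subseteq> W}"
  define P where "P = (\<lambda>i. {p \<in> topspace D. wj_proj x i (f p) \<in> {a \<in> topspace (Xs i). wj_inj x i a \<in> W}})"
  have P: "openin D (P i)" for i
    unfolding P_def by (rule openin_continuous_map_preimage[OF cont wj_nbhd_coords(2)[OF W]])
  have top: "wj_proj x i (f p) \<in> topspace (Xs i)" if "p \<in> topspace D" for i p
    using continuous_map_funspace[OF cont[of i]] that by auto
  show "openin D {p \<in> topspace D. f p \<in> W}"
  proof (cases "None \<in> W")
    case True
    then have finJ: "finite J" using wj_nbhd_coords(1)[OF W] by (simp add: J_def)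
    have "{p \<in> topspace D. f p \<in> W} = topspace D \<inter> (\<Inter>i\<in>J. P i)"
      using wj_mem_nbhd[OF W True f] top unfolding J_def[symmetric] by (auto simp: P_def)
    moreover have "openin D (topspace D \<inter> (\<Inter>i\<in>J. P i))"
      using finJ P by (cases "J = {}") (auto intro!: openin_Int openin_INT2)
    ultimately show ?thesis by simp
  next
    case False
    \<comment> \<open>Without the common point, \<open>W\<close> is a disjoint union of open parts
      of the single spaces.\<close>
    have "f p \<in> W \<longleftrightarrow> (\<exists>i. p \<in> P i)" if p: "p \<in> topspace D" for p
    proof (cases "f p")
      case None
      then show ?thesis using False by (auto simp: P_def wj_inj_def)
    next
      case (Some b)
      obtain j a where b: "b = (j,a)" by force
      then have fp: "f p = Some (j,a)" "a \<noteq> x j" using f[OF p] Some by (auto simp: wj_carrier_def)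
      have "wj_inj x i (wj_proj x i (f p)) = (if i = j then f p else None)" for i
        using fp by (simp add: wj_inj_def wj_proj_def)
      then show ?thesis using top[OF p] p False by (auto simp: P_def split: if_splits)
    qed
    then have "{p \<in> topspace D. f p \<in> W} = (\<Union>i. P i)" by (auto simp: P_def)
    then show ?thesis using P by auto
  qed
qed

text \<open>A neighbourhood of the common point constrains only finitely many coordinates, so the
  exceptional indices form a finite union of finite sets.\<close>

lemma weak_join_small:
  fixes g :: "'k \<Rightarrow> 'z \<Rightarrow> nat \<Rightarrow> 'a"
  assumes x: "\<And>i. x i \<in> topspace (Xs i)" and top: "\<And>k z i. k \<in> K \<Longrightarrow> z \<in> A \<Longrightarrow> g k z i \<in> topspace (Xs i)"
    and disj: "\<And>k z i j. k \<in> K \<Longrightarrow> z \<in> A \<Longrightarrow> g k z i \<noteq> x i \<Longrightarrow> g k z j \<noteq> x j \<Longrightarrow> i = j"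
    and small: "\<And>i U. openin (Xs i) U \<Longrightarrow> x i \<in> U \<Longrightarrow> finite {k\<in>K. \<not> (\<forall>z\<in>A. g k z i \<in> U)}"
    and W: "openin (weak_join Xs x) W" "None \<in> W"
  shows "finite {k\<in>K. \<not> (\<forall>z\<in>A. wj_of x (g k z) \<in> W)}"
proof -
  define J where "J = {i. \<not> wj_inj x i ` topspace (Xs i) \<subseteq> W}"
  define U where "U = (\<lambda>i. {a \<in> topspace (Xs i). wj_inj x i a \<in> W})"
  have finJ: "finite J" using wj_nbhd_coords(1)[OF W(1)] W(2) by (simp add: J_def)
  have U: "openin (Xs i) (U i)" "x i \<in> U i" for i
    using wj_nbhd_coords(2)[OF W(1)] x W(2) by (auto simp: U_def wj_inj_def)
  have mem: "wj_of x (g k z) \<in> W" if k: "k \<in> K" and z: "z \<in> A" and "\<And>i. i \<in> J \<Longrightarrow> g k z i \<in> U i" for k z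
  proof -
    have "wj_of x (g k z) \<in> wj_carrier Xs x" by (rule wj_of_in_carrier) (use top disj k z in auto)
    from wj_mem_nbhd[OF W this] show ?thesis
      using that(3) wj_proj_of[of "g k z" x, OF disj[OF k z]] by (auto simp: U_def J_def)
  qed
  have "{k\<in>K. \<not> (\<forall>z\<in>A. wj_of x (g k z) \<in> W)} \<subseteq> (\<Union>i\<in>J. {k\<in>K. \<not> (\<forall>z\<in>A. g k z i \<in> U i)})"
  proof
    fix k assume k: "k \<in> {k\<in>K. \<not> (\<forall>z\<in>A. wj_of x (g k z) \<in> W)}"
    then obtain z where z: "z \<in> A" "wj_of x (g k z) \<notin> W" by blast
    then obtain i where "i \<in> J" "g k z i \<notin> U i" using mem[of k z] k by blast
    then show "k \<in> (\<Union>i\<in>J. {k\<in>K. \<not> (\<forall>z\<in>A. g k z i \<in> U i)})" using k z(1) by blast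
  qed
  moreover have "finite (\<Union>i\<in>J. {k\<in>K. \<not> (\<forall>z\<in>A. g k z i \<in> U i)})"
    using finJ small[OF U] by (rule finite_UN_I)
  ultimately show ?thesis by (rule finite_subset)
qed

section \<open>Consequences of the hypotheses on the spaces\<close>

lemma homotopy_group_eq: "homotopy_group n T y = hw_group (top_of_set (earring n {1})) n T y"
  by (simp add: homotopy_group_def base_sphere_eq)

text \<open>For empty \<open>F\<close> the map is constant and a path to \<open>y\<close> is
  required. Otherwise a bijection of \<open>F\<close> with \<open>{1..d}\<close> transports the map
  to the sphere of dimension \<open>d\<close>, whose homotopy group is trivial.\<close>

lemma nullable_of_connected_upto:
  fixes T :: "'a topology"
  assumes conn: "connected_upto m T y" and y: "y \<in> topspace T"
  shows "nullable m T y"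
  unfolding nullable_def
proof (intro allI impI, elim conjE)
  fix F :: "nat set" and g :: "point \<Rightarrow> 'a"
  assume F: "finite F" "card F \<le> m" and g: "continuous_map euclidean T g" "depends_on F g"
    and out: "\<forall>x. (\<exists>c\<in>F. x c \<le> 0 \<or> 1 \<le> x c) \<longrightarrow> g x = y"
  show "\<exists>G. continuous_map euclidean T (G :: real \<times> point \<Rightarrow> 'a) \<and> (\<forall>x. G (0,x) = g x) \<and>
         (\<forall>x. G (1,x) = y) \<and> (\<forall>t. depends_on F (\<lambda>x. G (t,x))) \<and>
         (\<forall>t x. (\<exists>c\<in>F. x c \<le> 0 \<or> 1 \<le> x c) \<longrightarrow> G (t,x) = y)"
  proof (cases "F = {}")
    case True
    have "g (\<lambda>_. 0) \<in> topspace T" using continuous_map_funspace[OF g(1)] by auto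
    then obtain \<gamma> where \<gamma>: "pathin T \<gamma>" "\<gamma> 0 = g (\<lambda>_. 0)" "\<gamma> 1 = y"
      using conn y unfolding connected_upto_def path_connected_space_def by metis
    have "continuous_map euclidean (top_of_set {0..1}) (\<lambda>z::real \<times> point. max 0 (min 1 (fst z)))"
      by (auto simp: continuous_map_in_subtopology intro!: continuous_intros)
    from continuous_map_compose[OF this \<gamma>(1)[unfolded pathin_def]]
    have c: "continuous_map euclidean T (\<lambda>z::real \<times> point. \<gamma> (max 0 (min 1 (fst z))))" by (simp add: o_def)
    have "g (\<lambda>_. 0) = g x" for x by (rule depends_onD[OF g(2)]) (simp add: True)
    then show ?thesis
      by (intro exI[of _ "\<lambda>z. \<gamma> (max 0 (min 1 (fst z)))"]) (use c \<gamma> True in \<open>auto simp: depends_on_def\<close>)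
  next
    case False
    define d where "d = card F"
    have d: "1 \<le> d" "d \<le> m" using F False by (auto simp: d_def Suc_le_eq card_gt_0_iff)
    interpret S: earring_maps "{1}" d T y using d y by unfold_locales auto
    obtain \<pi> where \<pi>: "bij_betw \<pi> {1..d} F" using ex_bij_betw_nat_finite_1[OF F(1)] by (auto simp: d_def)
    define \<sigma> where "\<sigma> = inv_into {1..d} \<pi>"
    have \<sigma>: "\<sigma> c \<in> {1..d}" "\<pi> (\<sigma> c) = c" if "c \<in> F" for c
      using \<pi> that unfolding \<sigma>_def by (metis bij_betw_imp_surj_on inv_into_into, metis bij_betw_inv_into_right)
    have \<pi>F: "\<pi> j \<in> F" "\<sigma> (\<pi> j) = j" if "j \<in> {1..d}" for j
      using \<pi> that unfolding \<sigma>_def by (metis bij_betwE, metis bij_betw_inv_into_left)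
    define e where "e = (\<lambda>x c. if c \<in> F then x (\<sigma> c) else (0::real))"
    have "cube_map d y (\<lambda>x. g (e x))"
      unfolding cube_map_def
    proof (intro conjI allI impI)
      show "depends_on {1..d} (\<lambda>x. g (e x))" unfolding depends_on_def
        using \<sigma> by (auto simp: e_def intro!: depends_onD[OF g(2)])
      fix x assume "x \<notin> ocube d"
      then obtain c where c: "c \<in> {1..d}" "x c \<le> 0 \<or> 1 \<le> x c" by (force simp: ocube_def)
      then have "e x (\<pi> c) \<le> 0 \<or> 1 \<le> e x (\<pi> c)" using \<pi>F[OF c(1)] by (simp add: e_def)
      then show "g (e x) = y" using out \<pi>F(1)[OF c(1)] by blast
    qed
    note cube = this
    have ce: "continuous_on UNIV e" unfolding e_def
      by (intro continuous_on_coordinatewise_then_product, rename_tac c, case_tac "c \<in> F") simp_all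
    define f where "f = unglue d y (\<lambda>_ x. g (e x))"
    have f: "S.based f" unfolding f_def
    proof (rule S.based_unglue)
      show "continuous_map euclidean T (\<lambda>x. g (e x))" by (rule continuous_map_compose_on[OF g(1) ce])
    qed (use cube in auto)
    have fs: "f (sph d 1 x) = g (e x)" for x
      unfolding f_def by (rule unglue_sph[where g = "\<lambda>_ x. g (e x)"]) (use cube in auto)
    obtain a where "carrier S.G = {a}"
      using conn d unfolding connected_upto_def homotopy_group_eq by blast
    then have "S.cls f = S.cls (\<lambda>_. y)" using f S.based_const unfolding S.carrier_G by blast
    then have "S.homot f (\<lambda>_. y)" using S.cls_eq_iff[OF f S.based_const] by simp
    then obtain h where h: "\<And>k. k \<in> {1} \<Longrightarrow> continuous_map euclidean T (h k :: real \<times> point \<Rightarrow> 'a)"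
      "\<And>k x. h k (0,x) = f (sph d k x)" "\<And>k x. h k (1,x) = y" "\<And>k t. cube_map d y (\<lambda>x. h k (t,x))"
      by (rule S.homotE) blast
    define r where "r = (\<lambda>x j. x (\<pi> j) :: real)"
    show ?thesis
    proof (intro exI conjI allI impI)
      show "continuous_map euclidean T (\<lambda>z. h 1 (fst z, r (snd z)))"
        unfolding r_def
        by (intro continuous_map_compose_on[OF h(1)] continuous_on_Pair continuous_on_coordinatewise_then_product
            continuous_on_snd_apply continuous_on_fst continuous_on_id) simp
      show "h 1 (fst (0, x), r (snd (0, x))) = g x" for x
      proof -
        have "g (e (r x)) = g x" by (rule depends_onD[OF g(2)]) (simp add: e_def r_def \<sigma>)
        then show ?thesis by (simp add: h fs[simplified])
      qed
      show "h 1 (fst (1, x), r (snd (1, x))) = y" for x by (simp add: h)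
      show "depends_on F (\<lambda>x. h 1 (fst (t, x), r (snd (t, x))))" for t
        unfolding depends_on_def
      proof (intro allI impI)
        fix x z :: "point" assume xz: "\<forall>c\<in>F. x c = z c"
        have "depends_on {1..d} (\<lambda>x. h 1 (t,x))" using h(4)[of 1 t] by (simp add: cube_map_def)
        then have "h 1 (t, r x) = h 1 (t, r z)"
          by (rule depends_onD) (use xz \<pi>F(1) in \<open>simp add: r_def\<close>)
        then show "h 1 (fst (t, x), r (snd (t, x))) = h 1 (fst (t, z), r (snd (t, z)))" by simp
      qed
      show "h 1 (fst (t, x), r (snd (t, x))) = y" if bad: "\<exists>c\<in>F. x c \<le> 0 \<or> 1 \<le> x c" for t x
      proof -
        obtain c where c: "c \<in> F" "x c \<le> 0 \<or> 1 \<le> x c" using bad by blast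
        show ?thesis unfolding fst_conv snd_conv
          by (rule cube_map_outside[OF h(4) \<sigma>(1)[OF c(1)]]) (use c \<sigma>(2)[OF c(1)] in \<open>simp add: r_def\<close>)
      qed
    qed
  qed
qed

lemma lsc_contraction:
  assumes "locally_strongly_contractible_at T y" "openin T U" "y \<in> U"
  obtains V C where "openin T V" "y \<in> V" "V \<subseteq> U"
    "continuous_map (prod_topology (top_of_set {0..1::real}) (subtopology T V)) (subtopology T U) C"
    "\<And>v. C (0, v) = v" "\<And>v. C (1, v) = y" "\<And>t. t \<in> {0..1} \<Longrightarrow> C (t, y) = y"
proof -
  obtain V where V: "openin T V" "y \<in> V" "V \<subseteq> U"
    "homotopic_with (\<lambda>h. h y = y) (subtopology T V) (subtopology T U) (\<lambda>v. v) (\<lambda>_. y)"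
    using assms unfolding locally_strongly_contractible_at_def by blast
  then show ?thesis using that unfolding homotopic_with_def by blast
qed

text \<open>Complete regularity separates \<open>y\<close> from the complement of a contractible
  neighbourhood by a function \<open>u\<close>. The contraction is damped by \<open>l\<close>, which
  is 1 for \<open>u\<close> at most 1/3 and 0 for \<open>u\<close> at least 2/3, and hence extends
  by the identity.\<close>

lemma well_pointed_of_tikhonov:
  fixes T :: "'a topology"
  assumes "tikhonov_space T" "locally_strongly_contractible_at T y" "y \<in> topspace T"
  shows "well_pointed T y"
proof -
  obtain V C where V: "openin T V" "y \<in> V"
    and C: "continuous_map (prod_topology (top_of_set {0..1::real}) (subtopology T V)) (subtopology T (topspace T)) C"
    "\<And>v. C (0, v) = v" "\<And>v. C (1, v) = y" "\<And>t. t \<in> {0..1} \<Longrightarrow> C (t, y) = y"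
    using lsc_contraction[OF assms(2) openin_topspace assms(3)] by metis
  have "closedin T (topspace T - V)" using V(1) by blast
  then obtain u where u: "continuous_map T (top_of_set {0..1::real}) u" "u y = 0" "u ` (topspace T - V) \<subseteq> {1}"
    using assms(1,3) V(2) unfolding tikhonov_space_def completely_regular_space_def by (metis DiffD2 DiffI)
  have cu: "continuous_map T euclideanreal u" using u(1) by (simp add: continuous_map_in_subtopology)
  define l where "l = (\<lambda>z. max 0 (min 1 (2 - 3 * u z)))"
  define h where "h = (\<lambda>p::real\<times>'a. if u (snd p) \<le> 2/3 then C (max 0 (min 1 (fst p)) * l (snd p), snd p) else snd p)"
  let ?P = "prod_topology euclideanreal T"
  have "continuous_map ?P T h"
    unfolding h_def
  proof (rule continuous_map_cases_le)
    show "continuous_map ?P euclideanreal (\<lambda>p. u (snd p))"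
      using continuous_map_compose[OF continuous_map_snd cu] by (simp add: o_def)
    let ?S = "subtopology ?P {p \<in> topspace ?P. u (snd p) \<le> 2/3}"
    have cl: "continuous_map ?S euclideanreal (\<lambda>p. max 0 (min 1 (fst p)) * l (snd p))"
    proof -
      have "continuous_map T euclideanreal l" unfolding l_def by (intro continuous_intros cu)
      then have "continuous_map ?P euclideanreal (\<lambda>p. l (snd p))"
        using continuous_map_compose[OF continuous_map_snd] by (force simp: o_def)
      moreover have "continuous_map ?P euclideanreal fst" by (rule continuous_map_fst)
      ultimately show ?thesis by (intro continuous_map_from_subtopology continuous_intros) auto
    qed
    have "0 \<le> max 0 (min 1 a) * l b" "max 0 (min 1 a) * l b \<le> 1" for a :: real and b
      by (auto simp: l_def intro: mult_le_one)
    then have 1: "continuous_map ?S (top_of_set {0..1}) (\<lambda>p. max 0 (min 1 (fst p)) * l (snd p))"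
      using cl by (auto simp: continuous_map_in_subtopology)
    have "continuous_map ?S T snd" by (intro continuous_map_from_subtopology continuous_map_snd)
    moreover have "snd p \<in> V" if "p \<in> topspace ?S" for p
      using that u(3) by (cases p) force
    ultimately have 2: "continuous_map ?S (subtopology T V) snd"
      by (auto simp: continuous_map_in_subtopology)
    have "continuous_map ?S (prod_topology (top_of_set {0..1}) (subtopology T V))
       (\<lambda>p. (max 0 (min 1 (fst p)) * l (snd p), snd p))"
      by (intro continuous_map_pairedI 1 2)
    from continuous_map_compose[OF this C(1)]
    show "continuous_map ?S T (\<lambda>p. C (max 0 (min 1 (fst p)) * l (snd p), snd p))"
      by (simp add: o_def)
    show "continuous_map (subtopology ?P {p \<in> topspace ?P. 2/3 \<le> u (snd p)}) T snd"
      by (intro continuous_map_from_subtopology continuous_map_snd)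
  qed (auto simp: l_def C)
  moreover have "h (0,z) = z" for z by (simp add: h_def C)
  moreover have "h (t,y) = y" for t
  proof -
    have "l y = 1" by (simp add: l_def u)
    then show ?thesis by (auto simp: h_def u(2) intro!: C(4))
  qed
  moreover have "h (1,z) = y" if "u z \<le> 1/3" for z
  proof -
    have "l z = 1" using that by (simp add: l_def)
    then show ?thesis using that by (simp add: h_def C)
  qed
  ultimately show ?thesis unfolding well_pointed_def using cu u(2) by blast
qed

lemma decreasing_nbhd_base:
  assumes "first_countable_at T y" "y \<in> topspace T"
  obtains B :: "nat \<Rightarrow> 'a set" where "\<And>m. openin T (B m)" "\<And>m. y \<in> B m" "\<And>m l. m \<le> l \<Longrightarrow> B l \<subseteq> B m"
    "\<And>U. openin T U \<Longrightarrow> y \<in> U \<Longrightarrow> \<exists>m. B m \<subseteq> U"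
proof -
  obtain \<B> where "countable \<B> \<and> (\<forall>V\<in>\<B>. openin T V \<and> y \<in> V) \<and>
      (\<forall>U. openin T U \<and> y \<in> U \<longrightarrow> (\<exists>V\<in>\<B>. V \<subseteq> U))"
    using assms(1) unfolding first_countable_at_def by (elim exE)
  then have \<B>: "countable \<B>" "\<And>V. V \<in> \<B> \<Longrightarrow> openin T V \<and> y \<in> V"
    "\<And>U. openin T U \<Longrightarrow> y \<in> U \<Longrightarrow> \<exists>V\<in>\<B>. V \<subseteq> U"
    by simp_all
  have ne: "\<B> \<noteq> {}" using \<B>(3)[OF openin_topspace assms(2)] by blast
  define b where "b = from_nat_into \<B>"
  have b: "b m \<in> \<B>" for m unfolding b_def by (rule from_nat_into[OF ne])
  show ?thesis
  proof (rule that[of "\<lambda>m. \<Inter>j\<in>{..m}. b j"])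
    show "openin T (\<Inter>j\<in>{..m}. b j)" for m using b \<B>(2) by (intro openin_INT2) auto
    show "y \<in> (\<Inter>j\<in>{..m}. b j)" for m using b \<B>(2) by auto
    show "(\<Inter>j\<in>{..l}. b j) \<subseteq> (\<Inter>j\<in>{..m}. b j)" if "m \<le> l" for m l :: nat using that by force
    show "\<exists>m. (\<Inter>j\<in>{..m}. b j) \<subseteq> U" if U: "openin T U" "y \<in> U" for U
    proof -
      obtain V where V: "V \<in> \<B>" "V \<subseteq> U" using \<B>(3)[OF U] by blast
      then obtain m where "b m = V" using from_nat_into_surj[OF \<B>(1)] unfolding b_def by metis
      then show ?thesis using V(2) by (intro exI[of _ m]) auto
    qed
  qed
qed

text \<open>First countability lets the contraction used on the \<open>k\<close>-th map take place in smaller and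
  smaller neighbourhoods as \<open>k\<close> grows.\<close>

lemma trivialize_almost_all:
  fixes \<psi> :: "nat \<Rightarrow> point \<Rightarrow> 'a" and K :: "nat set"
  assumes lsc: "locally_strongly_contractible_at T y" and fc: "first_countable_at T y" and y: "y \<in> topspace T"
    and cont: "\<And>k. k \<in> K \<Longrightarrow> continuous_map euclidean T (\<psi> k)" and cube: "\<And>k. k \<in> K \<Longrightarrow> cube_map n y (\<psi> k)"
    and small: "\<And>U. openin T U \<Longrightarrow> y \<in> U \<Longrightarrow> finite {k\<in>K. \<not> (\<forall>x. \<psi> k x \<in> U)}"
  obtains H where "\<And>k. k \<in> K \<Longrightarrow> continuous_map euclidean T (H k :: real \<times> point \<Rightarrow> 'a)"
    "\<And>k x. k \<in> K \<Longrightarrow> H k (0,x) = \<psi> k x" "\<And>k t. k \<in> K \<Longrightarrow> cube_map n y (\<lambda>x. H k (t,x))"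
    "\<And>k t x. k \<in> K \<Longrightarrow> \<psi> k x = y \<Longrightarrow> H k (t,x) = y"
    "\<And>U. openin T U \<Longrightarrow> y \<in> U \<Longrightarrow> finite {k\<in>K. \<not> (\<forall>t x. H k (t,x) \<in> U)}"
    "finite {k\<in>K. \<not> (\<forall>x. H k (1,x) = y)}"
proof -
  obtain B :: "nat \<Rightarrow> 'a set" where B: "\<And>m. openin T (B m)" "\<And>m. y \<in> B m" "\<And>m l. m \<le> l \<Longrightarrow> B l \<subseteq> B m"
    "\<And>U. openin T U \<Longrightarrow> y \<in> U \<Longrightarrow> \<exists>m. B m \<subseteq> U"
    using decreasing_nbhd_base[OF fc y] by blast
  have "\<exists>V C. openin T V \<and> y \<in> V \<and> V \<subseteq> B m \<and>
    continuous_map (prod_topology (top_of_set {0..1::real}) (subtopology T V)) (subtopology T (B m)) C \<and>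
    (\<forall>v. C (0, v) = v) \<and> (\<forall>v. C (1, v) = y) \<and> (\<forall>t\<in>{0..1}. C (t, y) = y)" for m
    by (rule lsc_contraction[OF lsc B(1,2), of m]) blast
  then obtain V C where V: "\<And>m. openin T (V m)" "\<And>m. y \<in> V m" and
    C: "\<And>m. continuous_map (prod_topology (top_of_set {0..1::real}) (subtopology T (V m))) (subtopology T (B m)) (C m)"
    "\<And>m v. C m (0, v) = v" "\<And>m v. C m (1, v) = y" "\<And>m t. t \<in> {0..1} \<Longrightarrow> C m (t, y) = y"
    by metis
  \<comment> \<open>The bound \<open>m \<le> k\<close> guarantees a greatest good level. For fixed
    \<open>m\<close> almost all \<open>k\<close> are good, so the levels \<open>M k\<close> still
    tend to infinity along \<open>K\<close>.\<close>
  define good where "good = (\<lambda>k m. m \<le> k \<and> (\<forall>x. \<psi> k x \<in> V m))"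
  define M where "M = (\<lambda>k. GREATEST m. good k m)"
  define H where "H = (\<lambda>k z. if \<exists>m. good k m then C (M k) (max 0 (min 1 (fst z)), \<psi> k (snd z)) else \<psi> k (snd z))"
  have M: "good k (M k)" "m \<le> M k" if "good k m" for k m
  proof -
    have bound: "\<forall>j. good k j \<longrightarrow> j \<le> k" by (simp add: good_def)
    then show "good k (M k)" unfolding M_def using that GreatestI_nat by blast
    show "m \<le> M k" unfolding M_def using that bound by (blast intro: Greatest_le_nat)
  qed
  have HB: "H k z \<in> B (M k)" and HC: "H k z = C (M k) (max 0 (min 1 (fst z)), \<psi> k (snd z))"
    if "good k m" for k m z
  proof -
    show eq: "H k z = C (M k) (max 0 (min 1 (fst z)), \<psi> k (snd z))" using that by (auto simp: H_def)
    have V: "\<psi> k (snd z) \<in> V (M k)" using M(1)[OF that] by (simp add: good_def)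
    then have "\<psi> k (snd z) \<in> topspace T" using V(1) openin_subset \<open>\<And>m. openin T (V m)\<close> by blast
    then show "H k z \<in> B (M k)"
      using continuous_map_funspace[OF C(1)[of "M k"]] V unfolding eq by force
  qed
  show ?thesis
  proof (rule that[of H])
    fix k assume k: "k \<in> K"
    show "continuous_map euclidean T (H k)"
    proof (cases "\<exists>m. good k m")
      case True
      have "continuous_map euclidean (subtopology T (V (M k))) (\<lambda>z::real \<times> point. \<psi> k (snd z))"
        using continuous_map_compose_on[OF cont[OF k], of snd] M(1) True
        by (auto simp: continuous_map_in_subtopology good_def continuous_intros)
      moreover have "continuous_map euclidean (top_of_set {0..1}) (\<lambda>z::real \<times> point. max 0 (min 1 (fst z)))"
        by (auto simp: continuous_map_in_subtopology intro!: continuous_intros)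
      ultimately have "continuous_map euclidean (prod_topology (top_of_set {0..1}) (subtopology T (V (M k))))
          (\<lambda>z::real \<times> point. (max 0 (min 1 (fst z)), \<psi> k (snd z)))"
        by (intro continuous_map_pairedI)
      from continuous_map_compose[OF this C(1)] show ?thesis
        using True unfolding H_def by (simp add: o_def continuous_map_in_subtopology)
    next
      case False
      then have "H k z = \<psi> k (snd z)" for z unfolding H_def by (rule if_not_P)
      then have "H k = (\<lambda>z. \<psi> k (snd z))" by (intro ext)
      then show ?thesis using continuous_map_compose_on[OF cont[OF k], of snd]
        by (simp add: continuous_intros)
    qed
    show "H k (0,x) = \<psi> k x" for x by (simp add: H_def C)
    show base: "H k (t,x) = y" if "\<psi> k x = y" for t x
      unfolding H_def fst_conv snd_conv that using C(4)[of "max 0 (min 1 t)" "M k"] by simp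
    show "cube_map n y (\<lambda>x. H k (t,x))" for t
    proof -
      have "depends_on {1..n} (\<psi> k)" using cube[OF k] by (simp add: cube_map_def)
      then have "depends_on {1..n} (\<lambda>x. H k (t,x))" unfolding depends_on_def H_def by (metis fst_conv snd_conv)
      then show ?thesis using cube[OF k] base by (simp add: cube_map_def)
    qed
  next
    fix U assume "openin T U" "y \<in> U"
    then obtain m where m: "B m \<subseteq> U" using B(4) by blast
    have "{k\<in>K. \<not> (\<forall>t x. H k (t,x) \<in> U)} \<subseteq> {..<m} \<union> {k\<in>K. \<not> (\<forall>x. \<psi> k x \<in> V m)}"
    proof
      fix k assume k: "k \<in> {k\<in>K. \<not> (\<forall>t x. H k (t,x) \<in> U)}"
      show "k \<in> {..<m} \<union> {k\<in>K. \<not> (\<forall>x. \<psi> k x \<in> V m)}"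
      proof (rule ccontr)
        assume "\<not> ?thesis"
        then have g: "good k m" using k by (auto simp: good_def)
        have "H k z \<in> U" for z using HB[OF g, of z] B(3)[OF M(2)[OF g]] m by blast
        then show False using k by blast
      qed
    qed
    then show "finite {k\<in>K. \<not> (\<forall>t x. H k (t,x) \<in> U)}"
      by (rule finite_subset) (use small[OF V] in simp)
  next
    have "{k\<in>K. \<not> (\<forall>x. H k (1,x) = y)} \<subseteq> {k\<in>K. \<not> (\<forall>x. \<psi> k x \<in> V 0)}"
    proof
      fix k assume k: "k \<in> {k\<in>K. \<not> (\<forall>x. H k (1,x) = y)}"
      have "\<not> good k 0"
      proof
        assume "good k 0"
        from HC[OF this] have "H k (1,x) = y" for x by (simp add: C)
        then show False using k by blast
      qed
      then show "k \<in> {k\<in>K. \<not> (\<forall>x. \<psi> k x \<in> V 0)}" using k by (simp add: good_def)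
    qed
    then show "finite {k\<in>K. \<not> (\<forall>x. H k (1,x) = y)}" by (rule finite_subset) (rule small[OF V])
  qed
qed

section \<open>The isomorphism\<close>

locale join_family =
  fixes n :: nat and Xs :: "nat \<Rightarrow> 'a topology" and x :: "nat \<Rightarrow> 'a"
  assumes n2: "n \<ge> 2"
    and x: "\<And>i. x i \<in> topspace (Xs i)"
    and conn: "\<And>i. connected_upto (n - 1) (Xs i) (x i)"
    and tik: "\<And>i. tikhonov_space (Xs i)"
    and lsc: "\<And>i. locally_strongly_contractible_at (Xs i) (x i)"
    and fc: "\<And>i. first_countable_at (Xs i) (x i)"

sublocale join_family \<subseteq> H: earring_maps "{1..}" n "weak_join Xs x" None
  using n2 by unfold_locales (auto simp: topspace_weak_join wj_carrier_def)

sublocale join_family \<subseteq> S: earring_maps "{1}" n "Xs i" "x i" for i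
  using n2 x by unfold_locales auto

context join_family
begin

text \<open>Spheres are numbered from 1 and the factors of the weak product from 0, hence
  \<open>Suc k\<close>.\<close>

definition component :: "(point \<Rightarrow> (nat \<times> 'a) option) \<Rightarrow> nat \<Rightarrow> nat \<Rightarrow> point \<Rightarrow> 'a" where
  "component f i k = unglue n (x i) (\<lambda>_ p. wj_proj x i (f (sph n (Suc k) p)))"

lemma continuous_map_proj:
  "continuous_map D (weak_join Xs x) g \<Longrightarrow> continuous_map D (Xs i) (\<lambda>z. wj_proj x i (g z))"
  using continuous_map_compose[OF _ continuous_wj_proj[where x = x and Xs = Xs, OF x]] by (simp add: o_def)

lemma cube_map_proj: "cube_map n None g \<Longrightarrow> cube_map n (x i) (\<lambda>p. wj_proj x i (g p))"
  unfolding cube_map_def depends_on_def by (metis wj_proj_None)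

lemma small_proj:
  fixes g :: "'k \<Rightarrow> 'z \<Rightarrow> (nat \<times> 'a) option"
  assumes g: "\<And>k z. k \<in> K \<Longrightarrow> g k z \<in> wj_carrier Xs x"
    and small: "\<And>W. openin (weak_join Xs x) W \<Longrightarrow> None \<in> W \<Longrightarrow> finite {k\<in>K. \<not> (\<forall>z. g k z \<in> W)}"
    and U: "openin (Xs i) U" "x i \<in> U"
  shows "finite {k\<in>K. \<not> (\<forall>z. wj_proj x i (g k z) \<in> U)}"
proof (rule finite_subset[OF _ small])
  let ?W = "{z \<in> topspace (weak_join Xs x). wj_proj x i z \<in> U}"
  show "openin (weak_join Xs x) ?W"
    by (rule openin_continuous_map_preimage[OF continuous_wj_proj[where x = x and Xs = Xs, OF x] U(1)])
  show "None \<in> ?W" using U(2) by (simp add: topspace_weak_join wj_carrier_def)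
  show "{k\<in>K. \<not> (\<forall>z. wj_proj x i (g k z) \<in> U)} \<subseteq> {k\<in>K. \<not> (\<forall>z. g k z \<in> ?W)}" by auto
qed

lemma in_carrier:
  "continuous_map euclidean (weak_join Xs x) g \<Longrightarrow> g z \<in> wj_carrier Xs x"
  using continuous_map_funspace[of euclidean "weak_join Xs x" g] by (auto simp: topspace_weak_join)

lemma component_sph:
  assumes "H.based f" shows "component f i k (sph n 1 p) = wj_proj x i (f (sph n (Suc k) p))"
  unfolding component_def
  by (rule unglue_sph[where g = "\<lambda>_ p. wj_proj x i (f (sph n (Suc k) p))"])
     (auto intro: cube_map_proj H.based_cube_map[OF assms])

lemma based_component:
  assumes f: "H.based f" shows "S.based i (component f i k)"
  unfolding component_def
proof (rule S.based_unglue)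
  show "continuous_map euclidean (Xs i) (\<lambda>p. wj_proj x i (f (sph n (Suc k) p)))"
    by (intro continuous_map_proj H.based_continuous[OF f]) simp
  show "cube_map n (x i) (\<lambda>p. wj_proj x i (f (sph n (Suc k) p)))"
    by (intro cube_map_proj H.based_cube_map[OF f])
qed auto

lemma homot_component:
  assumes "H.homot f g" shows "S.homot i (component f i k) (component g i k)"
proof -
  have b: "H.based f" "H.based g" using H.homot_based[OF assms] by auto
  obtain h where h: "\<And>k. k \<in> {1..} \<Longrightarrow> continuous_map euclidean (weak_join Xs x) (h k :: real \<times> point \<Rightarrow> _)"
    "\<And>k p. h k (0,p) = f (sph n k p)" "\<And>k p. h k (1,p) = g (sph n k p)"
    "\<And>k t. cube_map n None (\<lambda>p. h k (t,p))"
    by (rule H.homotE[OF assms]) blast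
  show ?thesis
  proof (rule S.homotI[OF based_component[OF b(1)] based_component[OF b(2)], where h = "\<lambda>_ z. wj_proj x i (h (Suc k) z)"])
    show "continuous_map euclidean (Xs i) (\<lambda>z. wj_proj x i (h (Suc k) z))"
      by (intro continuous_map_proj h) simp
    show "wj_proj x i (h (Suc k) (0,p)) = component f i k (sph n l p)" "wj_proj x i (h (Suc k) (1,p)) = component g i k (sph n l p)"
      if "l \<in> {1}" for l p using that component_sph[OF b(1)] component_sph[OF b(2)] by (simp_all add: h)
    show "wj_proj x i (h (Suc k) (t,p)) = x i" if "p \<notin> ocube n" for t p
      using h(4)[of "Suc k" t] that by (simp add: cube_map_def)
  qed auto
qed

lemma homot_of_eq_on_sph:
  assumes "S.based i f" "S.based i g" "\<And>p. f (sph n 1 p) = g (sph n 1 p)"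
  shows "S.homot i f g"
proof (rule S.homot_cong)
  fix p assume "p \<in> earring n {1}"
  then show "f p = g p"
    by (rule S.sph_cases) (use assms(3) S.based_base[OF assms(1)] S.based_base[OF assms(2)] in auto)
qed (use assms S.based_base in auto)

lemma component_concat:
  assumes f: "H.based f" and g: "H.based g"
  shows "S.homot i (component (hw_concat n f g) i k) (hw_concat n (component f i k) (component g i k))"
proof (rule homot_of_eq_on_sph)
  show "S.based i (component (hw_concat n f g) i k)" by (intro based_component H.based_concat f g)
  show "S.based i (hw_concat n (component f i k) (component g i k))" by (intro S.based_concat based_component f g)
  fix p
  have "hw_concat n f g (sph n (Suc k) p) = (if p 1 \<le> 1/2 then f (sph n (Suc k) (p(1 := 2 * p 1)))
      else g (sph n (Suc k) (p(1 := 2 * p 1 - 1))))"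
    by (rule H.concat_sph[OF f g]) simp
  moreover have "hw_concat n (component f i k) (component g i k) (sph n 1 p) = (if p 1 \<le> 1/2
      then component f i k (sph n 1 (p(1 := 2 * p 1))) else component g i k (sph n 1 (p(1 := 2 * p 1 - 1))))"
    by (rule S.concat_sph[OF based_component[OF f] based_component[OF g]]) simp
  ultimately show "component (hw_concat n f g) i k (sph n 1 p) = hw_concat n (component f i k) (component g i k) (sph n 1 p)"
    using component_sph[OF H.based_concat[OF f g]] component_sph[OF f] component_sph[OF g] by simp
qed

text \<open>Triviality at time 1 for almost all \<open>k\<close> shows that the image lies in the
  weak product, and it prepares the injectivity argument; the support condition keeps different
  coordinates disjoint.\<close>

lemma shrink_components:
  assumes f: "H.based f"
  obtains R where "\<And>k. k \<in> {1..} \<Longrightarrow> continuous_map euclidean (Xs i) (R k :: real \<times> point \<Rightarrow> 'a)"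
    "\<And>k p. k \<in> {1..} \<Longrightarrow> R k (0,p) = wj_proj x i (f (sph n k p))"
    "\<And>k t. k \<in> {1..} \<Longrightarrow> cube_map n (x i) (\<lambda>p. R k (t,p))"
    "\<And>k t p. k \<in> {1..} \<Longrightarrow> wj_proj x i (f (sph n k p)) = x i \<Longrightarrow> R k (t,p) = x i"
    "\<And>U. openin (Xs i) U \<Longrightarrow> x i \<in> U \<Longrightarrow> finite {k\<in>{1..}. \<not> (\<forall>t p. R k (t,p) \<in> U)}"
    "finite {k\<in>{1..}. \<not> (\<forall>p. R k (1,p) = x i)}"
proof (rule trivialize_almost_all[OF lsc fc x, of "{1..}" i "\<lambda>k p. wj_proj x i (f (sph n k p))" n])
  show "continuous_map euclidean (Xs i) (\<lambda>p. wj_proj x i (f (sph n k p)))" if "k \<in> {1..}" for k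
    by (intro continuous_map_proj H.based_continuous[OF f that])
  show "cube_map n (x i) (\<lambda>p. wj_proj x i (f (sph n k p)))" for k
    by (intro cube_map_proj H.based_cube_map[OF f])
  show "finite {k\<in>{1..}. \<not> (\<forall>p. wj_proj x i (f (sph n k p)) \<in> U)}" if "openin (Xs i) U" "x i \<in> U" for U
    by (rule small_proj[where g = "\<lambda>k p. f (sph n k p)", OF in_carrier[OF H.based_continuous[OF f]] H.based_small[OF f] that])
qed (use that in blast)

lemma finite_nontrivial_component:
  assumes f: "H.based f"
  shows "finite {k. S.cls i (component f i k) \<noteq> S.cls i (\<lambda>_. x i)}"
proof -
  obtain R where R: "\<And>k. k \<in> {1..} \<Longrightarrow> continuous_map euclidean (Xs i) (R k :: real \<times> point \<Rightarrow> 'a)"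
    "\<And>k p. k \<in> {1..} \<Longrightarrow> R k (0,p) = wj_proj x i (f (sph n k p))"
    "\<And>k t. k \<in> {1..} \<Longrightarrow> cube_map n (x i) (\<lambda>p. R k (t,p))"
    "finite {k\<in>{1..}. \<not> (\<forall>p. R k (1,p) = x i)}"
    by (rule shrink_components[OF f, of i]) blast
  have hom: "S.homot i (component f i k) (\<lambda>_. x i)" if "\<forall>p. R (Suc k) (1,p) = x i" for k
  proof (rule S.homotI[OF based_component[OF f] S.based_const, where h = "\<lambda>_. R (Suc k)"])
    show "R (Suc k) (0,p) = component f i k (sph n l p)" if "l \<in> {1}" for l p
      using that component_sph[OF f] R(2) by simp
    show "R (Suc k) (t,p) = x i" if "p \<notin> ocube n" for t p using R(3)[of "Suc k" t] that by (simp add: cube_map_def)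
  qed (use R(1) that in auto)
  have "{k. S.cls i (component f i k) \<noteq> S.cls i (\<lambda>_. x i)} \<subseteq> (\<lambda>k. k - 1) ` {k\<in>{1..}. \<not> (\<forall>p. R k (1,p) = x i)}"
  proof
    fix k assume "k \<in> {k. S.cls i (component f i k) \<noteq> S.cls i (\<lambda>_. x i)}"
    then have "\<not> S.homot i (component f i k) (\<lambda>_. x i)" using S.cls_eq_iff[OF based_component[OF f] S.based_const] by simp
    then have "Suc k \<in> {k\<in>{1..}. \<not> (\<forall>p. R k (1,p) = x i)}" using hom by auto
    then show "k \<in> (\<lambda>k. k - 1) ` {k\<in>{1..}. \<not> (\<forall>p. R k (1,p) = x i)}" by (rule rev_image_eqI) simp
  qed
  then show ?thesis using R(4) by (rule finite_surj[rotated])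
qed

lemma continuous_wj_of:
  fixes g :: "'z::topological_space \<Rightarrow> nat \<Rightarrow> 'a"
  assumes cont: "\<And>i. continuous_map euclidean (Xs i) (\<lambda>z. g z i)"
    and disj: "\<And>z i j. g z i \<noteq> x i \<Longrightarrow> g z j \<noteq> x j \<Longrightarrow> i = j"
  shows "continuous_map euclidean (weak_join Xs x) (\<lambda>z. wj_of x (g z))"
proof (rule continuous_into_weak_join)
  have top: "g z i \<in> topspace (Xs i)" for z i using continuous_map_funspace[OF cont[of i]] by auto
  show "wj_of x (g z) \<in> wj_carrier Xs x" for z by (rule wj_of_in_carrier) (use top disj in auto)
  show "continuous_map euclidean (Xs i) (\<lambda>z. wj_proj x i (wj_of x (g z)))" for i
  proof -
    have "wj_proj x i (wj_of x (g z)) = g z i" for z by (rule wj_proj_of) (use disj in blast)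
    then show ?thesis using cont[of i] by simp
  qed
qed

text \<open>The nullhomotopies on single spheres come without any bound on their size. So
  \<open>f\<close> is first moved to \<open>f1\<close>, each of whose coordinates is constant on
  almost all spheres; \<open>Z k\<close> keeps these coordinates constant afterwards, which makes
  the combined homotopy continuous at the base point.\<close>

lemma nullhomotopic_of_components:
  assumes f: "H.based f" and null: "\<And>i k. S.homot i (component f i k) (\<lambda>_. x i)"
  shows "H.homot f (\<lambda>_. None)"
proof -
  define Q where "Q = (\<lambda>i R. (\<forall>k\<in>{1..}. continuous_map euclidean (Xs i) (R k :: real \<times> point \<Rightarrow> 'a)) \<and>
    (\<forall>k\<in>{1..}. \<forall>p. R k (0,p) = wj_proj x i (f (sph n k p))) \<and>
    (\<forall>k\<in>{1..}. \<forall>t. cube_map n (x i) (\<lambda>p. R k (t,p))) \<and>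
    (\<forall>k\<in>{1..}. \<forall>t p. wj_proj x i (f (sph n k p)) = x i \<longrightarrow> R k (t,p) = x i) \<and>
    (\<forall>U. openin (Xs i) U \<longrightarrow> x i \<in> U \<longrightarrow> finite {k\<in>{1..}. \<not> (\<forall>t p. R k (t,p) \<in> U)}) \<and>
    finite {k\<in>{1..}. \<not> (\<forall>p. R k (1,p) = x i)})"
  have "\<exists>R. Q i R" for i
    unfolding Q_def by (rule shrink_components[OF f, of i]) blast
  then obtain R where "\<And>i. Q i (R i)" by metis
  then have R: "\<And>i k. k \<ge> 1 \<Longrightarrow> continuous_map euclidean (Xs i) (R i k :: real \<times> point \<Rightarrow> 'a)"
    "\<And>i k p. k \<ge> 1 \<Longrightarrow> R i k (0,p) = wj_proj x i (f (sph n k p))"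
    "\<And>i k t. k \<ge> 1 \<Longrightarrow> cube_map n (x i) (\<lambda>p. R i k (t,p))"
    "\<And>i k t p. k \<ge> 1 \<Longrightarrow> wj_proj x i (f (sph n k p)) = x i \<Longrightarrow> R i k (t,p) = x i"
    "\<And>i U. openin (Xs i) U \<Longrightarrow> x i \<in> U \<Longrightarrow> finite {k\<in>{1..}. \<not> (\<forall>t p. R i k (t,p) \<in> U)}"
    "\<And>i. finite {k\<in>{1..}. \<not> (\<forall>p. R i k (1,p) = x i)}"
    unfolding Q_def by simp_all
  have Rdisj: "i = j" if "k \<ge> 1" "R i k (t,p) \<noteq> x i" "R j k (t,p) \<noteq> x j" for i j k t p
    using R(4)[OF that(1), of i p t] R(4)[OF that(1), of j p t] that wj_proj_disjoint by metis
  have Rtop: "R i k z \<in> topspace (Xs i)" if "k \<ge> 1" for i k z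
    using continuous_map_funspace[OF R(1)[OF that]] by auto
  define h where "h = (\<lambda>k z. wj_of x (\<lambda>i. R i k z))"
  have conth: "continuous_map euclidean (weak_join Xs x) (h k)" if "k \<ge> 1" for k
    unfolding h_def
    by (rule continuous_wj_of) (use R(1)[OF that] Rdisj[OF that] in auto)
  have cubeh: "cube_map n None (\<lambda>p. h k (t,p))" if "k \<ge> 1" for k t
    unfolding cube_map_def
  proof (intro conjI allI impI)
    show "depends_on {1..n} (\<lambda>p. h k (t,p))" unfolding depends_on_def h_def
    proof (intro allI impI arg_cong[where f = "wj_of x"] ext)
      fix p q :: "point" and i assume pq: "\<forall>c\<in>{1..n}. p c = q c"
      have "depends_on {1..n} (\<lambda>p. R i k (t,p))" using R(3)[OF that] by (simp add: cube_map_def)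
      then show "R i k (t,p) = R i k (t,q)" by (rule depends_onD) (use pq in auto)
    qed
    fix p assume "p \<notin> ocube n"
    then have "(\<lambda>i. R i k (t,p)) = x" using R(3)[OF that] by (auto simp: cube_map_def fun_eq_iff)
    then show "h k (t,p) = None" by (simp add: h_def)
  qed
  have hsmall: "finite {k\<in>{1..}. \<not> (\<forall>z\<in>UNIV. h k z \<in> W)}"
    if W: "openin (weak_join Xs x) W" "None \<in> W" for W
    unfolding h_def
  proof (rule weak_join_small[OF x _ _ _ W])
    show "R i k z \<in> topspace (Xs i)" if "k \<in> {1..}" for i k z using Rtop that by simp
    show "i = j" if "k \<in> {1..}" "R i k z \<noteq> x i" "R j k z \<noteq> x j" for i j k z
      using Rdisj[of k i "fst z" "snd z" j] that by simp
    show "finite {k\<in>{1..}. \<not> (\<forall>z\<in>UNIV. R i k z \<in> U)}" if "openin (Xs i) U" "x i \<in> U" for i U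
      using R(5)[OF that] by simp
  qed
  define f1 where "f1 = unglue n None (\<lambda>k p. h k (1,p))"
  have f1: "H.based f1" unfolding f1_def
  proof (rule H.based_unglue)
    show "continuous_map euclidean (weak_join Xs x) (\<lambda>p. h k (1,p))" if "k \<in> {1..}" for k
      using continuous_map_compose_on[OF conth, of k "\<lambda>p. (1,p)"] that by (simp add: continuous_intros)
    show "finite {k\<in>{1..}. \<not> (\<forall>p. h k (1,p) \<in> W)}" if "openin (weak_join Xs x) W" "None \<in> W" for W
      by (rule finite_subset[OF _ hsmall[OF that]]) auto
  qed (use cubeh in auto)
  have f1s: "f1 (sph n k p) = h k (1,p)" if "k \<ge> 1" for k p
    unfolding f1_def by (rule unglue_sph[where g = "\<lambda>k p. h k (1,p)"]) (use that cubeh in auto)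
  have 1: "H.homot f f1"
  proof (rule H.homotI[OF f f1, where h = h])
    show "h k (0,p) = f (sph n k p)" if "k \<in> {1..}" for k p
      using that wj_of_proj[OF in_carrier[OF H.based_continuous[OF f that]], of p] by (simp add: h_def R(2))
    show "finite {k\<in>{1..}. \<not> (\<forall>t\<in>{0..1}. \<forall>p. h k (t,p) \<in> W)}" if "openin (weak_join Xs x) W" "None \<in> W" for W
      by (rule finite_subset[OF _ hsmall[OF that]]) auto
    show "h k (t,p) = None" if "k \<in> {1..}" "p \<notin> ocube n" for k t p
      using cubeh[of k t] that by (simp add: cube_map_def)
  qed (use conth f1s in auto)
  define Z where "Z = (\<lambda>k. {i. \<forall>p. R i k (1,p) = x i})"
  have hom: "homotopic_with (join_map n x (Z k)) euclidean (product_topology Xs UNIV) (\<lambda>p i. R i k (1,p)) (\<lambda>_. x)"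
    if k: "k \<ge> 1" for k
    unfolding Z_def
  proof (rule nullhomotopic_join[OF n2 x nullable_of_connected_upto[OF conn x] well_pointed_of_tikhonov[OF tik lsc x]])
    fix i
    show "continuous_map euclidean (Xs i) (\<lambda>p. R i k (1,p))"
      using continuous_map_compose_on[OF R(1)[OF k], of "\<lambda>p. (1,p)"] by (simp add: continuous_intros)
    show "cube_map n (x i) (\<lambda>p. R i k (1,p))" by (rule R(3)[OF k])
    have a: "homotopic_with (cube_map n (x i)) euclidean (Xs i) (\<lambda>p. wj_proj x i (f (sph n k p))) (\<lambda>p. R i k (1,p))"
      by (rule homotopic_withI[OF R(1)[OF k]]) (use R(2)[OF k] R(3)[OF k] in auto)
    obtain e where e: "\<And>l. l \<in> {1} \<Longrightarrow> continuous_map euclidean (Xs i) (e l :: real \<times> point \<Rightarrow> 'a)"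
      "\<And>l p. e l (0,p) = component f i (k - 1) (sph n l p)" "\<And>l p. e l (1,p) = x i"
      "\<And>l t. cube_map n (x i) (\<lambda>p. e l (t,p))"
      by (rule S.homotE[OF null[of i "k - 1"]]) blast
    \<comment> \<open>Component \<open>k - 1\<close> lives on the sphere with index
      \<open>k\<close>, because \<open>k\<close> is at least 1 here.\<close>
    have e0: "e 1 (0,p) = wj_proj x i (f (sph n k p))" for p
      using k component_sph[OF f] by (simp add: e(2) del: One_nat_def)
    have "homotopic_with (cube_map n (x i)) euclidean (Xs i) (\<lambda>p. wj_proj x i (f (sph n k p))) (\<lambda>_. x i)"
      by (rule homotopic_withI[of _ "e 1"]) (use e e0 in auto)
    then show "homotopic_with (cube_map n (x i)) euclidean (Xs i) (\<lambda>p. R i k (1,p)) (\<lambda>_. x i)"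
      using a by (meson homotopic_with_symD homotopic_with_trans)
  qed (use Rdisj[OF k] in blast)
  define Q' where "Q' = (\<lambda>k J. continuous_map euclidean (product_topology Xs UNIV) (J :: real \<times> point \<Rightarrow> nat \<Rightarrow> 'a) \<and>
      (\<forall>p. J (0,p) = (\<lambda>i. R i k (1,p))) \<and> (\<forall>p. J (1,p) = x) \<and> (\<forall>t. join_map n x (Z k) (\<lambda>p. J (t,p))))"
  have "\<exists>J. Q' k J" if "k \<ge> 1" for k
    unfolding Q'_def by (rule homotopic_with_extend[OF hom[OF that]]) blast
  then obtain J where "\<And>k. k \<ge> 1 \<Longrightarrow> Q' k (J k)" by metis
  then have J: "\<And>k. k \<ge> 1 \<Longrightarrow> continuous_map euclidean (product_topology Xs UNIV) (J k :: real \<times> point \<Rightarrow> nat \<Rightarrow> 'a)"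
     "\<And>k p. k \<ge> 1 \<Longrightarrow> J k (0,p) = (\<lambda>i. R i k (1,p))" "\<And>k p. k \<ge> 1 \<Longrightarrow> J k (1,p) = x"
     "\<And>k t. k \<ge> 1 \<Longrightarrow> join_map n x (Z k) (\<lambda>p. J k (t,p))"
    unfolding Q'_def by simp_all
  have Jc: "continuous_map euclidean (Xs i) (\<lambda>z. J k z i)" if "k \<ge> 1" for i k
    using J(1)[OF that] unfolding continuous_map_componentwise_UNIV by blast
  have Jtop: "J k z i \<in> topspace (Xs i)" if "k \<ge> 1" for i k z
    using continuous_map_funspace[OF Jc[OF that]] by auto
  have Jdisj: "i = j" if "k \<ge> 1" "J k z i \<noteq> x i" "J k z j \<noteq> x j" for i j k z
  proof (cases z)
    case (Pair t p)
    then show ?thesis using J(4)[OF that(1), of t] that(2,3) unfolding join_map_def by blast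
  qed
  have 2: "H.homot f1 (\<lambda>_. None)"
  proof (rule H.homotI[OF f1 H.based_const, where h = "\<lambda>k z. wj_of x (J k z)"])
    show "continuous_map euclidean (weak_join Xs x) (\<lambda>z. wj_of x (J k z))" if "k \<in> {1..}" for k
      by (rule continuous_wj_of) (use Jc Jdisj that in auto)
    show "wj_of x (J k (0,p)) = f1 (sph n k p)" if "k \<in> {1..}" for k p
      using that f1s J(2) by (simp add: h_def)
    show "wj_of x (J k (1,p)) = None" if "k \<in> {1..}" for k p using that J(3) by simp
    show "wj_of x (J k (t,p)) = None" if "k \<in> {1..}" "p \<notin> ocube n" for k t p
    proof -
      have "J k (t,p) = x" using J(4)[of k t] that by (simp add: join_map_def)
      then show ?thesis by simp
    qed
    fix W assume W: "openin (weak_join Xs x) W" "None \<in> W"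
    have "finite {k\<in>{1..}. \<not> (\<forall>z\<in>UNIV. wj_of x (J k z) \<in> W)}"
    proof (rule weak_join_small[OF x _ _ _ W])
      show "J k z i \<in> topspace (Xs i)" if "k \<in> {1..}" for i k z using Jtop that by simp
      show "i = j" if "k \<in> {1..}" "J k z i \<noteq> x i" "J k z j \<noteq> x j" for i j k z using Jdisj that by simp
      show "finite {k\<in>{1..}. \<not> (\<forall>z\<in>UNIV. J k z i \<in> U)}" if U: "openin (Xs i) U" "x i \<in> U" for i U
      proof (rule finite_subset[OF _ R(6)[of i]])
        have "J k (t,p) i = x i" if "k \<ge> 1" "\<forall>p. R i k (1,p) = x i" for k t p
          using J(4)[OF that(1), of t] that(2) by (simp add: join_map_def Z_def)
        then have "J k z i = x i" if "k \<ge> 1" "\<forall>p. R i k (1,p) = x i" for k z using that by (cases z) blast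
        then show "{k\<in>{1..}. \<not> (\<forall>z\<in>UNIV. J k z i \<in> U)} \<subseteq> {k\<in>{1..}. \<not> (\<forall>p. R i k (1,p) = x i)}"
          using U(2) by fastforce
      qed
    qed
    then show "finite {k\<in>{1..}. \<not> (\<forall>t\<in>{0..1}. \<forall>p. wj_of x (J k (t,p)) \<in> W)}"
      by (rule finite_subset[rotated]) auto
  qed
  show ?thesis by (rule H.homot_trans[OF 1 2])
qed

text \<open>The maps \<open>\<beta> i k\<close> are placed side by side, the \<open>i\<close>-th one into the slab
  \<open>1 - 2\<^sup>-\<^sup>i < t\<^sub>1 < 1 - 2\<^sup>-\<^sup>i\<^sup>-\<^sup>1\<close>, which \<open>slab i\<close> stretches onto \<open>(0,1)\<close>.\<close>

definition slab :: "nat \<Rightarrow> real \<Rightarrow> real" where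
  "slab i s = 2 ^ Suc i * (s - 1) + 2"

lemma slab_nonpos: "s \<le> 0 \<Longrightarrow> slab i s \<le> 0"
proof -
  assume "s \<le> 0"
  then have "2 ^ Suc i * (s - 1) \<le> 2 ^ Suc i * (-1)" by (intro mult_left_mono) auto
  moreover have "(2::real) \<le> 2 ^ Suc i" using one_le_power[of "2::real" i] by simp
  ultimately show ?thesis unfolding slab_def by linarith
qed

lemma slab_ge1: "1 \<le> s \<Longrightarrow> 1 \<le> slab i s" by (simp add: slab_def)

lemma slab_disjoint:
  assumes "0 < slab i s" "slab i s < 1" "0 < slab j s" "slab j s < 1"
  shows "i = j"
proof -
  have "\<not> i < j" if "slab i s < 1" "0 < slab j s" for i j
  proof
    assume "i < j"
    then have "Suc i \<le> j" by simp
    have "2 ^ Suc i * (s - 1) < -1" using that(1) by (simp add: slab_def)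
    then have neg: "s - 1 < 0" by (smt (verit) mult_nonneg_nonneg zero_le_power)
    have "2 ^ j * (s - 1) \<le> 2 ^ Suc i * (s - 1)"
      using neg \<open>Suc i \<le> j\<close> by (intro mult_right_mono_neg power_increasing) auto
    then have "slab j s < 0" using \<open>2 ^ Suc i * (s - 1) < -1\<close> by (simp add: slab_def)
    then show False using that(2) by simp
  qed
  then show ?thesis using assms by (meson nat_neq_iff)
qed

text \<open>Infinitely many slabs accumulate at the wall where the first coordinate is 1. This does
  no harm: continuity into the weak join is tested one coordinate at a time, and each coordinate
  uses a single slab. Across the spheres, \<open>fin\<close> gives smallness.\<close>

lemma realize_components:
  assumes b: "\<And>i k. S.based i (\<beta> i k)" and fin: "\<And>i. finite {k. \<beta> i k \<noteq> (\<lambda>_. x i)}"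
  obtains f where "H.based f" "\<And>i k. S.homot i (component f i k) (\<beta> i k)"
proof -
  have one: "1 \<in> {1..n}" using n2 by simp
  define g where "g = (\<lambda>k p i. \<beta> i (k - 1) (sph n 1 (p(1 := slab i (p 1)))))"
  have out: "\<beta> i k (sph n 1 p) = x i" if "p \<notin> ocube n" for i k p using S.based_outside[OF b that] .
  have gin: "0 < slab i (p 1) \<and> slab i (p 1) < 1" if "g k p i \<noteq> x i" for k p i
  proof (rule ccontr)
    assume "\<not> ?thesis"
    then have "p(1 := slab i (p 1)) \<notin> ocube n" by (intro outside_ocube[OF one]) auto
    then show False using that out by (simp add: g_def)
  qed
  have gdisj: "i = j" if "g k p i \<noteq> x i" "g k p j \<noteq> x j" for k p i j
    using gin[OF that(1)] gin[OF that(2)] slab_disjoint by blast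
  have gout: "g k p i = x i" if p: "p \<notin> ocube n" for k p i
  proof -
    obtain c where c: "c \<in> {1..n}" "p c \<le> 0 \<or> 1 \<le> p c" using p by (force simp: ocube_def)
    have "(p(1 := slab i (p 1))) c \<le> 0 \<or> 1 \<le> (p(1 := slab i (p 1))) c"
      using c slab_nonpos slab_ge1 by (cases "c = 1") auto
    then show ?thesis unfolding g_def by (intro out outside_ocube[OF c(1)])
  qed
  have cont: "continuous_map euclidean (Xs i) (\<lambda>p. g k p i)" for k i
    unfolding g_def slab_def
    by (intro S.based_continuous_on[OF b] continuous_on_upd continuous_intros continuous_on_apply) simp
  have gtop: "g k p i \<in> topspace (Xs i)" for k p i using continuous_map_funspace[OF cont] by auto
  define f where "f = unglue n None (\<lambda>k p. wj_of x (g k p))"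
  have cube: "cube_map n None (\<lambda>p. wj_of x (g k p))" for k
    unfolding cube_map_def
  proof (intro conjI allI impI)
    show "depends_on {1..n} (\<lambda>p. wj_of x (g k p))" unfolding depends_on_def
    proof (intro allI impI arg_cong[where f = "wj_of x"] ext)
      fix p q :: "point" and i assume pq: "\<forall>c\<in>{1..n}. p c = q c"
      have "depends_on {1..n} (\<lambda>p. \<beta> i (k - 1) (sph n 1 p))"
        using S.based_cube_map[OF b] unfolding cube_map_def by blast
      then show "g k p i = g k q i" unfolding g_def by (rule depends_onD) (use pq one in auto)
    qed
    fix p assume "p \<notin> ocube n"
    then have "g k p = x" using gout by (intro ext)
    then show "wj_of x (g k p) = None" by simp
  qed
  have f: "H.based f" unfolding f_def
  proof (rule H.based_unglue)
    show "continuous_map euclidean (weak_join Xs x) (\<lambda>p. wj_of x (g k p))" for k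
      by (rule continuous_wj_of) (use cont gdisj in auto)
    fix W assume W: "openin (weak_join Xs x) W" "None \<in> W"
    have "finite {k\<in>{1..}. \<not> (\<forall>p\<in>UNIV. wj_of x (g k p) \<in> W)}"
    proof (rule weak_join_small[OF x gtop gdisj _ W])
      fix i U assume U: "x i \<in> U"
      have "{k\<in>{1..}. \<not> (\<forall>p\<in>UNIV. g k p i \<in> U)} \<subseteq> Suc ` {k. \<beta> i k \<noteq> (\<lambda>_. x i)}"
      proof
        fix k assume k: "k \<in> {k\<in>{1..}. \<not> (\<forall>p\<in>UNIV. g k p i \<in> U)}"
        then have "\<beta> i (k - 1) \<noteq> (\<lambda>_. x i)" using U by (auto simp: g_def)
        moreover have "k = Suc (k - 1)" using k by simp
        ultimately show "k \<in> Suc ` {k. \<beta> i k \<noteq> (\<lambda>_. x i)}" by blast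
      qed
      then show "finite {k\<in>{1..}. \<not> (\<forall>p\<in>UNIV. g k p i \<in> U)}"
        using fin[of i] by (meson finite_imageI finite_subset)
    qed
    then show "finite {k\<in>{1..}. \<not> (\<forall>p. wj_of x (g k p) \<in> W)}" by simp
  qed (rule cube)
  have fs: "f (sph n k p) = wj_of x (g k p)" if "k \<ge> 1" for k p
    unfolding f_def by (rule unglue_sph[where g = "\<lambda>k p. wj_of x (g k p)"]) (use that cube in auto)
  have "S.homot i (component f i k) (\<beta> i k)" for i k
  \<comment> \<open>The slab coordinate is stretched linearly back to the identity; beyond the slab
    its values lie outside the open unit interval.\<close>
  proof (rule S.homot_reparam[OF b[of i k] based_component[OF f] b[of i k], where \<phi> = "\<lambda>t s. (1 - t) * slab i s + t * s"])
    show "continuous_on UNIV (\<lambda>z::real\<times>real. (1 - fst z) * slab i (snd z) + fst z * snd z)"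
      unfolding slab_def by (intro continuous_intros)
    show "(1 - t) * slab i s + t * s \<le> 0 \<or> 1 \<le> (1 - t) * slab i s + t * s"
      if t: "0 \<le> t" "t \<le> 1" and s: "s \<le> 0 \<or> 1 \<le> s" for t s :: real
    proof (cases "s \<le> 0")
      case True
      then have "(1 - t) * slab i s \<le> 0" "t * s \<le> 0"
        using t slab_nonpos[OF True] by (simp_all add: mult_nonneg_nonpos)
      then show ?thesis by simp
    next
      case False
      then have "1 \<le> s" using s by simp
      then have "(1 - t) * 1 \<le> (1 - t) * slab i s" "t * 1 \<le> t * s" using t slab_ge1[of s i]
        by (intro mult_left_mono; linarith)+
      then show ?thesis by simp
    qed
    show "component f i k (sph n l p) = \<beta> i k (sph n l (p(1 := (1 - 0) * slab i (p 1) + 0 * p 1)))" if "l \<in> {1}" for l p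
    proof -
      have l: "l = 1" using that by simp
      have "component f i k (sph n 1 p) = g (Suc k) p i"
        using component_sph[OF f] wj_proj_of[of "g (Suc k) p" x i, OF gdisj] fs by simp
      then show ?thesis by (simp add: l g_def)
    qed
  qed simp
  then show ?thesis using that f by blast
qed

section \<open>The homomorphism and its bijectivity\<close>

definition Theta where
  "Theta A = (\<lambda>i\<in>UNIV. \<lambda>k\<in>UNIV. S.cls i (component (SOME f. f \<in> A) i k))"

lemma Theta_cls:
  assumes f: "H.based f"
  shows "Theta (H.cls f) = (\<lambda>i k. S.cls i (component f i k))"
proof -
  have "S.cls i (component (SOME g. g \<in> H.cls f) i k) = S.cls i (component f i k)" for i k
    using homot_component[OF H.some_cls[OF f], of i k] S.cls_eq_iff S.homot_based by metis
  then show ?thesis by (auto simp: Theta_def fun_eq_iff simp del: One_nat_def)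
qed

lemma Theta_iso:
  "Theta \<in> iso (hawaiian_group n (weak_join Xs x) None)
     (product_group UNIV (\<lambda>i. sum_group UNIV (\<lambda>k::nat. homotopy_group n (Xs i) (x i))))"
proof -
  note One_nat_def [simp del]
  define P where "P = product_group UNIV (\<lambda>i. sum_group UNIV (\<lambda>k::nat. S.G i))"
  have carS: "carrier (sum_group UNIV (\<lambda>k::nat. S.G i)) =
      {s. (\<forall>k. s k \<in> carrier (S.G i)) \<and> finite {k. s k \<noteq> \<one>\<^bsub>S.G i\<^esub>}}" for i
    unfolding carrier_sum_group[OF S.group_G] by (simp add: PiE_iff del: One_nat_def)
  have carP: "carrier P = {s. \<forall>i. (\<forall>k. s i k \<in> carrier (S.G i)) \<and> finite {k. s i k \<noteq> \<one>\<^bsub>S.G i\<^esub>}}"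
    unfolding P_def carrier_product_group carS by (auto simp: PiE_iff simp del: One_nat_def)
  have multP: "s \<otimes>\<^bsub>P\<^esub> t = (\<lambda>i k. s i k \<otimes>\<^bsub>S.G i\<^esub> t i k)" for s t
    by (auto simp: P_def fun_eq_iff simp del: One_nat_def)
  have oneP: "\<one>\<^bsub>P\<^esub> = (\<lambda>i k. \<one>\<^bsub>S.G i\<^esub>)" 
    by (auto simp: P_def fun_eq_iff simp del: One_nat_def)
  have groupP: "group P" unfolding P_def by (intro product_group sum_group S.group_G)
  have "Theta \<in> hom H.G P"
  proof (rule homI)
    fix A assume "A \<in> carrier H.G"
    then obtain f where f: "H.based f" "A = H.cls f" unfolding H.carrier_G by blast
    show "Theta A \<in> carrier P"
      unfolding carP f(2) Theta_cls[OF f(1)] S.carrier_G S.one_G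
      using finite_nontrivial_component[OF f(1)] based_component[OF f(1)] by blast
    fix B assume "B \<in> carrier H.G"
    then obtain g where g: "H.based g" "B = H.cls g" unfolding H.carrier_G by blast
    have "S.cls i (component (hw_concat n f g) i k) = S.cls i (component f i k) \<otimes>\<^bsub>S.G i\<^esub> S.cls i (component g i k)" for i k
    proof -
      have "S.cls i (component (hw_concat n f g) i k) = S.cls i (hw_concat n (component f i k) (component g i k))"
        using component_concat[OF f(1) g(1)] S.cls_eq_iff S.homot_based by metis
      then show ?thesis using S.mult_G[OF based_component[OF f(1)] based_component[OF g(1)]] by simp
    qed
    then show "Theta (A \<otimes>\<^bsub>H.G\<^esub> B) = Theta A \<otimes>\<^bsub>P\<^esub> Theta B"
      using f g by (simp add: H.mult_G Theta_cls H.based_concat multP)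
  qed
  then interpret group_hom H.G P Theta
    by (intro group_hom.intro group_hom_axioms.intro H.group_G groupP)
  have "Theta \<in> iso H.G P"
    unfolding iso_iff
  proof (intro conjI subsetI ballI impI)
    fix s assume s: "s \<in> carrier P"
    \<comment> \<open>Trivial classes are represented by the constant map itself, since
      \<open>realize_components\<close> asks for finitely many nonconstant maps and not merely for
      finitely many nontrivial classes.\<close>
    have "\<exists>\<beta>. S.based i \<beta> \<and> S.cls i \<beta> = s i k \<and> (s i k = \<one>\<^bsub>S.G i\<^esub> \<longrightarrow> \<beta> = (\<lambda>_. x i))" for i k
    proof (cases "s i k = \<one>\<^bsub>S.G i\<^esub>")
      case True
      then show ?thesis using S.based_const by (auto simp: S.one_G)
    next
      case False
      have "s i k \<in> carrier (S.G i)" using s by (simp add: carP)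
      then show ?thesis using False unfolding S.carrier_G by blast
    qed
    then obtain \<beta> where \<beta>: "\<And>i k. S.based i (\<beta> i k)" "\<And>i k. S.cls i (\<beta> i k) = s i k"
      "\<And>i k. s i k = \<one>\<^bsub>S.G i\<^esub> \<Longrightarrow> \<beta> i k = (\<lambda>_. x i)" by metis
    have "finite {k. \<beta> i k \<noteq> (\<lambda>_. x i)}" for i
    proof (rule finite_subset)
      show "{k. \<beta> i k \<noteq> (\<lambda>_. x i)} \<subseteq> {k. s i k \<noteq> \<one>\<^bsub>S.G i\<^esub>}" using \<beta>(3) by blast
      show "finite {k. s i k \<noteq> \<one>\<^bsub>S.G i\<^esub>}" using s by (simp add: carP)
    qed
    then obtain f where f: "H.based f" "\<And>i k. S.homot i (component f i k) (\<beta> i k)"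
      using realize_components[of \<beta>] \<beta>(1) by blast
    have "S.cls i (component f i k) = S.cls i (\<beta> i k)" for i k
      using f(2)[of i k] S.cls_eq_iff[OF based_component[OF f(1)] \<beta>(1)] by blast
    then have "S.cls i (component f i k) = s i k" for i k by (simp add: \<beta>(2))
    then have "Theta (H.cls f) = s" by (simp add: Theta_cls[OF f(1)])
    then show "s \<in> Theta ` carrier H.G" using f(1) unfolding H.carrier_G by blast
  next
    fix A assume "A \<in> carrier H.G" and one: "Theta A = \<one>\<^bsub>P\<^esub>"
    then obtain f where f: "H.based f" "A = H.cls f" unfolding H.carrier_G by blast
    have "S.cls i (component f i k) = S.cls i (\<lambda>_. x i)" for i k
      using one unfolding f(2) Theta_cls[OF f(1)] oneP S.one_G by (metis (no_types))
    then have "S.homot i (component f i k) (\<lambda>_. x i)" for i k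
      using S.cls_eq_iff[OF based_component[OF f(1)] S.based_const] by simp
    then have "H.homot f (\<lambda>_. None)" by (rule nullhomotopic_of_components[OF f(1)])
    then show "A = \<one>\<^bsub>H.G\<^esub>" using f H.cls_eq_iff[OF f(1) H.based_const] by (simp add: H.one_G)
  qed
  then show ?thesis
    by (simp add: hawaiian_group_def hawaiian_earring_eq homotopy_group_eq P_def)
qed

end

theorem theorem2p10:
  fixes n :: nat and Xs :: "nat \<Rightarrow> 'a topology" and x :: "nat \<Rightarrow> 'a"
  assumes "n \<ge> 2"
    and "\<And>i. x i \<in> topspace (Xs i)"
    and "\<And>i. connected_upto (n - 1) (Xs i) (x i)"
    and "\<And>i. tikhonov_space (Xs i)"
    and "\<And>i. locally_strongly_contractible_at (Xs i) (x i)"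
    and "\<And>i. first_countable_at (Xs i) (x i)"
  shows "hawaiian_group n (weak_join Xs x) None \<cong>
           product_group UNIV (\<lambda>i. sum_group UNIV (\<lambda>k::nat. homotopy_group n (Xs i) (x i)))"
proof -
  interpret join_family n Xs x using assms by unfold_locales
  show ?thesis using Theta_iso unfolding is_iso_def by blast
qed

end
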